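(* Consider a branching random walk on $\mathbb{Z}$ satisfying Assumptions A–E (see context). Let $M_n=\max_{k\in\mathbb{Z}}L_n(k)$ be the height and let $u_n\in\arg\max_{k\in\mathbb{Z}}L_n(k)$ be the mode of the profile at time $n$. (a) There is an a.s. finite random variable $N$ such that for $n>N$ the mode $u_n$ equals one of the numbers $\lfloor u_n^*\rfloor$ or $\lceil u_n^*\rceil$, where $$u_n^*=\varphi'(0)n+\frac{W_\infty'(0)}{W_\infty(0)}-\frac{\kappa_3(0)}{2\sigma^2(0)}.$$ (b) Almost surely, $$\frac{\sqrt{2\pi n}\,\sigma(0)M_n}{W_\infty(0)m^n}=1-\frac{1}{2\sigma^2(0)n}\left(\frac{\kappa_3^2(0)}{6\sigma^4(0)}-\frac{\kappa_4(0)}{4\sigma^2(0)}+\theta_n^2+(\log W_\infty)''(0)\right)+o\!\left(\frac1n\right),$$ where $\theta_n=\min_{k\in\mathbb{Z}}|u_n^*-k|$.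
   Context: Branching random walk (BRW) on $\mathbb{Z}$: at time $0$ there is one particle at $0$. At each time $n\in\mathbb{N}_0$ every particle is replaced, independently of all other particles and of the past, by a random finite cluster of particles whose displacements relative to the parent are distributed according to a fixed point process $\zeta$ on $\mathbb{Z}$. $N_n$ is the number of particles at time $n$; $L_n(k)$ is the number of particles at site $k$ at time $n$; $\vartheta_n(\{k\})=\mathbb{E}L_n(k)$; $\varphi(\beta)=\log\mathbb{E}\big[\sum_k{\rm e}^{\beta k}L_1(k)\big]$. Assumptions: (A) $\{k:\vartheta_1(\{k\})>0\}$ has at least two elements. (B) $N_1\neq0$ a.s. and $m:=\mathbb{E}N_1\in(1,\infty)$. (C) $\varphi$ finite on an open interval containing $0$; $\mathcal{D}_\varphi$ the maximal open interval of finiteness. $\beta_-=\inf\{\beta\in\mathcal{D}_\varphi:\varphi'(\beta)\beta<\varphi(\beta)\}$, $\beta_+=\sup$ of the same set. $W_n(\beta)=\sum_k{\rm e}^{\beta k-\varphi(\beta)n}L_n(k)$. (D) There is $p>1$ with $\sup_{\beta\in K}\mathbb{E}[W_1(\beta)^p]<\infty$ for every compact $K\subset(\beta_-,\beta_+)$. (E) No $h\in\{2,3,\dots\}$, $a\in\mathbb{Z}$ with $\vartheta_1$ concentrated on $a+h\mathbb{Z}$. Then there are an open $V\subset\mathbb{C}$ containing $(\beta_-,\beta_+)$ and a random analytic function $W_\infty$ on $V$ with $W_n\to W_\infty$ a.s. uniformly on compacts of $V$; $W_\infty(0)>0$ a.s. $\kappa_j(\beta)=\varphi^{(j)}(\beta)$,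 $\sigma^2(\beta)=\varphi''(\beta)$, $\sigma(0)>0$. *)

theory Defs
  imports "HOL-Probability.Probability" "HOL-Library.Landau_Symbols"
begin

text \<open>Branching random walk via Ulam-Harris labels. The cluster (point process of
  displacements) attached to particle u is the random finite list zeta u of integers.
  A label u = [i_1,...,i_n] is alive if each i_(j+1) indexes a point in the cluster of
  its ancestor take j u; its position is the sum of the displacements along the path.\<close>

definition alive :: "(nat list \<Rightarrow> 'a \<Rightarrow> int list) \<Rightarrow> nat list \<Rightarrow> 'a \<Rightarrow> bool" where
  "alive \<zeta> u \<omega> \<longleftrightarrow> (\<forall>j<length u. u ! j < length (\<zeta> (take j u) \<omega>))"

definition pos :: "(nat list \<Rightarrow> 'a \<Rightarrow> int list) \<Rightarrow> nat list \<Rightarrow> 'a \<Rightarrow> int" where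
  "pos \<zeta> u \<omega> = (\<Sum>j<length u. \<zeta> (take j u) \<omega> ! (u ! j))"

definition gen :: "(nat list \<Rightarrow> 'a \<Rightarrow> int list) \<Rightarrow> nat \<Rightarrow> 'a \<Rightarrow> nat list set" where
  "gen \<zeta> n \<omega> = {u. length u = n \<and> alive \<zeta> u \<omega>}"

definition L :: "(nat list \<Rightarrow> 'a \<Rightarrow> int list) \<Rightarrow> nat \<Rightarrow> int \<Rightarrow> 'a \<Rightarrow> nat" where
  "L \<zeta> n k \<omega> = card {u \<in> gen \<zeta> n \<omega>. pos \<zeta> u \<omega> = k}"

definition Npop :: "(nat list \<Rightarrow> 'a \<Rightarrow> int list) \<Rightarrow> nat \<Rightarrow> 'a \<Rightarrow> nat" where
  "Npop \<zeta> n \<omega> = card (gen \<zeta> n \<omega>)"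

text \<open>sum_k f(k) L_n(k) (finitely many nonzero terms).\<close>
definition profile_sum :: "(nat list \<Rightarrow> 'a \<Rightarrow> int list) \<Rightarrow> nat \<Rightarrow> (int \<Rightarrow> real) \<Rightarrow> 'a \<Rightarrow> real" where
  "profile_sum \<zeta> n f \<omega> = (\<Sum>k\<in>{k. L \<zeta> n k \<omega> \<noteq> 0}. f k * real (L \<zeta> n k \<omega>))"

definition vartheta1 :: "'a measure \<Rightarrow> (nat list \<Rightarrow> 'a \<Rightarrow> int list) \<Rightarrow> int \<Rightarrow> ennreal" where
  "vartheta1 M \<zeta> k = (\<integral>\<^sup>+\<omega>. of_nat (L \<zeta> 1 k \<omega>) \<partial>M)"

definition mean_offspring :: "'a measure \<Rightarrow> (nat list \<Rightarrow> 'a \<Rightarrow> int list) \<Rightarrow> real" where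
  "mean_offspring M \<zeta> = enn2real (\<integral>\<^sup>+\<omega>. of_nat (Npop \<zeta> 1 \<omega>) \<partial>M)"

definition laplace :: "'a measure \<Rightarrow> (nat list \<Rightarrow> 'a \<Rightarrow> int list) \<Rightarrow> real \<Rightarrow> ennreal" where
  "laplace M \<zeta> \<beta> = (\<integral>\<^sup>+\<omega>. ennreal (profile_sum \<zeta> 1 (\<lambda>k. exp (\<beta> * real_of_int k)) \<omega>) \<partial>M)"

definition phi :: "'a measure \<Rightarrow> (nat list \<Rightarrow> 'a \<Rightarrow> int list) \<Rightarrow> real \<Rightarrow> real" where
  "phi M \<zeta> \<beta> = ln (enn2real (laplace M \<zeta> \<beta>))"

definition Dphi :: "'a measure \<Rightarrow> (nat list \<Rightarrow> 'a \<Rightarrow> int list) \<Rightarrow> real set" where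
  "Dphi M \<zeta> = connected_component_set (interior {\<beta>. laplace M \<zeta> \<beta> < \<infinity>}) 0"

definition betaset :: "'a measure \<Rightarrow> (nat list \<Rightarrow> 'a \<Rightarrow> int list) \<Rightarrow> real set" where
  "betaset M \<zeta> = {\<beta> \<in> Dphi M \<zeta>. deriv (phi M \<zeta>) \<beta> * \<beta> < phi M \<zeta> \<beta>}"

definition beta_minus :: "'a measure \<Rightarrow> (nat list \<Rightarrow> 'a \<Rightarrow> int list) \<Rightarrow> ereal" where
  "beta_minus M \<zeta> = Inf (ereal ` betaset M \<zeta>)"

definition beta_plus :: "'a measure \<Rightarrow> (nat list \<Rightarrow> 'a \<Rightarrow> int list) \<Rightarrow> ereal" where
  "beta_plus M \<zeta> = Sup (ereal ` betaset M \<zeta>)"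

definition Wn :: "'a measure \<Rightarrow> (nat list \<Rightarrow> 'a \<Rightarrow> int list) \<Rightarrow> nat \<Rightarrow> real \<Rightarrow> 'a \<Rightarrow> real" where
  "Wn M \<zeta> n \<beta> \<omega> = profile_sum \<zeta> n (\<lambda>k. exp (\<beta> * real_of_int k - phi M \<zeta> \<beta> * real n)) \<omega>"

definition height :: "(nat list \<Rightarrow> 'a \<Rightarrow> int list) \<Rightarrow> nat \<Rightarrow> 'a \<Rightarrow> nat" where
  "height \<zeta> n \<omega> = Sup (range (\<lambda>k. L \<zeta> n k \<omega>))"

definition kappa :: "'a measure \<Rightarrow> (nat list \<Rightarrow> 'a \<Rightarrow> int list) \<Rightarrow> nat \<Rightarrow> real" where
  "kappa M \<zeta> j = (deriv ^^ j) (phi M \<zeta>) 0"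

definition dist_Z :: "real \<Rightarrow> real" where
  "dist_Z x = (INF k::int. \<bar>x - real_of_int k\<bar>)"

end

theory Submission
  imports Defs "HOL-Complex_Analysis.Complex_Analysis" "HOL-Real_Asymp.Real_Asymp"
begin

text \<open>
  Let S_n(z) be the sum of exp (z X_u) over the particles u of generation n, X_u their positions,
  m(z) = E S_1(z) and a = m(0). Cutting offspring clusters off at size a^(n/8), using orthogonality
  in L2 below the cut and the p-th moment in L1 above it, one gets
  E |S_(n+1)(z) - m(z) S_n(z)| <= C (rho a)^n with rho < 1 on a strip |Re z| <= r. Two consequences
  hold almost surely with exponential rates: by Cauchy's formula on a circle, S_n / m^n converges
  uniformly near 0 to a holomorphic W; and the integral of |S_n(it)| over eta < |t| <= pi is
  negligible against a^n, because aperiodicity makes |m(it)| < a there. Fourier inversion then turns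
  L_n(k) into the integral of exp (- ikt) W(it) m(it)^n over |t| <= eta. Its second-order Edgeworth
  expansion shows that, for bounded k - phi'(0) n, the normalised profile is
  1 - (c + (k - u_n^*)^2) / (2 sigma^2 n) + O(n^(-3/2)), while a cruder bound excludes all other k,
  so that the maximum sits at an integer neighbour of u_n^*. That W(0) > 0 follows from a
  comparison of the tree with its two first subtrees.
\<close>

section \<open>Exponential sums over a generation\<close>

text \<open>Bounds in mean at each z give no control over uncountably many z, so they are integrated
  over a circle or a range of frequencies before an almost sure statement is drawn. The given
  \<open>Winf\<close> is only a pointwise limit on a real interval; the holomorphic limit is built
  independently and identified with it there, which gives access to its derivatives. Locating the
  mode needs two estimates of different reach: a precise expansion for bounded displacement y, and a
  bound uniform over all sites. The latter must not lose a full n^(-1/2), since near its top the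
  profile drops only by order 1/n per unit step; its first-order correction is therefore kept with
  the factor min(1, |y| s), where s is the scale n^(-1/2), so that the quadratic drop dominates it
  as soon as |y| is large.\<close>

definition cexpi :: "complex \<Rightarrow> int \<Rightarrow> complex" where
  "cexpi z k = exp (z * of_int k)"

definition offspring_sum :: "complex \<Rightarrow> int list \<Rightarrow> complex" where
  "offspring_sum z c = (\<Sum>k\<leftarrow>c. cexpi z k)"

definition gen_sum :: "(nat list \<Rightarrow> 'a \<Rightarrow> int list) \<Rightarrow> complex \<Rightarrow> nat \<Rightarrow> 'a \<Rightarrow> complex" where
  "gen_sum \<zeta> z n \<omega> = (\<Sum>u\<in>gen \<zeta> n \<omega>. cexpi z (pos \<zeta> u \<omega>))"

text \<open>Zero on dead labels, so that the random set \<open>gen\<close> can be replaced by a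
  deterministic index set in sums.\<close>

definition weight :: "(nat list \<Rightarrow> 'a \<Rightarrow> int list) \<Rightarrow> complex \<Rightarrow> nat list \<Rightarrow> 'a \<Rightarrow> complex" where
  "weight \<zeta> z u \<omega> = (if alive \<zeta> u \<omega> then cexpi z (pos \<zeta> u \<omega>) else 0)"

lemma norm_cexpi: "norm (cexpi z k) = exp (Re z * of_int k)"
  by (simp add: cexpi_def norm_exp)

lemma cexpi_add: "cexpi z (j + k) = cexpi z j * cexpi z k"
  by (simp add: cexpi_def ring_distribs exp_add)

lemma cexpi_of_real: "cexpi (of_real x) k = of_real (exp (x * of_int k))"
  by (simp add: cexpi_def flip: exp_of_real)

lemma alive_snoc: "alive \<zeta> (u @ [i]) \<omega> \<longleftrightarrow> alive \<zeta> u \<omega> \<and> i < length (\<zeta> u \<omega>)"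
  by (auto simp: alive_def nth_append less_Suc_eq)

lemma pos_snoc: "pos \<zeta> (u @ [i]) \<omega> = pos \<zeta> u \<omega> + \<zeta> u \<omega> ! i"
  by (simp add: pos_def nth_append)

lemma gen_0: "gen \<zeta> 0 \<omega> = {[]}"
  by (auto simp: gen_def alive_def)

lemma gen_Suc: "gen \<zeta> (Suc n) \<omega> = (\<Union>u\<in>gen \<zeta> n \<omega>. (\<lambda>i. u @ [i]) ` {..<length (\<zeta> u \<omega>)})"
proof (intro equalityI subsetI)
  fix v assume v: "v \<in> gen \<zeta> (Suc n) \<omega>"
  then show "v \<in> (\<Union>u\<in>gen \<zeta> n \<omega>. (\<lambda>i. u @ [i]) ` {..<length (\<zeta> u \<omega>)})"
    by (cases v rule: rev_cases) (auto simp: gen_def alive_snoc)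
qed (auto simp: gen_def alive_snoc)

lemma finite_gen: "finite (gen \<zeta> n \<omega>)"
  by (induction n) (auto simp: gen_0 gen_Suc)

lemma sum_gen_Suc:
  fixes f :: "nat list \<Rightarrow> 'b::comm_monoid_add"
  shows "(\<Sum>v\<in>gen \<zeta> (Suc n) \<omega>. f v) = (\<Sum>u\<in>gen \<zeta> n \<omega>. \<Sum>i<length (\<zeta> u \<omega>). f (u @ [i]))"
  unfolding gen_Suc
  by (subst sum.UNION_disjoint) (auto simp: finite_gen sum.reindex inj_on_def)

lemma sum_list_map_nth: "(\<Sum>k\<leftarrow>c. f k) = (\<Sum>i<length c. f (c ! i))"
  by (simp add: sum_list_sum_nth atLeast0LessThan)

lemma gen_sum_0: "gen_sum \<zeta> z 0 \<omega> = 1"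
  by (simp add: gen_sum_def gen_0 pos_def cexpi_def)

lemma gen_sum_Suc:
  "gen_sum \<zeta> z (Suc n) \<omega> = (\<Sum>u\<in>gen \<zeta> n \<omega>. cexpi z (pos \<zeta> u \<omega>) * offspring_sum z (\<zeta> u \<omega>))"
  unfolding gen_sum_def sum_gen_Suc offspring_sum_def sum_list_map_nth
  by (simp add: pos_snoc cexpi_add sum_distrib_left)

lemma gen_sum_1: "gen_sum \<zeta> z 1 \<omega> = offspring_sum z (\<zeta> [] \<omega>)"
  using gen_sum_Suc[of \<zeta> z 0 \<omega>] by (simp add: gen_0 pos_def cexpi_def)

text \<open>Only the clusters of strict ancestors of u enter, and a dead label produces a zero
  factor. This is the source of the independence between the weight of u and the cluster attached to
  u.\<close>

lemma weight_eq_prod: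
  "weight \<zeta> z u \<omega> = (\<Prod>j<length u. let c = \<zeta> (take j u) \<omega> in if u ! j < length c then cexpi z (c ! (u ! j)) else 0)"
proof (cases "alive \<zeta> u \<omega>")
  case True
  then show ?thesis
    by (simp add: weight_def alive_def Let_def pos_def cexpi_def sum_distrib_left exp_sum)
next
  case False
  then show ?thesis by (auto simp: weight_def alive_def Let_def intro!: prod_zero[symmetric])
qed

text \<open>Second moments at z become first moments at 2z. This is why the strip later has
  half-width r < \<delta> / 2.\<close>

lemma norm_weight_sq: "(norm (weight \<zeta> z u \<omega>))\<^sup>2 = norm (weight \<zeta> (2 * z) u \<omega>)"
  by (simp add: weight_def norm_cexpi power2_eq_square flip: exp_add)

lemma sum_gen_eq_sum_weight:
  assumes "finite F" "gen \<zeta> n \<omega> \<subseteq> F" "F \<subseteq> {u. length u = n}"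
  shows "(\<Sum>u\<in>gen \<zeta> n \<omega>. cexpi z (pos \<zeta> u \<omega>) * f u) = (\<Sum>u\<in>F. weight \<zeta> z u \<omega> * f u)"
proof -
  have "(\<Sum>u\<in>gen \<zeta> n \<omega>. cexpi z (pos \<zeta> u \<omega>) * f u) = (\<Sum>u\<in>gen \<zeta> n \<omega>. weight \<zeta> z u \<omega> * f u)"
    by (intro sum.cong) (auto simp: weight_def gen_def)
  also have "\<dots> = (\<Sum>u\<in>F. weight \<zeta> z u \<omega> * f u)"
    using assms by (intro sum.mono_neutral_left) (auto simp: gen_def weight_def)
  finally show ?thesis .
qed

text \<open>For a fixed sample point the generation is finite, so labels with entries below j
  eventually exhaust it and the sequence is eventually constant. This supplies both measurability
  and the passage from finite label sets to the full generation.\<close>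

lemma gen_sum_limit:
  "(\<lambda>j. \<Sum>u\<in>{u. set u \<subseteq> {..<j} \<and> length u = n}. weight \<zeta> z u \<omega> * f u) \<longlonglongrightarrow>
     (\<Sum>u\<in>gen \<zeta> n \<omega>. cexpi z (pos \<zeta> u \<omega>) * f u)"
proof (rule tendsto_eventually)
  obtain m where m: "\<And>u. u \<in> gen \<zeta> n \<omega> \<Longrightarrow> set u \<subseteq> {..<m}"
  proof -
    have "finite (\<Union>u\<in>gen \<zeta> n \<omega>. set u)" by (simp add: finite_gen)
    then obtain m where "(\<Union>u\<in>gen \<zeta> n \<omega>. set u) \<subseteq> {..<m}"
      by (meson finite_nat_iff_bounded)
    then show ?thesis by (intro that[of m]) blast
  qed
  show "\<forall>\<^sub>F j in sequentially. (\<Sum>u\<in>{u. set u \<subseteq> {..<j} \<and> length u = n}. weight \<zeta> z u \<omega> * f u) =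
     (\<Sum>u\<in>gen \<zeta> n \<omega>. cexpi z (pos \<zeta> u \<omega>) * f u)"
    using eventually_ge_at_top[of m]
  proof eventually_elim
    case (elim j)
    have "gen \<zeta> n \<omega> \<subseteq> {u. set u \<subseteq> {..<j} \<and> length u = n}"
    proof
      fix u assume u: "u \<in> gen \<zeta> n \<omega>"
      with m[OF u] elim show "u \<in> {u. set u \<subseteq> {..<j} \<and> length u = n}"
        by (auto simp: gen_def)
    qed
    then show ?case
      by (intro sum_gen_eq_sum_weight[symmetric] finite_lists_length_eq) auto
  qed
qed

lemma measurable_cnj[measurable]: "cnj \<in> borel_measurable borel"
  by (intro borel_measurable_continuous_onI continuous_intros)

section \<open>Independence along labels and first moments\<close>

locale branching_random_walk = prob_space M for M :: "'a measure" +
  fixes \<zeta> :: "nat list \<Rightarrow> 'a \<Rightarrow> int list"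
  assumes indep: "indep_vars (\<lambda>_. count_space UNIV) \<zeta> UNIV"
    and ident: "\<And>v. distr M (count_space UNIV) (\<zeta> v) = distr M (count_space UNIV) (\<zeta> [])"
begin

lemma measurable_zeta[measurable]: "\<zeta> v \<in> M \<rightarrow>\<^sub>M count_space UNIV"
  using indep by (auto simp: indep_vars_def)

lemma measurable_alive[measurable]: "Measurable.pred M (alive \<zeta> u)"
  unfolding alive_def by measurable

lemma measurable_pos[measurable]: "pos \<zeta> u \<in> M \<rightarrow>\<^sub>M count_space UNIV"
proof -
  have "(\<lambda>\<omega>. \<Sum>j<m. \<zeta> (take j u) \<omega> ! (u ! j)) \<in> M \<rightarrow>\<^sub>M count_space UNIV" for m
    by (induction m) auto
  then show ?thesis by (simp add: pos_def[abs_def])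
qed

lemma measurable_weight[measurable]: "weight \<zeta> z u \<in> borel_measurable M"
  unfolding weight_def by measurable

lemma distr_eq_integral:
  fixes g :: "int list \<Rightarrow> 'b::{banach, second_countable_topology}"
  shows "expectation (\<lambda>\<omega>. g (\<zeta> v \<omega>)) = expectation (\<lambda>\<omega>. g (\<zeta> [] \<omega>))"
  using integral_distr[of "\<zeta> v" M "count_space UNIV" g] integral_distr[of "\<zeta> []" M "count_space UNIV" g]
  by (simp add: ident[of v])

lemma distr_eq_nn_integral:
  "(\<integral>\<^sup>+\<omega>. h (\<zeta> v \<omega>) \<partial>M) = (\<integral>\<^sup>+\<omega>. h (\<zeta> [] \<omega>) \<partial>M)"
  using nn_integral_distr[of "\<zeta> v" M "count_space UNIV" h] nn_integral_distr[of "\<zeta> []" M "count_space UNIV" h]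
  by (simp add: ident[of v])

lemma indep_var_disjoint_labels:
  fixes f :: "(nat list \<Rightarrow> int list) \<Rightarrow> 'c::topological_space"
  assumes "A \<inter> B = {}" "f \<in> PiM A (\<lambda>_. count_space UNIV) \<rightarrow>\<^sub>M borel" "g \<in> PiM B (\<lambda>_. count_space UNIV) \<rightarrow>\<^sub>M borel"
  shows "indep_var borel (\<lambda>\<omega>. f (\<lambda>v\<in>A. \<zeta> v \<omega>)) borel (\<lambda>\<omega>. g (\<lambda>v\<in>B. \<zeta> v \<omega>))"
  using indep_var_compose[OF indep_var_restrict[OF indep assms(1)] assms(2,3)] by (simp add: comp_def)

lemma measurable_coord:
  assumes "u \<in> A"
  shows "(\<lambda>\<xi>. h (\<xi> u)) \<in> PiM A (\<lambda>_. count_space UNIV) \<rightarrow>\<^sub>M (borel :: 'c::topological_space measure)"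
  by (rule measurable_compose[OF measurable_component_singleton]) (use assms in auto)

text \<open>Instantiating \<open>weight\<close> with the coordinate maps turns it into a function of
  a family of clusters, which can be composed with the independent restrictions of \<zeta> to
  disjoint label sets.\<close>

lemma measurable_weight_coord:
  assumes "\<And>j. j < length u \<Longrightarrow> take j u \<in> A"
  shows "weight (\<lambda>v \<xi>. \<xi> v) z u \<in> borel_measurable (PiM A (\<lambda>_. count_space UNIV))"
proof -
  have "(\<lambda>\<xi>. \<xi> (take j u)) \<in> PiM A (\<lambda>_. count_space UNIV) \<rightarrow>\<^sub>M count_space UNIV" if "j < length u" for j
    using assms[OF that] by measurable
  then have "(\<lambda>\<xi>. let c = \<xi> (take j u) in if u ! j < length c then cexpi z (c ! (u ! j)) else 0)
      \<in> borel_measurable (PiM A (\<lambda>_. count_space UNIV))" if "j < length u" for j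
    by (rule measurable_compose) (auto intro: that)
  then have "(\<lambda>\<xi>. \<Prod>j<length u. let c = \<xi> (take j u) in if u ! j < length c then cexpi z (c ! (u ! j)) else 0)
      \<in> borel_measurable (PiM A (\<lambda>_. count_space UNIV))"
    by (intro borel_measurable_prod) auto
  then show ?thesis unfolding weight_eq_prod[abs_def] .
qed

lemma weight_coord:
  assumes "\<And>j. j < length u \<Longrightarrow> take j u \<in> A"
  shows "weight (\<lambda>v \<xi>. \<xi> v) z u (\<lambda>v\<in>A. \<zeta> v \<omega>) = weight \<zeta> z u \<omega>"
  unfolding weight_eq_prod using assms by (auto intro!: prod.cong)

lemma case_bool_borel: "case_bool borel borel = (\<lambda>_. borel)"
  by (auto simp: fun_eq_iff split: bool.split)

text \<open>The weight reads strict ancestors of u, all shorter than u, so it is independent of the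
  cluster at u itself.\<close>

lemma nn_integral_weight_mult:
  "(\<integral>\<^sup>+\<omega>. ennreal (norm (weight \<zeta> z u \<omega>)) * h (\<zeta> u \<omega>) \<partial>M)
    = (\<integral>\<^sup>+\<omega>. ennreal (norm (weight \<zeta> z u \<omega>)) \<partial>M) * (\<integral>\<^sup>+\<omega>. h (\<zeta> [] \<omega>) \<partial>M)"
proof -
  let ?A = "{take j u | j. j < length u}"
  have 1: "\<And>j. j < length u \<Longrightarrow> take j u \<in> ?A" by auto
  have 2: "?A \<inter> {u} = {}"
  proof -
    have "take j u \<noteq> u" if "j < length u" for j
      using that by (metis length_take min.absorb4 nat_neq_iff)
    then show ?thesis by blast
  qed
  have wm: "(\<lambda>\<xi>. ennreal (norm (weight (\<lambda>v \<xi>. \<xi> v) z u \<xi>))) \<in> borel_measurable (PiM ?A (\<lambda>_. count_space UNIV))"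
    using measurable_weight_coord[OF 1] by simp
  have hm: "(\<lambda>\<xi>. h (\<xi> u)) \<in> borel_measurable (PiM {u} (\<lambda>_. count_space UNIV))"
    by (rule measurable_coord) auto
  have "indep_var borel (\<lambda>\<omega>. ennreal (norm (weight (\<lambda>v \<xi>. \<xi> v) z u (\<lambda>v\<in>?A. \<zeta> v \<omega>))))
      borel (\<lambda>\<omega>. h ((\<lambda>v\<in>{u}. \<zeta> v \<omega>) u))"
    by (rule indep_var_disjoint_labels[OF 2])
       (simp_all only: restrict_apply singleton_iff if_True wm hm)
  then have ind: "indep_var borel (\<lambda>\<omega>. ennreal (norm (weight \<zeta> z u \<omega>))) borel (\<lambda>\<omega>. h (\<zeta> u \<omega>))"
    by (simp only: weight_coord[OF 1] restrict_apply singleton_iff simp_thms if_True)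
  have "(\<integral>\<^sup>+\<omega>. ennreal (norm (weight \<zeta> z u \<omega>)) * h (\<zeta> u \<omega>) \<partial>M)
    = (\<integral>\<^sup>+\<omega>. (\<Prod>b\<in>UNIV. case_bool (\<lambda>\<omega>. ennreal (norm (weight \<zeta> z u \<omega>))) (\<lambda>\<omega>. h (\<zeta> u \<omega>)) b \<omega>) \<partial>M)"
    by (simp add: UNIV_bool mult.commute)
  also have "\<dots> = (\<Prod>b\<in>UNIV. \<integral>\<^sup>+\<omega>. case_bool (\<lambda>\<omega>. ennreal (norm (weight \<zeta> z u \<omega>))) (\<lambda>\<omega>. h (\<zeta> u \<omega>)) b \<omega> \<partial>M)"
    using ind unfolding indep_var_def case_bool_borel
    by (intro indep_vars_nn_integral) (auto split: bool.split)
  also have "\<dots> = (\<integral>\<^sup>+\<omega>. ennreal (norm (weight \<zeta> z u \<omega>)) \<partial>M) * (\<integral>\<^sup>+\<omega>. h (\<zeta> u \<omega>) \<partial>M)"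
    by (simp add: UNIV_bool mult.commute)
  finally show ?thesis unfolding distr_eq_nn_integral[of h u] .
qed

text \<open>An extended nonnegative integral, so that the recursion in n holds before any finiteness
  is known. It is the Laplace transform \<open>laplace\<close>, as \<open>laplace_eq_mgf\<close>
  shows.\<close>

definition mgf :: "real \<Rightarrow> ennreal" where
  "mgf x = (\<integral>\<^sup>+\<omega>. ennreal (Re (offspring_sum (of_real x) (\<zeta> [] \<omega>))) \<partial>M)"

definition mean_weight :: "real \<Rightarrow> nat \<Rightarrow> ennreal" where
  "mean_weight x n = (\<integral>\<^sup>+\<omega>. ennreal (Re (gen_sum \<zeta> (of_real x) n \<omega>)) \<partial>M)"

lemma nn_integral_gen:
  "(\<integral>\<^sup>+u. ennreal (norm (weight \<zeta> z u \<omega>)) * indicator {u. length u = n} u * h u \<partial>count_space UNIV)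
    = (\<Sum>u\<in>gen \<zeta> n \<omega>. ennreal (exp (Re z * pos \<zeta> u \<omega>)) * h u)"
proof -
  have "(\<integral>\<^sup>+u. ennreal (norm (weight \<zeta> z u \<omega>)) * indicator {u. length u = n} u * h u \<partial>count_space UNIV)
     = (\<integral>\<^sup>+u. ennreal (norm (weight \<zeta> z u \<omega>)) * h u \<partial>count_space (gen \<zeta> n \<omega>))"
    by (subst nn_integral_count_space_indicator)
       (auto intro!: nn_integral_cong simp: gen_def indicator_def weight_def)
  also have "\<dots> = (\<Sum>u\<in>gen \<zeta> n \<omega>. ennreal (norm (weight \<zeta> z u \<omega>)) * h u)"
    by (rule nn_integral_count_space_finite[OF finite_gen])
  also have "\<dots> = (\<Sum>u\<in>gen \<zeta> n \<omega>. ennreal (exp (Re z * pos \<zeta> u \<omega>)) * h u)"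
    by (intro sum.cong) (auto simp: gen_def weight_def norm_cexpi)
  finally show ?thesis .
qed

text \<open>The sum over the random generation is an integral over all labels against counting
  measure. Labels are countable, so Tonelli exchanges it with the expectation, and the factorisation
  applies label by label.\<close>

lemma nn_integral_gen_mult:
  "(\<integral>\<^sup>+\<omega>. (\<Sum>u\<in>gen \<zeta> n \<omega>. ennreal (exp (Re z * pos \<zeta> u \<omega>)) * h (\<zeta> u \<omega>)) \<partial>M)
    = (\<integral>\<^sup>+u. (\<integral>\<^sup>+\<omega>. ennreal (norm (weight \<zeta> z u \<omega>)) \<partial>M) * indicator {u. length u = n} u \<partial>count_space UNIV)
       * (\<integral>\<^sup>+\<omega>. h (\<zeta> [] \<omega>) \<partial>M)"
proof -
  interpret C: sigma_finite_measure "count_space (UNIV :: nat list set)"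
    by (rule sigma_finite_measure_count_space)
  interpret P: pair_sigma_finite "count_space (UNIV :: nat list set)" M ..
  have meas: "(\<lambda>(u, \<omega>). ennreal (norm (weight \<zeta> z u \<omega>)) * indicator {u. length u = n} u * h (\<zeta> u \<omega>))
      \<in> borel_measurable (count_space UNIV \<Otimes>\<^sub>M M)"
    by (rule measurable_pair_measure_countable1) auto
  have "(\<integral>\<^sup>+\<omega>. (\<Sum>u\<in>gen \<zeta> n \<omega>. ennreal (exp (Re z * pos \<zeta> u \<omega>)) * h (\<zeta> u \<omega>)) \<partial>M)
     = (\<integral>\<^sup>+\<omega>. \<integral>\<^sup>+u. ennreal (norm (weight \<zeta> z u \<omega>)) * indicator {u. length u = n} u * h (\<zeta> u \<omega>) \<partial>count_space UNIV \<partial>M)"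
    by (simp add: nn_integral_gen)
  also have "\<dots> = (\<integral>\<^sup>+u. \<integral>\<^sup>+\<omega>. ennreal (norm (weight \<zeta> z u \<omega>)) * indicator {u. length u = n} u * h (\<zeta> u \<omega>) \<partial>M \<partial>count_space UNIV)"
    using P.Fubini'[OF meas] by simp
  also have "\<dots> = (\<integral>\<^sup>+u. (\<integral>\<^sup>+\<omega>. ennreal (norm (weight \<zeta> z u \<omega>)) \<partial>M) * indicator {u. length u = n} u * (\<integral>\<^sup>+\<omega>. h (\<zeta> [] \<omega>) \<partial>M) \<partial>count_space UNIV)"
    by (intro nn_integral_cong) (auto simp: indicator_def nn_integral_weight_mult)
  finally show ?thesis by (simp add: nn_integral_multc)
qed

lemma Re_offspring_sum: "Re (offspring_sum (of_real x) c) = (\<Sum>k\<leftarrow>c. exp (x * of_int k))"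
  by (induction c) (simp_all add: offspring_sum_def cexpi_of_real)

lemma Re_offspring_sum_nonneg: "0 \<le> Re (offspring_sum (of_real x) c)"
  unfolding Re_offspring_sum by (rule sum_list_nonneg) auto

lemma Re_gen_sum: "Re (gen_sum \<zeta> (of_real x) n \<omega>) = (\<Sum>u\<in>gen \<zeta> n \<omega>. exp (x * pos \<zeta> u \<omega>))"
  by (simp add: gen_sum_def cexpi_of_real)

lemma ennreal_Re_gen_sum: "ennreal (Re (gen_sum \<zeta> (of_real x) n \<omega>)) = (\<Sum>u\<in>gen \<zeta> n \<omega>. ennreal (exp (x * pos \<zeta> u \<omega>)))"
  unfolding Re_gen_sum by (simp add: sum_ennreal)

lemma sum_weights_eq_mean_weight:
  "(\<integral>\<^sup>+u. (\<integral>\<^sup>+\<omega>. ennreal (norm (weight \<zeta> z u \<omega>)) \<partial>M) * indicator {u. length u = n} u \<partial>count_space UNIV) = mean_weight (Re z) n"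
  using nn_integral_gen_mult[where n=n and z=z and h="\<lambda>_. 1"]
  unfolding mean_weight_def ennreal_Re_gen_sum by (simp only: nn_integral_const emeasure_space_1 mult_1_right)

lemma mean_weight_Suc: "mean_weight x (Suc n) = mean_weight x n * mgf x"
proof -
  have 1: "ennreal (Re (gen_sum \<zeta> (of_real x) (Suc n) \<omega>)) =
     (\<Sum>u\<in>gen \<zeta> n \<omega>. ennreal (exp (Re (of_real x) * pos \<zeta> u \<omega>)) * ennreal (Re (offspring_sum (of_real x) (\<zeta> u \<omega>))))" for \<omega>
  proof -
    have "Re (gen_sum \<zeta> (of_real x) (Suc n) \<omega>) = (\<Sum>u\<in>gen \<zeta> n \<omega>. exp (Re (of_real x) * pos \<zeta> u \<omega>) * Re (offspring_sum (of_real x) (\<zeta> u \<omega>)))"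
      unfolding gen_sum_Suc by (simp add: cexpi_of_real)
    then show ?thesis
      by (simp only: ennreal_mult[OF exp_ge_zero Re_offspring_sum_nonneg, symmetric])
         (intro sum_ennreal[symmetric] mult_nonneg_nonneg exp_ge_zero Re_offspring_sum_nonneg)
  qed
  have 2: "mean_weight x (Suc n) = mean_weight (Re (of_real x)) n * mgf x"
    unfolding mean_weight_def[of x] 1
    by (subst nn_integral_gen_mult) (simp only: sum_weights_eq_mean_weight mgf_def)
  then show ?thesis by simp
qed

lemma mean_weight_eq: "mean_weight x n = mgf x ^ n"
proof (induction n)
  case 0
  then show ?case by (simp add: mean_weight_def gen_sum_0 emeasure_space_1)
next
  case (Suc n)
  then show ?case by (simp add: mult.commute mean_weight_Suc)
qed

lemmas sum_mean_weights = sum_weights_eq_mean_weight[unfolded mean_weight_eq]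

lemma sum_mean_weights_finite:
  assumes "finite F" "F \<subseteq> {u. length u = n}"
  shows "(\<Sum>u\<in>F. \<integral>\<^sup>+\<omega>. ennreal (norm (weight \<zeta> z u \<omega>)) \<partial>M) \<le> mgf (Re z) ^ n"
proof -
  have "(\<Sum>u\<in>F. \<integral>\<^sup>+\<omega>. ennreal (norm (weight \<zeta> z u \<omega>)) \<partial>M)
     = (\<integral>\<^sup>+u. (\<integral>\<^sup>+\<omega>. ennreal (norm (weight \<zeta> z u \<omega>)) \<partial>M) * indicator F u \<partial>count_space UNIV)"
    by (subst nn_integral_count_space_finite[OF assms(1), symmetric])
       (simp add: nn_integral_count_space_indicator)
  also have "\<dots> \<le> mgf (Re z) ^ n"
    unfolding sum_mean_weights[symmetric] using assms(2)
    by (intro nn_integral_mono mult_left_mono) (auto simp: indicator_def)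
  finally show ?thesis .
qed

lemma integrable_weight:
  assumes "mgf (Re z) < \<infinity>"
  shows "integrable M (weight \<zeta> z u)"
proof (rule integrableI_bounded)
  have "(\<integral>\<^sup>+\<omega>. ennreal (norm (weight \<zeta> z u \<omega>)) \<partial>M) \<le> mgf (Re z) ^ length u"
    using sum_mean_weights_finite[of "{u}" "length u" z] by simp
  also have "\<dots> < \<infinity>" using assms by (simp add: power_less_top_ennreal)
  finally show "(\<integral>\<^sup>+\<omega>. ennreal (norm (weight \<zeta> z u \<omega>)) \<partial>M) < \<infinity>" .
qed auto

lemma integrable_weight_mult:
  assumes "mgf (2 * Re z) < \<infinity>"
  shows "integrable M (\<lambda>\<omega>. weight \<zeta> z u \<omega> * cnj (weight \<zeta> z v \<omega>))"
proof (rule Bochner_Integration.integrable_bound)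
  have i: "integrable M (\<lambda>\<omega>. (norm (weight \<zeta> z w \<omega>))\<^sup>2)" for w
    unfolding norm_weight_sq by (intro integrable_norm integrable_weight) (use assms in simp)
  show "integrable M (\<lambda>\<omega>. (norm (weight \<zeta> z u \<omega>))\<^sup>2 + (norm (weight \<zeta> z v \<omega>))\<^sup>2)"
    by (intro Bochner_Integration.integrable_add i)
  have "a * b \<le> a\<^sup>2 + b\<^sup>2" if "a \<ge> 0" "b \<ge> 0" for a b :: real
    using sum_squares_bound[of a b] mult_nonneg_nonneg[OF that] by linarith
  then show "AE \<omega> in M. norm (weight \<zeta> z u \<omega> * cnj (weight \<zeta> z v \<omega>)) \<le>
      norm ((norm (weight \<zeta> z u \<omega>))\<^sup>2 + (norm (weight \<zeta> z v \<omega>))\<^sup>2)"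
    by (intro AE_I2) (simp add: norm_mult)
qed measurable

section \<open>Second moments, truncation and the one-step estimate\<close>

lemma indep_offspring:
  fixes g :: "int list \<Rightarrow> complex"
  assumes "u \<noteq> v" "\<And>c. norm (g c) \<le> B"
  shows "expectation (\<lambda>\<omega>. g (\<zeta> u \<omega>) * cnj (g (\<zeta> v \<omega>))) = expectation (\<lambda>\<omega>. g (\<zeta> [] \<omega>)) * cnj (expectation (\<lambda>\<omega>. g (\<zeta> [] \<omega>)))"
proof -
  have "indep_var borel (\<lambda>\<omega>. (\<lambda>\<xi>. g (\<xi> u)) (\<lambda>w\<in>{u}. \<zeta> w \<omega>)) borel (\<lambda>\<omega>. (\<lambda>\<xi>. cnj (g (\<xi> v))) (\<lambda>w\<in>{v}. \<zeta> w \<omega>))"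
    using assms(1)
    by (intro indep_var_disjoint_labels measurable_coord) auto
  then have ind: "indep_var borel (\<lambda>\<omega>. g (\<zeta> u \<omega>)) borel (\<lambda>\<omega>. cnj (g (\<zeta> v \<omega>)))"
    by simp
  have "integrable M (\<lambda>\<omega>. g (\<zeta> w \<omega>))" for w
    by (rule integrable_const_bound[where B=B]) (use assms(2) in auto)
  then have "expectation (\<lambda>\<omega>. g (\<zeta> u \<omega>) * cnj (g (\<zeta> v \<omega>))) = expectation (\<lambda>\<omega>. g (\<zeta> u \<omega>)) * expectation (\<lambda>\<omega>. cnj (g (\<zeta> v \<omega>)))"
    by (intro indep_var_lebesgue_integral[OF ind]) auto
  then show ?thesis
    using distr_eq_integral[of g u] distr_eq_integral[of g v] by simp
qed

text \<open>
  The weights of u and v depend on labels of length less than n only, so centred functions of the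
  clusters attached to distinct u and v of length n are uncorrelated even after weighting.
\<close>

lemma orthogonal_offspring:
  fixes g :: "int list \<Rightarrow> complex"
  assumes "mgf (2 * Re z) < \<infinity>" "u \<noteq> v" "length u = length v"
    and "\<And>c. norm (g c) \<le> B" "expectation (\<lambda>\<omega>. g (\<zeta> [] \<omega>)) = 0"
  shows "expectation (\<lambda>\<omega>. (weight \<zeta> z u \<omega> * g (\<zeta> u \<omega>)) * cnj (weight \<zeta> z v \<omega> * g (\<zeta> v \<omega>))) = 0"
proof -
  let ?A = "{take j u | j. j < length u} \<union> {take j v | j. j < length v}"
  have A1: "\<And>j. j < length u \<Longrightarrow> take j u \<in> ?A" and A2: "\<And>j. j < length v \<Longrightarrow> take j v \<in> ?A" by auto
  have 2: "?A \<inter> {u, v} = {}"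
  proof -
    have "length w < length u" if "w \<in> ?A" for w
      using that assms(3) by auto
    from this[of u] this[of v] have "u \<notin> ?A" "v \<notin> ?A" unfolding assms(3) by (blast intro: less_irrefl)+
    then show ?thesis by (simp only: disjoint_iff insert_iff) blast
  qed
  have wm: "(\<lambda>\<xi>. weight (\<lambda>v \<xi>. \<xi> v) z u \<xi> * cnj (weight (\<lambda>v \<xi>. \<xi> v) z v \<xi>)) \<in> borel_measurable (PiM ?A (\<lambda>_. count_space UNIV))"
    using measurable_weight_coord[OF A1] measurable_weight_coord[OF A2] by (intro borel_measurable_times measurable_compose[OF _ measurable_cnj]) auto
  have hm: "(\<lambda>\<xi>. g (\<xi> u) * cnj (g (\<xi> v))) \<in> borel_measurable (PiM {u, v} (\<lambda>_. count_space UNIV))"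
    by (intro borel_measurable_times measurable_coord measurable_coord[where h="\<lambda>c. cnj (g c)"]) auto
  have "indep_var borel (\<lambda>\<omega>. weight (\<lambda>v \<xi>. \<xi> v) z u (\<lambda>v\<in>?A. \<zeta> v \<omega>) * cnj (weight (\<lambda>v \<xi>. \<xi> v) z v (\<lambda>v\<in>?A. \<zeta> v \<omega>)))
      borel (\<lambda>\<omega>. g ((\<lambda>v\<in>{u,v}. \<zeta> v \<omega>) u) * cnj (g ((\<lambda>v\<in>{u,v}. \<zeta> v \<omega>) v)))"
    by (rule indep_var_disjoint_labels[OF 2 wm hm])
  then have ind: "indep_var borel (\<lambda>\<omega>. weight \<zeta> z u \<omega> * cnj (weight \<zeta> z v \<omega>)) borel (\<lambda>\<omega>. g (\<zeta> u \<omega>) * cnj (g (\<zeta> v \<omega>)))"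
    by (simp only: weight_coord[OF A1] weight_coord[OF A2] restrict_apply insert_iff simp_thms if_True)
  have "norm (g c * cnj (g d)) \<le> B * B" for c d
    using assms(4)[of c] assms(4)[of d] order_trans[OF norm_ge_zero assms(4)[of c]] by (auto simp: norm_mult intro!: mult_mono)
  then have "integrable M (\<lambda>\<omega>. g (\<zeta> u \<omega>) * cnj (g (\<zeta> v \<omega>)))"
    by (intro integrable_const_bound[where B="B * B"]) auto
  then have "expectation (\<lambda>\<omega>. (weight \<zeta> z u \<omega> * cnj (weight \<zeta> z v \<omega>)) * (g (\<zeta> u \<omega>) * cnj (g (\<zeta> v \<omega>)))) = 0"
    by (subst indep_var_lebesgue_integral[OF ind integrable_weight_mult[OF assms(1)]])
       (use indep_offspring[of u v g B] assms in simp_all)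
  then show ?thesis by (simp add: algebra_simps)
qed

text \<open>By orthogonality only the diagonal survives; each diagonal term is at most B^2 times the
  mean of the weight at 2z, and these means sum to at most m2^n. Nonnegativity of the variance then
  passes from the second moment to the first. The finite F keeps the double sum and its expectation
  elementary.\<close>

lemma second_moment_le:
  fixes g :: "int list \<Rightarrow> complex"
  assumes "mgf (2 * Re z) = ennreal m2" "0 \<le> m2" "finite F" "F \<subseteq> {u. length u = n}"
    and "\<And>c. norm (g c) \<le> B" "expectation (\<lambda>\<omega>. g (\<zeta> [] \<omega>)) = 0"
  shows "(\<integral>\<^sup>+\<omega>. ennreal (norm (\<Sum>u\<in>F. weight \<zeta> z u \<omega> * g (\<zeta> u \<omega>))) \<partial>M) \<le> ennreal (B * sqrt (m2 ^ n))"
proof -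
  have fin: "mgf (2 * Re z) < \<infinity>" using assms(1) by simp
  have B: "0 \<le> B" using order_trans[OF norm_ge_zero assms(5)] .
  define X where "X u \<omega> = weight \<zeta> z u \<omega> * g (\<zeta> u \<omega>)" for u \<omega>
  have [measurable]: "X u \<in> borel_measurable M" for u
    unfolding X_def by measurable
  have i2: "integrable M (\<lambda>\<omega>. X u \<omega> * cnj (X v \<omega>))" for u v
  proof (rule Bochner_Integration.integrable_bound)
    show "integrable M (\<lambda>\<omega>. complex_of_real (B * B) * (weight \<zeta> z u \<omega> * cnj (weight \<zeta> z v \<omega>)))"
      by (intro integrable_mult_right integrable_weight_mult fin)
    show "AE \<omega> in M. norm (X u \<omega> * cnj (X v \<omega>)) \<le> norm (complex_of_real (B * B) * (weight \<zeta> z u \<omega> * cnj (weight \<zeta> z v \<omega>)))"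
    proof (rule AE_I2)
      fix \<omega>
      have "norm (g (\<zeta> u \<omega>)) * norm (g (\<zeta> v \<omega>)) \<le> B * B"
        using assms(5) B by (intro mult_mono) auto
      from mult_left_mono[OF this, of "norm (weight \<zeta> z u \<omega>) * norm (weight \<zeta> z v \<omega>)"]
      show "norm (X u \<omega> * cnj (X v \<omega>)) \<le> norm (complex_of_real (B * B) * (weight \<zeta> z u \<omega> * cnj (weight \<zeta> z v \<omega>)))"
        using B by (simp add: X_def norm_mult algebra_simps)
    qed
  qed measurable
  define Y where "Y \<omega> = norm (\<Sum>u\<in>F. X u \<omega>)" for \<omega>
  have [measurable]: "Y \<in> borel_measurable M" unfolding Y_def by measurable
  have sq: "complex_of_real ((Y \<omega>)\<^sup>2) = (\<Sum>u\<in>F. \<Sum>v\<in>F. X u \<omega> * cnj (X v \<omega>))" for \<omega>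
    by (simp add: Y_def complex_norm_square sum_product flip: of_real_power)
  have iY': "integrable M (\<lambda>\<omega>. complex_of_real ((Y \<omega>)\<^sup>2))"
    unfolding sq by (intro Bochner_Integration.integrable_sum i2)
  have iY: "integrable M (\<lambda>\<omega>. (Y \<omega>)\<^sup>2)"
    using integrable_norm[OF iY'] by (simp add: norm_power)
  have iw: "integrable M (\<lambda>\<omega>. norm (weight \<zeta> (2 * z) u \<omega>))" for u
    by (intro integrable_norm integrable_weight) (use fin in simp)
  have "complex_of_real (expectation (\<lambda>\<omega>. (Y \<omega>)\<^sup>2)) = (\<Sum>u\<in>F. \<Sum>v\<in>F. expectation (\<lambda>\<omega>. X u \<omega> * cnj (X v \<omega>)))"
    unfolding integral_complex_of_real[symmetric] sq by (subst Bochner_Integration.integral_sum; intro Bochner_Integration.integrable_sum i2 sum.cong refl Bochner_Integration.integral_sum)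
  also have "\<dots> = (\<Sum>u\<in>F. \<Sum>v\<in>F. if u = v then expectation (\<lambda>\<omega>. X u \<omega> * cnj (X u \<omega>)) else 0)"
    using orthogonal_offspring[OF fin _ _ assms(5,6)] assms(4)
    by (intro sum.cong) (auto simp: X_def)
  also have "\<dots> = (\<Sum>u\<in>F. expectation (\<lambda>\<omega>. complex_of_real ((norm (X u \<omega>))\<^sup>2)))"
    using assms(3) by (simp add: complex_norm_square flip: of_real_power)
  also have "\<dots> = complex_of_real (\<Sum>u\<in>F. expectation (\<lambda>\<omega>. (norm (X u \<omega>))\<^sup>2))"
    by (simp only: integral_complex_of_real of_real_sum)
  finally have E: "expectation (\<lambda>\<omega>. (Y \<omega>)\<^sup>2) = (\<Sum>u\<in>F. expectation (\<lambda>\<omega>. (norm (X u \<omega>))\<^sup>2))"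
    by (simp only: of_real_eq_iff)
  have "expectation (\<lambda>\<omega>. (norm (X u \<omega>))\<^sup>2) \<le> B\<^sup>2 * expectation (\<lambda>\<omega>. norm (weight \<zeta> (2 * z) u \<omega>))" for u
  proof -
    have "expectation (\<lambda>\<omega>. (norm (X u \<omega>))\<^sup>2) \<le> expectation (\<lambda>\<omega>. B\<^sup>2 * norm (weight \<zeta> (2 * z) u \<omega>))"
    proof (rule integral_mono)
      show "integrable M (\<lambda>\<omega>. (norm (X u \<omega>))\<^sup>2)"
        using integrable_norm[OF i2[of u u]] by (simp add: norm_mult power2_eq_square)
      show "(norm (X u \<omega>))\<^sup>2 \<le> B\<^sup>2 * norm (weight \<zeta> (2 * z) u \<omega>)" for \<omega>
        unfolding X_def norm_mult power_mult_distrib norm_weight_sq[symmetric]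
        using mult_right_mono[OF power_mono[OF assms(5) norm_ge_zero, of "\<zeta> u \<omega>" 2], of "(norm (weight \<zeta> z u \<omega>))\<^sup>2"]
        by (simp add: mult.commute)
    qed (intro integrable_mult_right iw)
    then show ?thesis by simp
  qed
  then have "expectation (\<lambda>\<omega>. (Y \<omega>)\<^sup>2) \<le> B\<^sup>2 * (\<Sum>u\<in>F. expectation (\<lambda>\<omega>. norm (weight \<zeta> (2 * z) u \<omega>)))"
    unfolding E sum_distrib_left by (rule sum_mono)
  also have "(\<Sum>u\<in>F. expectation (\<lambda>\<omega>. norm (weight \<zeta> (2 * z) u \<omega>))) \<le> m2 ^ n"
  proof -
    have "ennreal (\<Sum>u\<in>F. expectation (\<lambda>\<omega>. norm (weight \<zeta> (2 * z) u \<omega>)))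
        = (\<Sum>u\<in>F. \<integral>\<^sup>+\<omega>. ennreal (norm (weight \<zeta> (2 * z) u \<omega>)) \<partial>M)"
      by (subst sum_ennreal[symmetric]) (auto intro!: sum.cong simp: nn_integral_eq_integral[OF iw])
    also have "\<dots> \<le> ennreal (m2 ^ n)"
      using sum_mean_weights_finite[OF assms(3,4), of "2 * z"] assms(1,2) by (simp add: ennreal_power)
    finally show ?thesis using assms(2) by (simp add: ennreal_le_iff)
  qed
  finally have E2: "expectation (\<lambda>\<omega>. (Y \<omega>)\<^sup>2) \<le> B\<^sup>2 * m2 ^ n"
    using B by (simp add: mult_left_mono)
  have iY1: "integrable M Y"
    by (rule square_integrable_imp_integrable[OF _ iY]) measurable
  have "(expectation Y)\<^sup>2 \<le> expectation (\<lambda>\<omega>. (Y \<omega>)\<^sup>2)"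
    using variance_positive[of Y] variance_eq[OF iY1 iY] by simp
  then have "expectation Y \<le> sqrt (B\<^sup>2 * m2 ^ n)"
    using E2 by (intro real_le_rsqrt) simp
  also have "\<dots> = B * sqrt (m2 ^ n)" using B by (simp add: real_sqrt_mult)
  finally have "expectation Y \<le> B * sqrt (m2 ^ n)" .
  moreover have "(\<integral>\<^sup>+\<omega>. ennreal (Y \<omega>) \<partial>M) = ennreal (expectation Y)"
    by (rule nn_integral_eq_integral[OF iY1]) (simp add: Y_def)
  ultimately show ?thesis by (simp add: Y_def X_def ennreal_leI)
qed

lemma measurable_gen_sum_mult[measurable]:
  "(\<lambda>\<omega>. \<Sum>u\<in>gen \<zeta> n \<omega>. cexpi z (pos \<zeta> u \<omega>) * g (\<zeta> u \<omega>)) \<in> borel_measurable M"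
  by (rule borel_measurable_LIMSEQ_metric[OF _ gen_sum_limit]) measurable

text \<open>The bound for finite label sets does not depend on the set, so Fatou's lemma carries it
  to the whole generation.\<close>

lemma centred_sum_le:
  fixes g :: "int list \<Rightarrow> complex"
  assumes "mgf (2 * Re z) = ennreal m2" "0 \<le> m2"
    and "\<And>c. norm (g c) \<le> B" "expectation (\<lambda>\<omega>. g (\<zeta> [] \<omega>)) = 0"
  shows "(\<integral>\<^sup>+\<omega>. ennreal (norm (\<Sum>u\<in>gen \<zeta> n \<omega>. cexpi z (pos \<zeta> u \<omega>) * g (\<zeta> u \<omega>))) \<partial>M) \<le> ennreal (B * sqrt (m2 ^ n))"
proof -
  let ?X = "\<lambda>j \<omega>. \<Sum>u\<in>{u. set u \<subseteq> {..<j} \<and> length u = n}. weight \<zeta> z u \<omega> * g (\<zeta> u \<omega>)"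
  let ?Y = "\<lambda>\<omega>. \<Sum>u\<in>gen \<zeta> n \<omega>. cexpi z (pos \<zeta> u \<omega>) * g (\<zeta> u \<omega>)"
  have "liminf (\<lambda>j. ennreal (norm (?X j \<omega>))) = ennreal (norm (?Y \<omega>))" for \<omega>
    by (intro lim_imp_Liminf tendsto_ennrealI tendsto_norm gen_sum_limit) simp
  then have "(\<integral>\<^sup>+\<omega>. ennreal (norm (?Y \<omega>)) \<partial>M) = (\<integral>\<^sup>+\<omega>. liminf (\<lambda>j. ennreal (norm (?X j \<omega>))) \<partial>M)"
    by simp
  also have "\<dots> \<le> liminf (\<lambda>j. \<integral>\<^sup>+\<omega>. ennreal (norm (?X j \<omega>)) \<partial>M)"
    by (rule nn_integral_liminf) measurable
  also have "\<dots> \<le> limsup (\<lambda>j. \<integral>\<^sup>+\<omega>. ennreal (norm (?X j \<omega>)) \<partial>M)"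
    by (rule Liminf_le_Limsup) simp
  also have "\<dots> \<le> ennreal (B * sqrt (m2 ^ n))"
    by (intro Limsup_bounded always_eventually allI second_moment_le[OF assms(1,2) _ _ assms(3,4)] finite_lists_length_eq) auto
  finally show ?thesis .
qed

text \<open>Triangle inequality without cancellation: this serves the part of the clusters beyond
  the cut-off, whose first moment is small.\<close>

lemma weighted_sum_le:
  fixes h :: "int list \<Rightarrow> complex"
  shows "(\<integral>\<^sup>+\<omega>. ennreal (norm (\<Sum>u\<in>gen \<zeta> n \<omega>. cexpi z (pos \<zeta> u \<omega>) * h (\<zeta> u \<omega>))) \<partial>M)
    \<le> mgf (Re z) ^ n * (\<integral>\<^sup>+\<omega>. ennreal (norm (h (\<zeta> [] \<omega>))) \<partial>M)"
proof -
  have "ennreal (norm (\<Sum>u\<in>gen \<zeta> n \<omega>. cexpi z (pos \<zeta> u \<omega>) * h (\<zeta> u \<omega>)))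
     \<le> (\<Sum>u\<in>gen \<zeta> n \<omega>. ennreal (exp (Re z * pos \<zeta> u \<omega>)) * ennreal (norm (h (\<zeta> u \<omega>))))" for \<omega>
  proof -
    have "norm (\<Sum>u\<in>gen \<zeta> n \<omega>. cexpi z (pos \<zeta> u \<omega>) * h (\<zeta> u \<omega>)) \<le> (\<Sum>u\<in>gen \<zeta> n \<omega>. exp (Re z * pos \<zeta> u \<omega>) * norm (h (\<zeta> u \<omega>)))"
      by (rule sum_norm_le) (simp add: norm_mult norm_cexpi)
    then show ?thesis by (simp add: sum_ennreal ennreal_leI flip: ennreal_mult)
  qed
  then have "(\<integral>\<^sup>+\<omega>. ennreal (norm (\<Sum>u\<in>gen \<zeta> n \<omega>. cexpi z (pos \<zeta> u \<omega>) * h (\<zeta> u \<omega>))) \<partial>M) \<le>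
     (\<integral>\<^sup>+\<omega>. (\<Sum>u\<in>gen \<zeta> n \<omega>. ennreal (exp (Re z * pos \<zeta> u \<omega>)) * ennreal (norm (h (\<zeta> u \<omega>)))) \<partial>M)"
    by (intro nn_integral_mono)
  also have "\<dots> = mgf (Re z) ^ n * (\<integral>\<^sup>+\<omega>. ennreal (norm (h (\<zeta> [] \<omega>))) \<partial>M)"
    by (subst nn_integral_gen_mult) (simp only: sum_mean_weights)
  finally show ?thesis .
qed

text \<open>Clusters are split at R <= T. The bounded part, once centred, is at most 2 T and goes
  through the second-moment bound. The rest is at most T^(1-p) R^p, because 1 - p is negative and R
  > T, and goes through the triangle inequality, subtraction of its mean doubling the bound. The cut
  is made on R, which will be an envelope common to all z of a strip.\<close>

lemma gen_sum_step_le: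
  fixes R :: "int list \<Rightarrow> real"
  assumes m2: "mgf (2 * Re z) = ennreal m2" "0 \<le> m2" and m1: "mgf (Re z) = ennreal m1" "0 \<le> m1"
    and R: "\<And>c. norm (offspring_sum z c) \<le> R c"
    and p: "p > 1" and Rp: "(\<integral>\<^sup>+\<omega>. ennreal (R (\<zeta> [] \<omega>) powr p) \<partial>M) \<le> ennreal K" "0 \<le> K" and T: "T > 0"
  shows "integrable M (\<lambda>\<omega>. offspring_sum z (\<zeta> [] \<omega>))"
    and "(\<integral>\<^sup>+\<omega>. ennreal (norm (gen_sum \<zeta> z (Suc n) \<omega> - expectation (\<lambda>\<omega>. offspring_sum z (\<zeta> [] \<omega>)) * gen_sum \<zeta> z n \<omega>)) \<partial>M)
      \<le> ennreal (2 * T * sqrt (m2 ^ n) + 2 * m1 ^ n * (T powr (1 - p) * K))"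
proof -
  define s where "s = offspring_sum z"
  define Y where "Y c = (if R c \<le> T then s c else 0)" for c
  define Z where "Z c = (if R c \<le> T then 0 else s c)" for c
  have sYZ: "s c = Y c + Z c" for c by (simp add: Y_def Z_def)
  have R0: "0 \<le> R c" for c using order_trans[OF norm_ge_zero R] .
  have nY: "norm (Y c) \<le> T" for c using R[of c] T by (auto simp: Y_def s_def)
  have iY: "integrable M (\<lambda>\<omega>. Y (\<zeta> [] \<omega>))"
    by (rule integrable_const_bound[where B=T]) (auto simp: nY)
  have nZ: "norm (Z c) \<le> T powr (1 - p) * R c powr p" for c
  proof (cases "R c \<le> T")
    case False
    then have "R c = R c powr (1 - p) * R c powr p" using T by (simp flip: powr_add)
    also have "\<dots> \<le> T powr (1 - p) * R c powr p"
      using False T p by (intro mult_right_mono powr_mono2') auto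
    finally show ?thesis using False R[of c] by (simp add: Z_def s_def)
  qed (simp add: Z_def)
  have EZ: "(\<integral>\<^sup>+\<omega>. ennreal (norm (Z (\<zeta> [] \<omega>))) \<partial>M) \<le> ennreal (T powr (1 - p) * K)"
  proof -
    have "(\<integral>\<^sup>+\<omega>. ennreal (norm (Z (\<zeta> [] \<omega>))) \<partial>M) \<le> (\<integral>\<^sup>+\<omega>. ennreal (T powr (1 - p)) * ennreal (R (\<zeta> [] \<omega>) powr p) \<partial>M)"
      by (intro nn_integral_mono) (use nZ in \<open>simp flip: ennreal_mult\<close>)
    also have "\<dots> = ennreal (T powr (1 - p)) * (\<integral>\<^sup>+\<omega>. ennreal (R (\<zeta> [] \<omega>) powr p) \<partial>M)"
      by (rule nn_integral_cmult) measurable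
    also have "\<dots> \<le> ennreal (T powr (1 - p)) * ennreal K"
      by (intro mult_left_mono Rp) simp
    finally show ?thesis using Rp(2) by (simp add: ennreal_mult)
  qed
  have iZ: "integrable M (\<lambda>\<omega>. Z (\<zeta> [] \<omega>))"
    by (rule integrableI_bounded) (auto intro: le_less_trans[OF EZ])
  show int_s: "integrable M (\<lambda>\<omega>. offspring_sum z (\<zeta> [] \<omega>))"
    using Bochner_Integration.integrable_add[OF iY iZ] by (simp add: sYZ[symmetric] flip: s_def)
  define y where "y = expectation (\<lambda>\<omega>. Y (\<zeta> [] \<omega>))"
  define w where "w = expectation (\<lambda>\<omega>. Z (\<zeta> [] \<omega>))"
  have m: "expectation (\<lambda>\<omega>. offspring_sum z (\<zeta> [] \<omega>)) = y + w"
    using Bochner_Integration.integral_add[OF iY iZ] by (simp add: sYZ[symmetric] y_def w_def flip: s_def)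
  have ny: "norm y \<le> T"
  proof -
    have "norm y \<le> expectation (\<lambda>\<omega>. norm (Y (\<zeta> [] \<omega>)))" unfolding y_def by (rule integral_norm_bound)
    also have "\<dots> \<le> expectation (\<lambda>\<omega>. T)" by (intro integral_mono integrable_norm iY) (auto simp: nY)
    finally show ?thesis by (simp add: prob_space)
  qed
  have nw: "ennreal (norm w) \<le> ennreal (T powr (1 - p) * K)"
  proof -
    have "ennreal (norm w) \<le> (\<integral>\<^sup>+\<omega>. ennreal (norm (Z (\<zeta> [] \<omega>))) \<partial>M)"
      unfolding w_def by (rule integral_norm_bound_ennreal[OF iZ])
    then show ?thesis using EZ by (rule order_trans)
  qed
  let ?A = "\<lambda>\<omega>. \<Sum>u\<in>gen \<zeta> n \<omega>. cexpi z (pos \<zeta> u \<omega>) * (Y (\<zeta> u \<omega>) - y)"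
  let ?B = "\<lambda>\<omega>. \<Sum>u\<in>gen \<zeta> n \<omega>. cexpi z (pos \<zeta> u \<omega>) * (Z (\<zeta> u \<omega>) - w)"
  have "gen_sum \<zeta> z (Suc n) \<omega> - expectation (\<lambda>\<omega>. offspring_sum z (\<zeta> [] \<omega>)) * gen_sum \<zeta> z n \<omega> = ?A \<omega> + ?B \<omega>" for \<omega>
    unfolding gen_sum_Suc m unfolding s_def[symmetric] sYZ
    by (simp add: gen_sum_def sum_distrib_left algebra_simps sum.distrib sum_subtractf)
  then have "(\<integral>\<^sup>+\<omega>. ennreal (norm (gen_sum \<zeta> z (Suc n) \<omega> - expectation (\<lambda>\<omega>. offspring_sum z (\<zeta> [] \<omega>)) * gen_sum \<zeta> z n \<omega>)) \<partial>M)
     \<le> (\<integral>\<^sup>+\<omega>. ennreal (norm (?A \<omega>)) + ennreal (norm (?B \<omega>)) \<partial>M)"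
    by (intro nn_integral_mono) (simp add: norm_triangle_ineq flip: ennreal_plus)
  also have "\<dots> = (\<integral>\<^sup>+\<omega>. ennreal (norm (?A \<omega>)) \<partial>M) + (\<integral>\<^sup>+\<omega>. ennreal (norm (?B \<omega>)) \<partial>M)"
    using measurable_gen_sum_mult[where g="\<lambda>c. Y c - y"] measurable_gen_sum_mult[where g="\<lambda>c. Z c - w"]
    by (intro nn_integral_add) measurable
  also have "(\<integral>\<^sup>+\<omega>. ennreal (norm (?A \<omega>)) \<partial>M) \<le> ennreal (2 * T * sqrt (m2 ^ n))"
  proof (rule centred_sum_le[OF m2])
    show "norm (Y c - y) \<le> 2 * T" for c
      using norm_triangle_ineq4[of "Y c" y] nY[of c] ny by linarith
    show "expectation (\<lambda>\<omega>. Y (\<zeta> [] \<omega>) - y) = 0"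
      using iY by (simp add: y_def prob_space)
  qed
  also have "(\<integral>\<^sup>+\<omega>. ennreal (norm (?B \<omega>)) \<partial>M) \<le> mgf (Re z) ^ n * (\<integral>\<^sup>+\<omega>. ennreal (norm (Z (\<zeta> [] \<omega>) - w)) \<partial>M)"
    by (rule weighted_sum_le)
  also have "\<dots> \<le> mgf (Re z) ^ n * (\<integral>\<^sup>+\<omega>. ennreal (norm (Z (\<zeta> [] \<omega>))) + ennreal (norm w) \<partial>M)"
    by (intro mult_left_mono nn_integral_mono) (simp_all add: norm_triangle_ineq4 flip: ennreal_plus)
  also have "\<dots> = mgf (Re z) ^ n * ((\<integral>\<^sup>+\<omega>. ennreal (norm (Z (\<zeta> [] \<omega>))) \<partial>M) + ennreal (norm w))"
    by (subst nn_integral_add) (auto simp: emeasure_space_1)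
  also have "\<dots> \<le> mgf (Re z) ^ n * (ennreal (T powr (1 - p) * K) + ennreal (T powr (1 - p) * K))"
    by (intro mult_left_mono add_mono EZ nw) simp
  also have "\<dots> = ennreal (2 * m1 ^ n * (T powr (1 - p) * K))"
    using m1 Rp(2) by (simp add: ennreal_power mult.assoc flip: ennreal_plus ennreal_mult)
  finally show "(\<integral>\<^sup>+\<omega>. ennreal (norm (gen_sum \<zeta> z (Suc n) \<omega> - expectation (\<lambda>\<omega>. offspring_sum z (\<zeta> [] \<omega>)) * gen_sum \<zeta> z n \<omega>)) \<partial>M)
      \<le> ennreal (2 * T * sqrt (m2 ^ n) + 2 * m1 ^ n * (T powr (1 - p) * K))"
    using m1 m2 T Rp(2) by (simp add: add_right_mono add_left_mono)
qed

end

section \<open>Contraction on a strip\<close>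

text \<open>Dominates every offspring sum with |Re z| <= \<delta> at once, so that one cut-off and
  one p-th moment serve the whole strip.\<close>

definition envelope :: "real \<Rightarrow> int list \<Rightarrow> real" where
  "envelope \<delta> c = (\<Sum>k\<leftarrow>c. exp (\<delta> * of_int k) + exp (- (\<delta> * of_int k)))"

lemma exp_abs_le:
  fixes x y \<delta> :: real
  assumes "\<bar>x\<bar> \<le> \<delta>"
  shows "exp (x * y) \<le> exp (\<delta> * y) + exp (- (\<delta> * y))"
proof (cases "y \<ge> 0")
  case True
  then have "x * y \<le> \<delta> * y" using assms by (intro mult_right_mono) auto
  then have "exp (x * y) \<le> exp (\<delta> * y)" by simp
  then show ?thesis using exp_gt_zero[of "- (\<delta> * y)"] by linarith
next
  case False
  then have "x * y \<le> - \<delta> * y" using assms by (intro mult_right_mono_neg) auto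
  then have "exp (x * y) \<le> exp (- (\<delta> * y))" by simp
  then show ?thesis using exp_gt_zero[of "\<delta> * y"] by linarith
qed

lemma norm_offspring_sum_le:
  assumes "\<bar>Re z\<bar> \<le> \<delta>"
  shows "norm (offspring_sum z c) \<le> envelope \<delta> c"
proof (induction c)
  case (Cons k c)
  have "norm (offspring_sum z (k # c)) \<le> norm (cexpi z k) + norm (offspring_sum z c)"
    by (simp add: offspring_sum_def norm_triangle_ineq)
  with Cons exp_abs_le[OF assms, of "of_int k"] show ?case
    by (simp add: envelope_def norm_cexpi)
qed (simp add: offspring_sum_def envelope_def)

lemma envelope_nonneg: "0 \<le> envelope \<delta> c"
  unfolding envelope_def by (rule sum_list_nonneg) auto

lemma holomorphic_offspring_sum: "(\<lambda>z. offspring_sum z c) holomorphic_on S"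
proof (induction c)
  case (Cons k c)
  then show ?case by (simp add: offspring_sum_def cexpi_def) (intro holomorphic_intros)
qed (simp add: offspring_sum_def)

locale brw_exp_moments = branching_random_walk +
  fixes \<delta> p :: real
  assumes delta_pos: "\<delta> > 0" and p_ge_1: "p \<ge> 1"
    and envelope_moment: "(\<integral>\<^sup>+\<omega>. ennreal (envelope \<delta> (\<zeta> [] \<omega>) powr p) \<partial>M) < \<infinity>"
begin

text \<open>The number \<open>a\<close> below is the mean offspring number, written m in the paper.\<close>

definition m :: "complex \<Rightarrow> complex" where
  "m z = expectation (\<lambda>\<omega>. offspring_sum z (\<zeta> [] \<omega>))"

definition a :: real where "a = Re (m 0)"

abbreviation step_error :: "complex \<Rightarrow> nat \<Rightarrow> 'a \<Rightarrow> complex" where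
  "step_error z n \<omega> \<equiv> gen_sum \<zeta> z (Suc n) \<omega> - m z * gen_sum \<zeta> z n \<omega>"

lemma integrable_envelope: "integrable M (\<lambda>\<omega>. envelope \<delta> (\<zeta> [] \<omega>))"
proof (rule Bochner_Integration.integrable_bound)
  show "integrable M (\<lambda>\<omega>. 1 + envelope \<delta> (\<zeta> [] \<omega>) powr p)"
    by (intro Bochner_Integration.integrable_add integrableI_bounded)
       (use envelope_moment in \<open>simp_all add: emeasure_space_1\<close>)
  have "x \<le> 1 + x powr p" if "x \<ge> 0" for x :: real
  proof (cases "x \<le> 1")
    case False
    then have "x powr 1 \<le> x powr p" using p_ge_1 by (intro powr_mono) auto
    then show ?thesis using False by simp
  qed (simp add: add_increasing2)
  then show "AE \<omega> in M. norm (envelope \<delta> (\<zeta> [] \<omega>)) \<le> norm (1 + envelope \<delta> (\<zeta> [] \<omega>) powr p)"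
    by (intro AE_I2) (simp add: envelope_nonneg)
qed measurable

lemma integrable_offspring_sum:
  assumes "\<bar>Re z\<bar> \<le> \<delta>"
  shows "integrable M (\<lambda>\<omega>. offspring_sum z (\<zeta> [] \<omega>))"
  by (rule Bochner_Integration.integrable_bound[OF integrable_envelope])
     (auto intro!: AE_I2 order_trans[OF norm_offspring_sum_le[OF assms]])

lemma offspring_sum_of_real: "offspring_sum (of_real x) c = of_real (Re (offspring_sum (of_real x) c))"
  unfolding Re_offspring_sum by (induction c) (simp_all add: offspring_sum_def cexpi_of_real)

lemma m_of_real: "m (of_real x) = of_real (Re (m (of_real x)))"
proof -
  have "m (of_real x) = expectation (\<lambda>\<omega>. complex_of_real (Re (offspring_sum (of_real x) (\<zeta> [] \<omega>))))"
    unfolding m_def by (subst offspring_sum_of_real) (rule refl)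
  then show ?thesis by (simp only: integral_complex_of_real Re_complex_of_real)
qed

lemma mgf_eq:
  assumes "\<bar>x\<bar> \<le> \<delta>"
  shows "mgf x = ennreal (Re (m (of_real x)))"
proof -
  have i: "integrable M (\<lambda>\<omega>. offspring_sum (of_real x) (\<zeta> [] \<omega>))"
    using assms by (intro integrable_offspring_sum) simp
  show ?thesis unfolding mgf_def m_def integral_Re[OF i, symmetric]
    by (rule nn_integral_eq_integral[OF integrable_Re[OF i]]) (simp add: Re_offspring_sum_nonneg)
qed

lemma m_nonneg: "0 \<le> Re (m (of_real x))"
  unfolding m_def by (subst offspring_sum_of_real) (simp add: integral_nonneg_AE Re_offspring_sum_nonneg)

text \<open>Restricts the expectation to the first j values in an enumeration of all integer lists,
  which leaves a finite combination of entire functions. Holomorphy of m then follows by Weierstrass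
  rather than by differentiation under the expectation.\<close>

definition m_trunc :: "nat \<Rightarrow> complex \<Rightarrow> complex" where
  "m_trunc j z = (\<Sum>i<j. of_real (prob {\<omega>\<in>space M. to_nat (\<zeta> [] \<omega>) = i}) * offspring_sum z (from_nat i))"

lemma m_trunc_eq: "m_trunc j z = expectation (\<lambda>\<omega>. if to_nat (\<zeta> [] \<omega>) < j then offspring_sum z (\<zeta> [] \<omega>) else 0)"
proof -
  have "(if to_nat (\<zeta> [] \<omega>) < j then offspring_sum z (\<zeta> [] \<omega>) else 0)
     = (\<Sum>i<j. of_real (indicator {\<omega>\<in>space M. to_nat (\<zeta> [] \<omega>) = i} \<omega>) * offspring_sum z (from_nat i))" if "\<omega> \<in> space M" for \<omega>
  proof -
    have "(\<Sum>i<j. of_real (indicator {\<omega>\<in>space M. to_nat (\<zeta> [] \<omega>) = i} \<omega>) * offspring_sum z (from_nat i))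
       = (\<Sum>i<j. if i = to_nat (\<zeta> [] \<omega>) then offspring_sum z (from_nat i) else 0)"
      using that by (intro sum.cong) (auto simp: indicator_def)
    then show ?thesis by (simp add: sum.delta)
  qed
  then have "expectation (\<lambda>\<omega>. if to_nat (\<zeta> [] \<omega>) < j then offspring_sum z (\<zeta> [] \<omega>) else 0)
     = expectation (\<lambda>\<omega>. \<Sum>i<j. of_real (indicator {\<omega>\<in>space M. to_nat (\<zeta> [] \<omega>) = i} \<omega>) * offspring_sum z (from_nat i))"
    by (intro Bochner_Integration.integral_cong) auto
  also have "\<dots> = m_trunc j z"
    unfolding m_trunc_def
  proof (subst Bochner_Integration.integral_sum)
    have [measurable]: "{\<omega>\<in>space M. to_nat (\<zeta> [] \<omega>) = i} \<in> sets M" for i by measurable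
    show "integrable M (\<lambda>\<omega>. complex_of_real (indicator {\<omega>\<in>space M. to_nat (\<zeta> [] \<omega>) = i} \<omega>) * offspring_sum z (from_nat i))" for i
      by (intro integrable_mult_left integrable_of_real integrable_real_indicator) (auto simp: emeasure_eq_measure)
    show "(\<Sum>i<j. expectation (\<lambda>\<omega>. complex_of_real (indicator {\<omega>\<in>space M. to_nat (\<zeta> [] \<omega>) = i} \<omega>) * offspring_sum z (from_nat i))) =
      (\<Sum>i<j. complex_of_real (prob {\<omega>\<in>space M. to_nat (\<zeta> [] \<omega>) = i}) * offspring_sum z (from_nat i))"
      by (simp only: integral_mult_left_zero integral_complex_of_real) simp
  qed
  finally show ?thesis ..
qed

text \<open>The error is at most the mean of the envelope over clusters numbered j or higher. This
  does not involve z and tends to 0 by dominated convergence.\<close>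

lemma m_trunc_uniform: "uniform_limit {z. \<bar>Re z\<bar> \<le> \<delta>} m_trunc m sequentially"
proof -
  define e where "e j = expectation (\<lambda>\<omega>. if to_nat (\<zeta> [] \<omega>) < j then 0 else envelope \<delta> (\<zeta> [] \<omega>))" for j
  have "e \<longlonglongrightarrow> expectation (\<lambda>_. 0)"
    unfolding e_def
  proof (rule integral_dominated_convergence[OF _ _ integrable_envelope])
    show "AE \<omega> in M. (\<lambda>j. if to_nat (\<zeta> [] \<omega>) < j then 0 else envelope \<delta> (\<zeta> [] \<omega>)) \<longlonglongrightarrow> 0"
    proof (rule AE_I2, rule tendsto_eventually)
      fix \<omega> show "\<forall>\<^sub>F j in sequentially. (if to_nat (\<zeta> [] \<omega>) < j then 0 else envelope \<delta> (\<zeta> [] \<omega>)) = 0"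
        using eventually_gt_at_top[of "to_nat (\<zeta> [] \<omega>)"] by eventually_elim simp
    qed
  qed (auto simp: envelope_nonneg)
  then have lim: "e \<longlonglongrightarrow> 0" by simp
  show ?thesis
  proof (rule uniform_limitI)
    fix \<epsilon> :: real assume "\<epsilon> > 0"
    then have "\<forall>\<^sub>F j in sequentially. e j < \<epsilon>" using lim by (rule order_tendstoD(2)[rotated])
    then show "\<forall>\<^sub>F j in sequentially. \<forall>z\<in>{z. \<bar>Re z\<bar> \<le> \<delta>}. dist (m_trunc j z) (m z) < \<epsilon>"
    proof eventually_elim
      case (elim j)
      show ?case
      proof
        fix z assume "z \<in> {z. \<bar>Re z\<bar> \<le> \<delta>}"
        then have z: "\<bar>Re z\<bar> \<le> \<delta>" by simp
        note i = integrable_offspring_sum[OF z]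
        have i1: "integrable M (\<lambda>\<omega>. if to_nat (\<zeta> [] \<omega>) < j then offspring_sum z (\<zeta> [] \<omega>) else 0)"
          by (rule Bochner_Integration.integrable_bound[OF i]) auto
        have i2: "integrable M (\<lambda>\<omega>. if to_nat (\<zeta> [] \<omega>) < j then 0 else envelope \<delta> (\<zeta> [] \<omega>))"
          by (rule Bochner_Integration.integrable_bound[OF integrable_envelope]) (auto simp: envelope_nonneg)
        have "m z - m_trunc j z = expectation (\<lambda>\<omega>. offspring_sum z (\<zeta> [] \<omega>) - (if to_nat (\<zeta> [] \<omega>) < j then offspring_sum z (\<zeta> [] \<omega>) else 0))"
          unfolding m_def m_trunc_eq using i i1 by simp
        also have "norm \<dots> \<le> e j"
          unfolding e_def
          by (rule order_trans[OF integral_norm_bound integral_mono])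
             (use i i1 i2 norm_offspring_sum_le[OF z] in auto)
        finally show "dist (m_trunc j z) (m z) < \<epsilon>"
          using elim by (simp add: dist_norm norm_minus_commute)
      qed
    qed
  qed
qed

lemma open_strip: "open {z. \<bar>Re z\<bar> < \<delta>}"
  by (intro open_Collect_less continuous_intros)

lemma holomorphic_m: "m holomorphic_on {z. \<bar>Re z\<bar> < \<delta>}"
proof (rule holomorphic_uniform_sequence[OF open_strip])
  show "m_trunc j holomorphic_on {z. \<bar>Re z\<bar> < \<delta>}" for j
    unfolding m_trunc_def[abs_def] by (intro holomorphic_intros holomorphic_offspring_sum)
  fix x assume "x \<in> {z. \<bar>Re z\<bar> < \<delta>}"
  then obtain d where d: "d > 0" "cball x d \<subseteq> {z. \<bar>Re z\<bar> < \<delta>}"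
    using open_strip open_contains_cball by blast
  moreover have "uniform_limit (cball x d) m_trunc m sequentially"
    by (rule uniform_limit_on_subset[OF m_trunc_uniform]) (use d(2) in force)
  ultimately show "\<exists>d>0. cball x d \<subseteq> {z. \<bar>Re z\<bar> < \<delta>} \<and> uniform_limit (cball x d) m_trunc m sequentially"
    by blast
qed

lemma m_0: "m 0 = of_real a"
  using m_of_real[of 0] by (simp add: a_def)

lemma isCont_m: "\<bar>Re z\<bar> < \<delta> \<Longrightarrow> isCont m z"
  using holomorphic_on_imp_continuous_on[OF holomorphic_m] open_strip
  by (simp add: continuous_on_eq_continuous_at)

end

text \<open>The fourth root leaves room for two losses: passing from means to almost sure bounds
  replaces \<rho> by its square root, and dividing by m(z)^n costs a further \<rho>^(1/4) per step,
  so that the rate \<rho>^(1/4) remains. The lower bound is asked on a disc, where this division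
  takes place; the step bound is asked on a strip, which contains the imaginary frequencies up to
  pi.\<close>

locale brw_contraction = brw_exp_moments +
  fixes r C \<rho> :: real
  assumes a: "a > 1" and r: "r > 0" "r < \<delta> / 2" and C: "C \<ge> 0" and \<rho>: "0 < \<rho>" "\<rho> < 1"
    and lo: "\<And>z. norm z \<le> r \<Longrightarrow> norm (m z) \<ge> root 4 \<rho> * a"
    and key: "\<And>z n. \<bar>Re z\<bar> \<le> r \<Longrightarrow> (\<integral>\<^sup>+\<omega>. ennreal (norm (step_error z n \<omega>)) \<partial>M) \<le> ennreal (C * (\<rho> * a) ^ n)"

lemma (in brw_exp_moments) key_bound:
  assumes a: "a > 1" and p_gt_1: "p > 1"
  shows "\<exists>r C \<rho>. brw_contraction M \<zeta> \<delta> p r C \<rho>"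
proof -
  \<comment> \<open>Both parts of the one-step estimate must grow at most like a^((1 - e) n). The
    second-moment part has exponent 1/8 + (1 + e)/2, for which e <= 1/8 suffices; the tail has 1 + e
    - (p - 1)/8, which forces e <= (p - 1)/16.\<close>
  define e where "e = min (1/8) ((p - 1) / 16)"
  have e: "e > 0" "e \<le> 1/8" "e \<le> (p - 1) / 16"
    unfolding e_def using p_gt_1 by (simp, intro min.cobounded1, intro min.cobounded2)
  define \<rho> where "\<rho> = a powr (- e)"
  have \<rho>: "\<rho> > 0" "\<rho> < 1" using a e by (auto simp: \<rho>_def powr_less_one)
  have cont: "(m \<longlongrightarrow> of_real a) (at 0)"
    using isCont_m[of 0] delta_pos by (simp add: isCont_def m_0)
  have r4: "root 4 \<rho> < 1" using \<rho> by (simp add: real_root_lt_1_iff)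
  have "\<forall>\<^sub>F z in at 0. norm (m z) > root 4 \<rho> * a"
    using order_tendstoD(1)[OF tendsto_norm[OF cont], of "root 4 \<rho> * a"] r4 a by simp
  moreover have "\<forall>\<^sub>F z in at 0. norm (m z) < a powr (1 + e)"
    using order_tendstoD(2)[OF tendsto_norm[OF cont], of "a powr (1 + e)"] a e
      powr_less_mono[of 1 "1 + e" a] by simp
  ultimately have "\<forall>\<^sub>F z in at 0. norm (m z) > root 4 \<rho> * a \<and> norm (m z) < a powr (1 + e)"
    by (rule eventually_conj)
  then obtain d where d: "d > 0" "\<And>z. z \<noteq> 0 \<Longrightarrow> norm z < d \<Longrightarrow> norm (m z) > root 4 \<rho> * a \<and> norm (m z) < a powr (1 + e)"
    unfolding eventually_at by (auto simp: dist_norm)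
  have d': "norm (m z) > root 4 \<rho> * a \<and> norm (m z) < a powr (1 + e)" if "norm z < d" for z
  proof (cases "z = 0")
    case True
    then show ?thesis using a r4 e powr_less_mono[of 1 "1 + e" a] by (simp add: m_0)
  qed (use d(2) that in blast)
  \<comment> \<open>Quarters, because the second moment is taken at 2 Re z, which must stay within
    both d and \<delta>.\<close>
  define r where "r = min (d / 4) (\<delta> / 4)"
  have r: "r > 0" "r < \<delta> / 2" "2 * r < d" using d(1) delta_pos by (auto simp: r_def)
  define K where "K = enn2real (\<integral>\<^sup>+\<omega>. ennreal (envelope \<delta> (\<zeta> [] \<omega>) powr p) \<partial>M)"
  have K: "(\<integral>\<^sup>+\<omega>. ennreal (envelope \<delta> (\<zeta> [] \<omega>) powr p) \<partial>M) \<le> ennreal K" "0 \<le> K"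
    using envelope_moment by (simp_all add: K_def)
  have "(\<integral>\<^sup>+\<omega>. ennreal (norm (step_error z n \<omega>)) \<partial>M) \<le> ennreal ((2 + 2 * K) * (\<rho> * a) ^ n)"
    if z: "\<bar>Re z\<bar> \<le> r" for z n
  proof -
    define x where "x = Re z"
    \<comment> \<open>Any small power of \<open>a ^ n\<close> works as cut-off: it must stay below \<open>a powr (n / 2)\<close>
       for the L2 part and grow exponentially for the tail.\<close>
    define T where "T = a powr (real n / 8)"
    \<comment> \<open>Norms of weights depend on Re z alone, so bounds for m at real points suffice
      and the estimate holds for all imaginary parts.\<close>
    define m1 where "m1 = Re (m (of_real x))"
    define m2 where "m2 = Re (m (of_real (2 * x)))"
    have m12: "0 \<le> m1" "0 \<le> m2" unfolding m1_def m2_def by (rule m_nonneg)+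
    have b: "m1 \<le> a powr (1 + e)" "m2 \<le> a powr (1 + e)"
    proof -
      have "norm (m (of_real y)) < a powr (1 + e)" if "\<bar>y\<bar> < d" for y using d'[of "of_real y"] that by simp
      moreover have "\<bar>x\<bar> < d" "\<bar>2 * x\<bar> < d" using z r by (auto simp: x_def)
      ultimately have "norm (m (of_real x)) < a powr (1 + e)" "norm (m (of_real (2 * x))) < a powr (1 + e)"
        by blast+
      then show "m1 \<le> a powr (1 + e)" "m2 \<le> a powr (1 + e)"
        using complex_Re_le_cmod[of "m (of_real x)"] complex_Re_le_cmod[of "m (of_real (2 * x))"]
        unfolding m1_def m2_def by linarith+
    qed
    have powr_n: "(a powr s) ^ n = a powr (s * real n)" for s
      using a by (simp add: powr_powr flip: powr_realpow)
    have ra: "\<rho> * a = a powr (1 - e)"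
      using a by (simp add: \<rho>_def powr_diff powr_minus divide_inverse)
    have le1: "T * sqrt (m2 ^ n) \<le> (\<rho> * a) ^ n"
    proof -
      have "sqrt (m2 ^ n) \<le> sqrt ((a powr (1 + e)) ^ n)" using b m12 by (simp add: power_mono)
      also have "\<dots> = a powr ((1 + e) * real n / 2)"
        unfolding powr_n by (subst powr_half_sqrt[symmetric]) (simp_all only: powr_powr powr_ge_zero times_divide_eq_right mult_1_right)
      finally have "T * sqrt (m2 ^ n) \<le> a powr (real n / 8) * a powr ((1 + e) * real n / 2)"
        unfolding T_def by (intro mult_left_mono) auto
      also have "\<dots> = a powr (real n * (1 / 8 + (1 + e) / 2))"
      proof -
        have "real n / 8 + (1 + e) * real n / 2 = real n * (1 / 8 + (1 + e) / 2)" by (simp add: field_simps)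
        then show ?thesis by (simp only: flip: powr_add)
      qed
      also have "\<dots> \<le> a powr (real n * (1 - e))"
      proof -
        have "1 / 8 + (1 + e) / 2 \<le> 1 - e" using e(2) by (simp add: field_simps)
        then show ?thesis using a by (intro powr_mono mult_left_mono) simp_all
      qed
      also have "\<dots> = (\<rho> * a) ^ n"
        unfolding ra powr_n by (simp only: mult.commute)
      finally show ?thesis .
    qed
    have le2: "m1 ^ n * T powr (1 - p) \<le> (\<rho> * a) ^ n"
    proof -
      have "m1 ^ n * T powr (1 - p) \<le> (a powr (1 + e)) ^ n * T powr (1 - p)"
        using b m12 by (intro mult_right_mono power_mono) auto
      also have "\<dots> = a powr (real n * (1 + e - (p - 1) / 8))"
      proof -
        have "(1 + e) * real n + real n / 8 * (1 - p) = real n * (1 + e - (p - 1) / 8)" by (simp add: field_simps)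
        then show ?thesis by (simp only: T_def powr_n powr_powr flip: powr_add)
      qed
      also have "\<dots> \<le> a powr (real n * (1 - e))"
      proof -
        have "1 + e - (p - 1) / 8 \<le> 1 - e" using e(3) by simp
        then show ?thesis using a by (intro powr_mono mult_left_mono) simp_all
      qed
      also have "\<dots> = (\<rho> * a) ^ n"
        unfolding ra powr_n by (simp only: mult.commute)
      finally show ?thesis .
    qed
    have "(\<integral>\<^sup>+\<omega>. ennreal (norm (step_error z n \<omega>)) \<partial>M)
      \<le> ennreal (2 * T * sqrt (m2 ^ n) + 2 * m1 ^ n * (T powr (1 - p) * K))"
      unfolding m_def
    proof (rule gen_sum_step_le(2)[OF _ m12(2) _ m12(1) _ p_gt_1 K])
      show "mgf (2 * Re z) = ennreal m2" using z r unfolding m2_def x_def by (subst mgf_eq) auto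
      show "mgf (Re z) = ennreal m1" using z r delta_pos unfolding m1_def x_def by (subst mgf_eq) auto
      show "norm (offspring_sum z c) \<le> envelope \<delta> c" for c using z r delta_pos by (intro norm_offspring_sum_le) auto
      show "T > 0" using a by (simp add: T_def)
    qed
    also have "\<dots> \<le> ennreal ((2 + 2 * K) * (\<rho> * a) ^ n)"
      using mult_left_mono[OF le1, of 2] mult_left_mono[OF le2, of "2 * K"] K(2)
      by (intro ennreal_leI) (simp add: algebra_simps)
    finally show ?thesis .
  qed
  moreover have "norm (m z) \<ge> root 4 \<rho> * a" if "norm z \<le> r" for z
    using d'[of z] that r by auto
  ultimately show ?thesis
    using r \<rho> K(2) a
    by (intro exI[of _ r] exI[of _ "2 + 2 * K"] exI[of _ \<rho>] brw_contraction.intro brw_exp_moments_axioms brw_contraction_axioms.intro) auto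
qed

section \<open>Almost sure convergence\<close>

text \<open>Weighting the n-th variable by \<rho>^(-n/2) leaves a series with finite mean, hence
  finite almost surely; its value serves as a random K for all n simultaneously. The price is the
  square root of the rate.\<close>

lemma (in prob_space) AE_geometric_bound:
  fixes f :: "nat \<Rightarrow> 'a \<Rightarrow> ennreal"
  assumes [measurable]: "\<And>n. f n \<in> borel_measurable M"
    and bound: "\<And>n. (\<integral>\<^sup>+\<omega>. f n \<omega> \<partial>M) \<le> ennreal (C * \<rho> ^ n)" and C: "C \<ge> 0" and \<rho>: "0 < \<rho>" "\<rho> < 1"
  shows "AE \<omega> in M. \<exists>K\<ge>0. \<forall>n. f n \<omega> \<le> ennreal (K * sqrt \<rho> ^ n)"
proof -
  define w where "w n = ennreal (inverse (sqrt \<rho>) ^ n)" for n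
  have s: "sqrt \<rho> > 0" "sqrt \<rho> < 1" using \<rho> by (simp_all add: real_sqrt_lt_1_iff)
  have "(\<integral>\<^sup>+\<omega>. (\<Sum>n. w n * f n \<omega>) \<partial>M) = (\<Sum>n. w n * (\<integral>\<^sup>+\<omega>. f n \<omega> \<partial>M))"
    by (subst nn_integral_suminf) (simp_all add: nn_integral_cmult)
  also have "\<dots> \<le> (\<Sum>n. ennreal (C * sqrt \<rho> ^ n))"
  proof (rule suminf_le)
    fix n
    have "w n * (\<integral>\<^sup>+\<omega>. f n \<omega> \<partial>M) \<le> w n * ennreal (C * \<rho> ^ n)"
      by (intro mult_left_mono bound) simp
    also have "\<dots> = ennreal (inverse (sqrt \<rho>) ^ n * (C * \<rho> ^ n))"
      using s C \<rho> by (simp add: w_def ennreal_mult)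
    also have "inverse (sqrt \<rho>) ^ n * (C * \<rho> ^ n) = C * sqrt \<rho> ^ n"
    proof -
      have "\<rho> = sqrt \<rho> * sqrt \<rho>" using \<rho> by simp
      then have "inverse (sqrt \<rho>) * \<rho> = sqrt \<rho>" using s by (simp add: field_simps)
      then have "(inverse (sqrt \<rho>) * \<rho>) ^ n = sqrt \<rho> ^ n" by simp
      then show ?thesis by (simp add: power_mult_distrib)
    qed
    finally show "w n * (\<integral>\<^sup>+\<omega>. f n \<omega> \<partial>M) \<le> ennreal (C * sqrt \<rho> ^ n)" .
  qed auto
  also have "\<dots> = ennreal (\<Sum>n. C * sqrt \<rho> ^ n)"
    using s C by (intro suminf_ennreal2 summable_mult summable_geometric) auto
  also have "\<dots> < \<infinity>" by simp
  finally have "(\<integral>\<^sup>+\<omega>. (\<Sum>n. w n * f n \<omega>) \<partial>M) \<noteq> \<infinity>" by simp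
  then have "AE \<omega> in M. (\<Sum>n. w n * f n \<omega>) \<noteq> \<infinity>"
    by (rule nn_integral_noteq_infinite[rotated]) measurable
  then show ?thesis
  proof eventually_elim
    case (elim \<omega>)
    define K where "K = enn2real (\<Sum>n. w n * f n \<omega>)"
    have K: "ennreal K = (\<Sum>n. w n * f n \<omega>)" using elim by (simp add: K_def less_top)
    have "f n \<omega> \<le> ennreal (K * sqrt \<rho> ^ n)" for n
    proof -
      have "w n * f n \<omega> \<le> ennreal K"
        unfolding K using sum_le_suminf[of "\<lambda>n. w n * f n \<omega>" "{n}"] by simp
      then have "ennreal (sqrt \<rho> ^ n) * (w n * f n \<omega>) \<le> ennreal (sqrt \<rho> ^ n) * ennreal K"
        by (rule mult_left_mono) simp
      also have "ennreal (sqrt \<rho> ^ n) * (w n * f n \<omega>) = f n \<omega>"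
        using s by (simp add: w_def power_inverse flip: mult.assoc ennreal_mult)
      also have "ennreal (sqrt \<rho> ^ n) * ennreal K = ennreal (K * sqrt \<rho> ^ n)"
        using s by (simp add: K_def mult.commute flip: ennreal_mult)
      finally show ?thesis .
    qed
    then show ?case by (intro exI[of _ K]) (simp add: K_def)
  qed
qed

text \<open>Exceptional null sets depending on t could not be united. Integrating over t first, by
  Tonelli, leaves one random variable for each n.\<close>

lemma (in prob_space) AE_integral_geometric_bound:
  fixes F :: "nat \<Rightarrow> real \<Rightarrow> 'a \<Rightarrow> complex"
  assumes F[measurable]: "\<And>n. (\<lambda>(t, \<omega>). F n t \<omega>) \<in> borel_measurable (lborel \<Otimes>\<^sub>M M)"
    and A[measurable]: "A \<in> sets borel" and fin: "emeasure lborel A < \<infinity>"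
    and bound: "\<And>n t. t \<in> A \<Longrightarrow> (\<integral>\<^sup>+\<omega>. ennreal (norm (F n t \<omega>)) \<partial>M) \<le> ennreal (C * \<rho> ^ n)"
    and C: "C \<ge> 0" and \<rho>: "0 < \<rho>" "\<rho> < 1"
  shows "AE \<omega> in M. \<exists>K\<ge>0. \<forall>n. (\<integral>\<^sup>+t\<in>A. ennreal (norm (F n t \<omega>)) \<partial>lborel) \<le> ennreal (K * sqrt \<rho> ^ n)"
proof (rule AE_geometric_bound[where C="C * measure lborel A"])
  interpret P: pair_sigma_finite lborel M ..
  have F'[measurable]: "(\<lambda>x. F n (fst x) (snd x)) \<in> borel_measurable (lborel \<Otimes>\<^sub>M M)" for n
    using F[of n] by (simp add: case_prod_beta)
  have j: "(\<lambda>x. ennreal (norm (F n (fst x) (snd x))) * indicator A (fst x)) \<in> borel_measurable (lborel \<Otimes>\<^sub>M M)" for n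
    by measurable
  then have j': "(\<lambda>(t, \<omega>). ennreal (norm (F n t \<omega>)) * indicator A t) \<in> borel_measurable (lborel \<Otimes>\<^sub>M M)" for n
    by (simp add: case_prod_beta)
  from measurable_pair_swap[OF j]
  have "(\<lambda>(\<omega>, t). ennreal (norm (F n t \<omega>)) * indicator A t) \<in> borel_measurable (M \<Otimes>\<^sub>M lborel)" for n
    by simp
  then show "(\<lambda>\<omega>. \<integral>\<^sup>+t\<in>A. ennreal (norm (F n t \<omega>)) \<partial>lborel) \<in> borel_measurable M" for n
    by (rule lborel.borel_measurable_nn_integral)
  fix n
  have "(\<integral>\<^sup>+\<omega>. (\<integral>\<^sup>+t\<in>A. ennreal (norm (F n t \<omega>)) \<partial>lborel) \<partial>M) = (\<integral>\<^sup>+t. \<integral>\<^sup>+\<omega>. ennreal (norm (F n t \<omega>)) * indicator A t \<partial>M \<partial>lborel)"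
    by (rule P.Fubini'[OF j'])
  also have "\<dots> \<le> (\<integral>\<^sup>+t. ennreal (C * \<rho> ^ n) * indicator A t \<partial>lborel)"
    by (intro nn_integral_mono) (auto simp: indicator_def bound)
  also have "\<dots> = ennreal (C * \<rho> ^ n) * emeasure lborel A"
    by (simp add: nn_integral_cmult_indicator)
  also have "\<dots> = ennreal (C * measure lborel A * \<rho> ^ n)"
    using fin C \<rho> by (simp add: emeasure_eq_ennreal_measure mult_ac flip: ennreal_mult)
  finally show "(\<integral>\<^sup>+\<omega>. (\<integral>\<^sup>+t\<in>A. ennreal (norm (F n t \<omega>)) \<partial>lborel) \<partial>M) \<le> ennreal (C * measure lborel A * \<rho> ^ n)" .
qed (use C \<rho> in auto)

lemma nn_integral_Icc_continuous:
  fixes h :: "real \<Rightarrow> real"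
  assumes "continuous_on {c..d} h" "\<And>t. t \<in> {c..d} \<Longrightarrow> 0 \<le> h t"
  shows "(\<integral>\<^sup>+t\<in>{c..d}. ennreal (h t) \<partial>lborel) = ennreal (integral {c..d} h)"
proof -
  have i: "set_integrable lborel {c..d} h" by (rule borel_integrable_atLeastAtMost'[OF assms(1)])
  have "(\<integral>\<^sup>+t\<in>{c..d}. ennreal (h t) \<partial>lborel) = (\<integral>\<^sup>+t. ennreal (indicator {c..d} t *\<^sub>R h t) \<partial>lborel)"
    by (intro nn_integral_cong) (auto simp: indicator_def)
  also have "\<dots> = ennreal (\<integral>t. indicator {c..d} t *\<^sub>R h t \<partial>lborel)"
    using i assms(2) by (intro nn_integral_eq_integral) (auto simp: set_integrable_def indicator_def)
  also have "\<dots> = ennreal (integral {c..d} h)"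
    using set_borel_integral_eq_integral(2)[OF i] by (simp add: set_lebesgue_integral_def)
  finally show ?thesis .
qed

text \<open>The distance from w to the circle is at least r/2, so the Cauchy kernel is at most 2 pi
  r / (r/2) = 4 pi, and division by 2 pi gives the factor 2. A mean over the circle thus controls
  the supremum on the half disc.\<close>

lemma Cauchy_norm_bound:
  assumes f: "f holomorphic_on cball 0 r" and r: "r > 0" and w: "norm w \<le> r / 2"
    and b: "(\<integral>\<^sup>+t\<in>{0..1}. ennreal (norm (f (circlepath 0 r t))) \<partial>lborel) \<le> ennreal B" "B \<ge> 0"
  shows "norm (f w) \<le> 2 * B"
proof -
  have cf: "continuous_on {0..1} (\<lambda>t. f (circlepath 0 r t))"
  proof (rule continuous_on_compose2[OF holomorphic_on_imp_continuous_on[OF f]])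
    show "continuous_on {0..1} (circlepath 0 r)" unfolding circlepath_def part_circlepath_def by (intro continuous_intros)
  qed (use r in \<open>auto simp: circlepath norm_mult\<close>)
  have I: "integral {0..1} (\<lambda>t. norm (f (circlepath 0 r t))) \<le> B"
    using b nn_integral_Icc_continuous[of 0 1 "\<lambda>t. norm (f (circlepath 0 r t))"] cf
    by (simp add: continuous_on_norm)
  have "((\<lambda>u. f u / (u - w)) has_contour_integral (2 * of_real pi * \<i> * f w)) (circlepath 0 r)"
    using f r w by (intro Cauchy_integral_circlepath_simple) auto
  then have H: "((\<lambda>t. f (circlepath 0 r t) / (circlepath 0 r t - w) * vector_derivative (circlepath 0 r) (at t within {0..1})) has_integral (2 * of_real pi * \<i> * f w)) {0..1}"
    by (simp add: has_contour_integral_def)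
  have "norm (integral {0..1} (\<lambda>t. f (circlepath 0 r t) / (circlepath 0 r t - w) * vector_derivative (circlepath 0 r) (at t within {0..1})))
     \<le> integral {0..1} (\<lambda>t. 4 * pi * norm (f (circlepath 0 r t)))"
  proof (rule Henstock_Kurzweil_Integration.integral_norm_bound_integral)
    show "(\<lambda>t. f (circlepath 0 r t) / (circlepath 0 r t - w) * vector_derivative (circlepath 0 r) (at t within {0..1})) integrable_on {0..1}"
      using H by (rule has_integral_integrable)
    show "(\<lambda>t. 4 * pi * norm (f (circlepath 0 r t))) integrable_on {0..1}"
      by (intro integrable_continuous_interval continuous_intros continuous_on_norm cf)
    fix t :: real assume t: "t \<in> {0..1}"
    have n: "norm (circlepath 0 r t) = r" using r by (simp add: circlepath norm_mult)
    have "r / 2 \<le> norm (circlepath 0 r t - w)"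
      using norm_triangle_ineq2[of "circlepath 0 r t" w] n w by simp
    moreover have "norm (vector_derivative (circlepath 0 r) (at t within {0..1})) = 2 * pi * r"
      using t r by (simp add: vector_derivative_circlepath01 norm_mult)
    ultimately have "norm (f (circlepath 0 r t)) * (2 * pi * r) / norm (circlepath 0 r t - w) \<le> norm (f (circlepath 0 r t)) * (2 * pi * r) / (r / 2)"
      using r by (intro divide_left_mono mult_pos_pos) auto
    then show "norm (f (circlepath 0 r t) / (circlepath 0 r t - w) * vector_derivative (circlepath 0 r) (at t within {0..1})) \<le> 4 * pi * norm (f (circlepath 0 r t))"
      using r \<open>norm (vector_derivative _ _) = _\<close> by (simp add: norm_mult norm_divide field_simps)
  qed
  also have "\<dots> = 4 * pi * integral {0..1} (\<lambda>t. norm (f (circlepath 0 r t)))" by simp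
  also have "\<dots> \<le> 4 * pi * B" using I by simp
  finally have "norm (2 * of_real pi * \<i> * f w) \<le> 4 * pi * B"
    using integral_unique[OF H] by simp
  then show ?thesis by (simp add: norm_mult)
qed

text \<open>Consecutive quotients S_n / m^n differ by the step error over m^(n+1). The errors are of
  order (\<theta>^2 a)^n and |m| is at least \<theta> a, so the telescoping series converges at rate
  \<theta>^n, uniformly on the half disc, and its sum is holomorphic.\<close>

lemma geometric_holomorphic_limit:
  fixes S :: "nat \<Rightarrow> complex \<Rightarrow> complex" and m :: "complex \<Rightarrow> complex"
  assumes S: "\<And>n. S n holomorphic_on cball 0 r" and m: "m holomorphic_on cball 0 r" and r: "r > 0"
    and a: "a > 0" and \<theta>: "0 < \<theta>" "\<theta> < 1" and lo: "\<And>z. norm z \<le> r \<Longrightarrow> norm (m z) \<ge> \<theta> * a"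
    and b: "\<And>n. (\<integral>\<^sup>+t\<in>{0..1}. ennreal (norm (S (Suc n) (circlepath 0 r t) - m (circlepath 0 r t) * S n (circlepath 0 r t))) \<partial>lborel) \<le> ennreal (K * (\<theta>\<^sup>2 * a) ^ n)"
    and K: "K \<ge> 0"
  shows "\<exists>W. W holomorphic_on ball 0 (r / 2) \<and> (\<exists>K\<ge>0. \<forall>n z. norm z \<le> r / 2 \<longrightarrow> norm (S n z / m z ^ n - W z) \<le> K * \<theta> ^ n)"
proof -
  define g where "g n z = S (Suc n) z / m z ^ Suc n - S n z / m z ^ n" for n z
  define K' where "K' = 2 * K / (\<theta> * a)"
  have K': "K' \<ge> 0" using K a \<theta> by (simp add: K'_def)
  have mnz: "m z \<noteq> 0" if "norm z \<le> r" for z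
    using lo[OF that] mult_pos_pos[OF \<theta>(1) a] by auto
  have g_bound: "norm (g n z) \<le> K' * \<theta> ^ n" if z: "norm z \<le> r / 2" for n z
  proof -
    have "norm (S (Suc n) z - m z * S n z) \<le> 2 * (K * (\<theta>\<^sup>2 * a) ^ n)"
      by (rule Cauchy_norm_bound[OF _ r z b]) (use S m K a in \<open>auto intro!: holomorphic_intros\<close>)
    moreover have "g n z = (S (Suc n) z - m z * S n z) / m z ^ Suc n"
      using mnz[of z] z r by (simp add: g_def field_simps)
    moreover have "(\<theta> * a) ^ Suc n \<le> norm (m z ^ Suc n)"
      unfolding norm_power using lo[of z] z r a \<theta> by (intro power_mono) auto
    ultimately have "norm (g n z) \<le> 2 * (K * (\<theta>\<^sup>2 * a) ^ n) / (\<theta> * a) ^ Suc n"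
      using K a \<theta> by (simp only: norm_divide) (intro frac_le, auto)
    also have "\<dots> = K' * \<theta> ^ n"
      using a \<theta> by (simp add: K'_def power_mult_distrib field_simps power2_eq_square)
    finally show ?thesis .
  qed
  have geo: "summable (\<lambda>n. K' * \<theta> ^ n)" using \<theta> by (intro summable_mult summable_geometric) auto
  have sg: "summable (\<lambda>n. norm (g n z))" if "norm z \<le> r / 2" for z
    by (rule summable_comparison_test'[OF geo, of 0]) (use g_bound[OF that] in auto)
  define W where "W z = S 0 z + (\<Sum>n. g n z)" for z
  have part: "S n z / m z ^ n = S 0 z + (\<Sum>i<n. g i z)" for n z
    using sum_lessThan_telescope[of "\<lambda>n. S n z / m z ^ n" n] by (simp add: g_def)
  have conv: "norm (S n z / m z ^ n - W z) \<le> (K' / (1 - \<theta>)) * \<theta> ^ n" if z: "norm z \<le> r / 2" for n z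
  proof -
    have s: "summable (\<lambda>n. g n z)" using sg[OF z] by (rule summable_norm_cancel)
    have "W z - S n z / m z ^ n = (\<Sum>i. g (i + n) z)"
      unfolding W_def part using suminf_minus_initial_segment[OF s, of n] by simp
    also have "norm \<dots> \<le> (\<Sum>i. norm (g (i + n) z))"
      by (rule summable_norm) (use summable_ignore_initial_segment[OF sg[OF z], of n] in simp)
    also have "\<dots> \<le> (\<Sum>i. (K' * \<theta> ^ n) * \<theta> ^ i)"
    proof (rule suminf_le)
      show "norm (g (i + n) z) \<le> K' * \<theta> ^ n * \<theta> ^ i" for i
        using g_bound[OF z, of "i + n"] by (simp add: power_add mult_ac)
      show "summable (\<lambda>i. norm (g (i + n) z))" using summable_ignore_initial_segment[OF sg[OF z], of n] by simp
      show "summable (\<lambda>i. (K' * \<theta> ^ n) * \<theta> ^ i)" using \<theta> by (intro summable_mult summable_geometric) auto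
    qed
    also have "\<dots> = (K' / (1 - \<theta>)) * \<theta> ^ n"
      using \<theta> by (subst suminf_mult) (auto simp: summable_geometric suminf_geometric)
    finally show ?thesis by (simp add: norm_minus_commute)
  qed
  have "W holomorphic_on ball 0 (r / 2)"
  proof (rule holomorphic_uniform_sequence[of _ "\<lambda>n z. S n z / m z ^ n"])
    show "(\<lambda>z. S n z / m z ^ n) holomorphic_on ball 0 (r / 2)" for n
      using mnz r by (intro holomorphic_intros holomorphic_on_subset[OF S] holomorphic_on_subset[OF m]) auto
    fix x :: complex assume x: "x \<in> ball 0 (r / 2)"
    then obtain d where d: "d > 0" "cball x d \<subseteq> ball 0 (r / 2)"
      using open_contains_cball open_ball by blast
    have "(\<lambda>n. (K' / (1 - \<theta>)) * \<theta> ^ n) \<longlonglongrightarrow> (K' / (1 - \<theta>)) * 0"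
      using \<theta> by (intro tendsto_mult_left LIMSEQ_power_zero) auto
    then have lim: "(\<lambda>n. (K' / (1 - \<theta>)) * \<theta> ^ n) \<longlonglongrightarrow> 0" by simp
    have "uniform_limit (cball x d) (\<lambda>n z. S n z / m z ^ n) W sequentially"
    proof (rule uniform_limitI)
      fix e :: real assume "e > 0"
      then have "\<forall>\<^sub>F n in sequentially. (K' / (1 - \<theta>)) * \<theta> ^ n < e" by (rule order_tendstoD(2)[OF lim])
      then show "\<forall>\<^sub>F n in sequentially. \<forall>z\<in>cball x d. dist (S n z / m z ^ n) (W z) < e"
      proof eventually_elim
        case (elim n)
        show ?case
        proof
          fix z assume "z \<in> cball x d"
          with d(2) have "norm z \<le> r / 2" by force
          from conv[OF this, of n] elim show "dist (S n z / m z ^ n) (W z) < e"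
            by (simp add: dist_norm)
        qed
      qed
    qed
    with d show "\<exists>d>0. cball x d \<subseteq> ball 0 (r / 2) \<and> uniform_limit (cball x d) (\<lambda>n z. S n z / m z ^ n) W sequentially"
      by blast
  qed auto
  moreover have "K' / (1 - \<theta>) \<ge> 0" using K' \<theta> by simp
  ultimately show ?thesis using conv by blast
qed

section \<open>Site counts, Fourier inversion and aperiodicity\<close>

lemma L_1_eq: "L \<zeta> 1 k \<omega> = card {i. i < length (\<zeta> [] \<omega>) \<and> \<zeta> [] \<omega> ! i = k}"
proof -
  have "{u \<in> gen \<zeta> 1 \<omega>. pos \<zeta> u \<omega> = k} = (\<lambda>i. [i]) ` {i. i < length (\<zeta> [] \<omega>) \<and> \<zeta> [] \<omega> ! i = k}"
    using gen_Suc[of \<zeta> 0 \<omega>] by (auto simp: gen_0 pos_def)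
  then show ?thesis by (simp add: L_def card_image inj_on_def)
qed

lemma L_1_pos_iff: "0 < L \<zeta> 1 k \<omega> \<longleftrightarrow> k \<in> set (\<zeta> [] \<omega>)"
  unfolding L_1_eq by (auto simp: card_gt_0_iff in_set_conv_nth)

lemma finite_L_support: "finite {k. L \<zeta> n k \<omega> \<noteq> 0}"
proof (rule finite_subset)
  show "{k. L \<zeta> n k \<omega> \<noteq> 0} \<subseteq> (\<lambda>u. pos \<zeta> u \<omega>) ` gen \<zeta> n \<omega>"
    by (auto simp: L_def card_eq_0_iff)
qed (simp add: finite_gen)

lemma sum_gen_eq_sum_L:
  fixes f :: "int \<Rightarrow> 'b::real_normed_algebra_1"
  shows "(\<Sum>u\<in>gen \<zeta> n \<omega>. f (pos \<zeta> u \<omega>)) = (\<Sum>k\<in>{k. L \<zeta> n k \<omega> \<noteq> 0}. f k * of_nat (L \<zeta> n k \<omega>))"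
proof -
  have "(\<Sum>u\<in>gen \<zeta> n \<omega>. f (pos \<zeta> u \<omega>)) = (\<Sum>k\<in>{k. L \<zeta> n k \<omega> \<noteq> 0}. \<Sum>u\<in>{u \<in> gen \<zeta> n \<omega>. pos \<zeta> u \<omega> = k}. f (pos \<zeta> u \<omega>))"
    by (rule sum.group[symmetric]) (auto simp: finite_gen finite_L_support L_def card_eq_0_iff)
  also have "\<dots> = (\<Sum>k\<in>{k. L \<zeta> n k \<omega> \<noteq> 0}. f k * of_nat (L \<zeta> n k \<omega>))"
  proof (intro sum.cong refl)
    fix k
    have "(\<Sum>u\<in>{u \<in> gen \<zeta> n \<omega>. pos \<zeta> u \<omega> = k}. f (pos \<zeta> u \<omega>)) = (\<Sum>u\<in>{u \<in> gen \<zeta> n \<omega>. pos \<zeta> u \<omega> = k}. f k)"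
      by (intro sum.cong) auto
    then show "(\<Sum>u\<in>{u \<in> gen \<zeta> n \<omega>. pos \<zeta> u \<omega> = k}. f (pos \<zeta> u \<omega>)) = f k * of_nat (L \<zeta> n k \<omega>)"
      by (simp add: L_def mult_of_nat_commute)
  qed
  finally show ?thesis .
qed

lemma integral_exp_int:
  "(LBINT t:{-pi..pi}. exp (\<i> * of_real t * of_int j)) = (if j = 0 then of_real (2 * pi) else 0)"
proof (cases "j = 0")
  case False
  define F where "F t = exp (\<i> * of_real t * of_int j) / (\<i> * of_int j)" for t :: real
  have "((\<lambda>t. exp (\<i> * of_real t * of_int j)) has_integral (F pi - F (- pi))) {-pi..pi}"
  proof (rule fundamental_theorem_of_calculus)
    fix t :: real
    have "((\<lambda>z. exp (\<i> * z * of_int j) / (\<i> * of_int j)) has_field_derivative exp (\<i> * of_real t * of_int j)) (at (of_real t))"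
      using False by (auto intro!: derivative_eq_intros)
    from has_vector_derivative_real_field[OF this]
    show "(F has_vector_derivative exp (\<i> * of_real t * of_int j)) (at t within {-pi..pi})"
      unfolding F_def by (rule has_vector_derivative_at_within)
  qed simp
  moreover have "F pi = F (- pi)"
  proof -
    have "exp (\<i> * of_real pi * of_int j) = exp (\<i> * of_real (- pi) * of_int j + of_int (2 * j) * (of_real pi * \<i>))"
      by (rule arg_cong[where f=exp]) (simp add: algebra_simps)
    also have "\<dots> = exp (\<i> * of_real (- pi) * of_int j)"
      using exp_plus_2pin[of "\<i> * of_real (- pi) * of_int j" j] by (simp add: mult_ac)
    finally show ?thesis by (simp add: F_def)
  qed
  ultimately have "integral {-pi..pi} (\<lambda>t. exp (\<i> * of_real t * of_int j)) = 0"
    by (simp add: integral_unique)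
  moreover have "set_integrable lborel {-pi..pi} (\<lambda>t. exp (\<i> * of_real t * of_int j))"
    by (intro borel_integrable_atLeastAtMost' continuous_intros)
  ultimately show ?thesis using False set_borel_integral_eq_integral(2) by metis
qed (simp add: set_lebesgue_integral_def scaleR_conv_of_real)

text \<open>On the imaginary axis the generation sum is a trigonometric polynomial whose
  coefficients are the counts L_n(k).\<close>

lemma Fourier_inversion:
  "(LBINT t:{-pi..pi}. exp (- (\<i> * of_real t * of_int k)) * gen_sum \<zeta> (\<i> * of_real t) n \<omega>) = of_real (2 * pi * real (L \<zeta> n k \<omega>))"
proof -
  have int: "set_integrable lborel {-pi..pi} (\<lambda>t. exp (\<i> * of_real t * of_int j))" for j :: int
    by (intro borel_integrable_atLeastAtMost' continuous_intros)
  have "exp (- (\<i> * of_real t * of_int k)) * gen_sum \<zeta> (\<i> * of_real t) n \<omega>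
      = (\<Sum>u\<in>gen \<zeta> n \<omega>. exp (\<i> * of_real t * of_int (pos \<zeta> u \<omega> - k)))" for t
    unfolding gen_sum_def sum_distrib_left cexpi_def
    by (intro sum.cong) (simp_all add: algebra_simps flip: exp_add)
  then have "(LBINT t:{-pi..pi}. exp (- (\<i> * of_real t * of_int k)) * gen_sum \<zeta> (\<i> * of_real t) n \<omega>)
      = (\<Sum>u\<in>gen \<zeta> n \<omega>. LBINT t:{-pi..pi}. exp (\<i> * of_real t * of_int (pos \<zeta> u \<omega> - k)))"
    using int unfolding set_lebesgue_integral_def set_integrable_def
    by (simp add: scaleR_sum_right Bochner_Integration.integral_sum del: of_int_diff)
  also have "\<dots> = (\<Sum>u\<in>gen \<zeta> n \<omega>. if pos \<zeta> u \<omega> = k then of_real (2 * pi) else 0)"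
    unfolding integral_exp_int by (intro sum.cong) (auto simp del: of_int_diff)
  also have "\<dots> = of_real (2 * pi * real (L \<zeta> n k \<omega>))"
    by (simp add: L_def finite_gen sum.If_cases Int_def mult.commute)
  finally show ?thesis .
qed

text \<open>The integers d with t d in 2 pi Z form a subgroup, nontrivial because of k1. Its least
  positive element h divides every k - k0 with \<open>P k\<close>, so the last assumption excludes h
  >= 2, and h = 1 is the claim.\<close>

lemma lattice_step:
  fixes t :: real and P :: "int \<Rightarrow> bool" and k0 k1 :: int
  assumes P: "\<And>k. P k \<Longrightarrow> \<exists>j::int. t * of_int (k - k0) = of_int j * 2 * pi"
    and k1: "P k1" "k1 \<noteq> k0"
    and E: "\<not> (\<exists>h::int \<ge> 2. \<exists>a::int. \<forall>k. P k \<longrightarrow> h dvd (k - a))"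
  shows "\<exists>j::int. t = of_int j * 2 * pi"
proof -
  define G where "G = {d::int. \<exists>j::int. t * of_int d = of_int j * 2 * pi}"
  have diff: "d - q * e \<in> G" if de: "d \<in> G" "e \<in> G" for d e q
  proof -
    obtain i j where ij: "t * of_int d = of_int i * 2 * pi" "t * of_int e = of_int j * 2 * pi"
      using de unfolding G_def by blast
    have "t * of_int (d - q * e) = t * of_int d - of_int q * (t * of_int e)" by (simp add: algebra_simps)
    also have "\<dots> = of_int (i - q * j) * 2 * pi" unfolding ij by (simp add: algebra_simps)
    finally show ?thesis unfolding G_def by blast
  qed
  have PG: "k - k0 \<in> G" if "P k" for k using P[OF that] by (simp add: G_def)
  have G0: "0 \<in> G" by (auto simp: G_def intro: exI[of _ 0])
  have "\<bar>k1 - k0\<bar> \<in> G"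
    using PG[OF k1(1)] diff[OF G0 PG[OF k1(1)], of 1] by (auto simp: abs_if)
  then have ex: "\<exists>h::nat. h > 0 \<and> int h \<in> G" using k1(2) by (intro exI[of _ "nat \<bar>k1 - k0\<bar>"]) auto
  define h where "h = (LEAST h::nat. h > 0 \<and> int h \<in> G)"
  have h: "h > 0" "int h \<in> G" using LeastI_ex[OF ex] by (auto simp: h_def)
  have dvd: "int h dvd d" if "d \<in> G" for d
  proof (rule ccontr)
    assume "\<not> int h dvd d"
    then have "d mod int h \<noteq> 0" by (simp add: dvd_eq_mod_eq_0)
    then have pos: "0 < d mod int h" "d mod int h < int h"
      using h(1) pos_mod_sign[of "int h" d] pos_mod_bound[of "int h" d] by linarith+
    have "d mod int h \<in> G"
      using diff[OF that h(2), of "d div int h"] by (simp add: minus_div_mult_eq_mod)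
    then have "h \<le> nat (d mod int h)"
      using Least_le[of "\<lambda>h. h > 0 \<and> int h \<in> G" "nat (d mod int h)", folded h_def] pos by simp
    with pos show False by linarith
  qed
  have "\<not> int h \<ge> 2" using E dvd PG by blast
  then have "h = 1" using h(1) by linarith
  with h(2) show ?thesis by (auto simp: G_def)
qed

context brw_exp_moments
begin

lemma norm_m_imag_le: "norm (m (\<i> * of_real t)) \<le> a"
proof -
  have i: "integrable M (\<lambda>\<omega>. offspring_sum (of_real 0) (\<zeta> [] \<omega>))"
    using delta_pos by (intro integrable_offspring_sum) auto
  have i2: "integrable M (\<lambda>\<omega>. offspring_sum (\<i> * of_real t) (\<zeta> [] \<omega>))"
    using delta_pos by (intro integrable_offspring_sum) auto
  have le: "norm (offspring_sum (\<i> * of_real t) c) \<le> Re (offspring_sum (of_real 0) c)" for c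
  proof (induction c)
    case (Cons k c)
    then show ?case
      using norm_triangle_ineq[of "cexpi (\<i> * of_real t) k" "offspring_sum (\<i> * of_real t) c"]
      by (simp add: offspring_sum_def norm_cexpi cexpi_def)
  qed (simp add: offspring_sum_def)
  have "norm (m (\<i> * of_real t)) \<le> expectation (\<lambda>\<omega>. norm (offspring_sum (\<i> * of_real t) (\<zeta> [] \<omega>)))"
    unfolding m_def by (rule integral_norm_bound)
  also have "\<dots> \<le> expectation (\<lambda>\<omega>. Re (offspring_sum (of_real 0) (\<zeta> [] \<omega>)))"
    by (intro integral_mono integrable_norm i2 integrable_Re[OF i] le)
  also have "\<dots> = a" using integral_Re[OF i] by (simp add: a_def m_def)
  finally show ?thesis .
qed

text \<open>Equality case of the triangle inequality. Were the norm not below a, then with \<theta>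
  the argument of m(it) the nonnegative variable d would have mean at most 0, hence vanish almost
  surely. All phases t k - \<theta> over charged sites k would be multiples of 2 pi, and the lattice
  argument would make t a nonzero multiple of 2 pi.\<close>

lemma norm_m_imag_less:
  assumes E: "\<not> (\<exists>h::int \<ge> 2. \<exists>b::int. \<forall>k. vartheta1 M \<zeta> k > 0 \<longrightarrow> h dvd (k - b))"
    and A: "vartheta1 M \<zeta> k0 > 0" "vartheta1 M \<zeta> k1 > 0" "k1 \<noteq> k0"
    and t: "t \<noteq> 0" "\<bar>t\<bar> \<le> pi"
  shows "norm (m (\<i> * of_real t)) < a"
proof (rule ccontr)
  assume "\<not> norm (m (\<i> * of_real t)) < a"
  then have ge: "norm (m (\<i> * of_real t)) \<ge> a" by simp
  define \<theta> where "\<theta> = Arg (m (\<i> * of_real t))"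
  have polar: "m (\<i> * of_real t) = of_real (norm (m (\<i> * of_real t))) * exp (\<i> * of_real \<theta>)"
    using Arg_eq[of "m (\<i> * of_real t)"] by (cases "m (\<i> * of_real t) = 0") (auto simp: \<theta>_def)
  define d where "d c = Re (offspring_sum 0 c - exp (- \<i> * of_real \<theta>) * offspring_sum (\<i> * of_real t) c)" for c
  have d: "d c = (\<Sum>k\<leftarrow>c. 1 - cos (t * of_int k - \<theta>))" for c
  proof (induction c)
    case (Cons k c)
    have "Re (exp (- \<i> * of_real \<theta>) * cexpi (\<i> * of_real t) k) = cos (t * of_int k - \<theta>)"
      unfolding cexpi_def by (simp add: Re_exp algebra_simps flip: exp_add)
    then show ?case using Cons
      by (simp add: d_def offspring_sum_def ring_distribs cexpi_def[of 0])
  qed (simp add: d_def offspring_sum_def)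
  have d0: "0 \<le> d c" for c unfolding d by (rule sum_list_nonneg) auto
  have i: "integrable M (\<lambda>\<omega>. offspring_sum 0 (\<zeta> [] \<omega>))" "integrable M (\<lambda>\<omega>. offspring_sum (\<i> * of_real t) (\<zeta> [] \<omega>))"
    using delta_pos by (auto intro!: integrable_offspring_sum)
  have id: "integrable M (\<lambda>\<omega>. d (\<zeta> [] \<omega>))"
    unfolding d_def by (intro integrable_Re Bochner_Integration.integrable_diff integrable_mult_right i)
  have "expectation (\<lambda>\<omega>. d (\<zeta> [] \<omega>)) = Re (m 0 - exp (- \<i> * of_real \<theta>) * m (\<i> * of_real t))"
    unfolding d_def m_def using i by (subst integral_Re) auto
  also have "\<dots> = a - norm (m (\<i> * of_real t))"
    by (subst (1) polar) (simp add: m_0 exp_minus field_simps)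
  finally have "expectation (\<lambda>\<omega>. d (\<zeta> [] \<omega>)) \<le> 0" using ge by simp
  moreover have "expectation (\<lambda>\<omega>. d (\<zeta> [] \<omega>)) \<ge> 0" using d0 by (simp add: integral_nonneg_AE)
  ultimately have "AE \<omega> in M. d (\<zeta> [] \<omega>) = 0"
    using integral_nonneg_eq_0_iff_AE[OF id] d0 by simp
  then have AEk: "AE \<omega> in M. \<forall>k\<in>set (\<zeta> [] \<omega>). cos (t * of_int k - \<theta>) = 1"
  proof eventually_elim
    case (elim \<omega>)
    have "\<forall>x\<in>set (map (\<lambda>k. 1 - cos (t * of_int k - \<theta>)) (\<zeta> [] \<omega>)). x = 0"
      using elim unfolding d by (subst (asm) sum_list_nonneg_eq_0_iff) auto
    then show ?case by auto
  qed
  have cos1: "cos (t * of_int k - \<theta>) = 1" if k: "vartheta1 M \<zeta> k > 0" for k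
  proof (rule ccontr)
    assume "cos (t * of_int k - \<theta>) \<noteq> 1"
    with AEk have "AE \<omega> in M. of_nat (L \<zeta> 1 k \<omega>) = (0::ennreal)"
      using L_1_pos_iff[of \<zeta> k] by (auto elim!: eventually_mono)
    then have "vartheta1 M \<zeta> k = 0"
      unfolding vartheta1_def by (subst nn_integral_cong_AE[of _ "\<lambda>_. 0"]) auto
    with k show False by simp
  qed
  have "\<exists>j::int. t * of_int (k - k0) = of_int j * 2 * pi" if k: "vartheta1 M \<zeta> k > 0" for k
  proof -
    obtain i j :: int where ij: "t * of_int k - \<theta> = of_int i * 2 * pi" "t * of_int k0 - \<theta> = of_int j * 2 * pi"
      using cos1[OF k] cos1[OF A(1)] cos_one_2pi_int by metis
    have "t * of_int (k - k0) = (t * of_int k - \<theta>) - (t * of_int k0 - \<theta>)" by (simp add: algebra_simps)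
    also have "\<dots> = of_int (i - j) * 2 * pi" unfolding ij by (simp add: algebra_simps)
    finally show ?thesis by blast
  qed
  from lattice_step[OF this A(2,3) E] obtain j :: int where j: "t = of_int j * 2 * pi" by blast
  with t(1) have "j \<noteq> 0" by auto
  then have "\<bar>of_int j\<bar> \<ge> (1::real)" by linarith
  then have "\<bar>t\<bar> \<ge> 2 * pi" unfolding j by (simp add: abs_mult)
  with t(2) show False using pi_gt_zero by linarith
qed

lemma m_imag_sup:
  assumes lt: "\<And>t. t \<noteq> 0 \<Longrightarrow> \<bar>t\<bar> \<le> pi \<Longrightarrow> norm (m (\<i> * of_real t)) < a"
    and \<eta>: "0 < \<eta>" "\<eta> \<le> pi" and a: "a > 0"
  shows "\<exists>q. 0 < q \<and> q < 1 \<and> (\<forall>t. \<eta> \<le> \<bar>t\<bar> \<and> \<bar>t\<bar> \<le> pi \<longrightarrow> norm (m (\<i> * of_real t)) \<le> q * a)"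
proof -
  let ?A = "{-pi..-\<eta>} \<union> {\<eta>..pi}"
  have c: "continuous_on ?A (\<lambda>t. norm (m (\<i> * of_real t)))"
    by (intro continuous_on_norm continuous_on_compose2[OF holomorphic_on_imp_continuous_on[OF holomorphic_m]] continuous_intros)
       (use delta_pos in auto)
  obtain t0 where t0: "t0 \<in> ?A" "\<forall>t\<in>?A. norm (m (\<i> * of_real t)) \<le> norm (m (\<i> * of_real t0))"
  proof -
    have "compact ?A" "?A \<noteq> {}" using \<eta> by (auto simp: compact_Un)
    from continuous_attains_sup[OF this c] show ?thesis using that by blast
  qed
  have "t0 \<noteq> 0" "\<bar>t0\<bar> \<le> pi" using t0(1) \<eta> by auto
  from lt[OF this] have l: "norm (m (\<i> * of_real t0)) < a" .
  \<comment> \<open>The 1/2 keeps q positive even if the maximum is 0.\<close>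
  define q where "q = max (1/2) (norm (m (\<i> * of_real t0)) / a)"
  have "q * a \<ge> norm (m (\<i> * of_real t0))"
    using a by (simp add: q_def max_mult_distrib_right)
  then show ?thesis
    using l a t0(2) by (intro exI[of _ q]) (auto simp: q_def abs_if intro: order_trans split: if_splits)
qed

text \<open>Induction through E|S_(n+1)| <= E|error| + |m| E|S_n|. The gap between q and q' absorbs
  the error: K satisfies C <= K (q' - q) a, so the two terms add up to at most K (q'
  a)^(n+1).\<close>

lemma expectation_away:
  assumes b: "\<And>n. (\<integral>\<^sup>+\<omega>. ennreal (norm (step_error z n \<omega>)) \<partial>M) \<le> ennreal (C * (\<rho> * a) ^ n)"
    and mz: "norm (m z) \<le> q * a" and q: "0 < q" "q < q'" "\<rho> \<le> q'" "0 < \<rho>" and a: "a > 0" and C: "C \<ge> 0"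
  shows "(\<integral>\<^sup>+\<omega>. ennreal (norm (gen_sum \<zeta> z n \<omega>)) \<partial>M) \<le> ennreal (max 1 (C / ((q' - q) * a)) * (q' * a) ^ n)"
proof (induction n)
  case 0
  then show ?case by (simp add: gen_sum_0 emeasure_space_1)
next
  case (Suc n)
  define K where "K = max 1 (C / ((q' - q) * a))"
  have K: "K \<ge> 1" "C \<le> K * ((q' - q) * a)"
  proof -
    have "C / ((q' - q) * a) \<le> K" by (simp add: K_def)
    then show "C \<le> K * ((q' - q) * a)" using q a by (simp add: pos_divide_le_eq)
  qed (simp add: K_def)
  have [measurable]: "gen_sum \<zeta> z n \<in> borel_measurable M" for n
    unfolding gen_sum_def using measurable_gen_sum_mult[where z=z and n=n and g="\<lambda>_. 1"] by simp
  have "(\<integral>\<^sup>+\<omega>. ennreal (norm (gen_sum \<zeta> z (Suc n) \<omega>)) \<partial>M)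
     \<le> (\<integral>\<^sup>+\<omega>. ennreal (norm (step_error z n \<omega>)) + ennreal (norm (m z)) * ennreal (norm (gen_sum \<zeta> z n \<omega>)) \<partial>M)"
  proof (intro nn_integral_mono)
    fix \<omega>
    have "norm (gen_sum \<zeta> z (Suc n) \<omega>) \<le> norm (step_error z n \<omega>) + norm (m z) * norm (gen_sum \<zeta> z n \<omega>)"
      using norm_triangle_sub[of "gen_sum \<zeta> z (Suc n) \<omega>" "m z * gen_sum \<zeta> z n \<omega>"] by (simp add: norm_mult)
    then show "ennreal (norm (gen_sum \<zeta> z (Suc n) \<omega>)) \<le> ennreal (norm (step_error z n \<omega>)) + ennreal (norm (m z)) * ennreal (norm (gen_sum \<zeta> z n \<omega>))"
      by (simp add: ennreal_leI flip: ennreal_mult ennreal_plus)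
  qed
  also have "\<dots> = (\<integral>\<^sup>+\<omega>. ennreal (norm (step_error z n \<omega>)) \<partial>M) + ennreal (norm (m z)) * (\<integral>\<^sup>+\<omega>. ennreal (norm (gen_sum \<zeta> z n \<omega>)) \<partial>M)"
    by (subst nn_integral_add) (auto simp: nn_integral_cmult)
  also have "\<dots> \<le> ennreal (C * (\<rho> * a) ^ n) + ennreal (q * a) * ennreal (K * (q' * a) ^ n)"
    using Suc.IH mz by (intro add_mono mult_mono b) (auto simp: K_def intro!: ennreal_leI)
  also have "\<dots> = ennreal (C * (\<rho> * a) ^ n + q * a * (K * (q' * a) ^ n))"
    using C q a K by (simp add: ennreal_mult ennreal_plus)
  also have "\<dots> \<le> ennreal (K * (q' * a) ^ Suc n)"
  proof (rule ennreal_leI)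
    have "C * (\<rho> * a) ^ n \<le> (K * ((q' - q) * a)) * (q' * a) ^ n"
      using K C q a by (intro mult_mono power_mono) auto
    then show "C * (\<rho> * a) ^ n + q * a * (K * (q' * a) ^ n) \<le> K * (q' * a) ^ Suc n"
      by (simp add: algebra_simps)
  qed
  finally show ?case by (simp add: K_def)
qed

text \<open>Joint measurability in t and the sample point, as Tonelli requires. It is inherited from
  the sums over finitely many labels, where each weight is explicit in both variables.\<close>

lemma measurable_gen_sum_path:
  assumes "\<gamma> \<in> borel_measurable lborel"
  shows "(\<lambda>(t, \<omega>). gen_sum \<zeta> (\<gamma> t) n \<omega>) \<in> borel_measurable (lborel \<Otimes>\<^sub>M M)"
proof -
  note [measurable] = assms
  have w: "(\<lambda>x. weight \<zeta> (\<gamma> (fst x)) u (snd x)) \<in> borel_measurable (lborel \<Otimes>\<^sub>M M)" for u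
    unfolding weight_def cexpi_def by measurable
  have lim: "(\<lambda>j. \<Sum>u\<in>{u. set u \<subseteq> {..<j} \<and> length u = n}. weight \<zeta> (\<gamma> (fst x)) u (snd x)) \<longlonglongrightarrow> gen_sum \<zeta> (\<gamma> (fst x)) n (snd x)" for x
    using gen_sum_limit[where z="\<gamma> (fst x)" and \<omega>="snd x" and f="\<lambda>_. 1" and n=n] by (simp add: gen_sum_def)
  have "(\<lambda>x. gen_sum \<zeta> (\<gamma> (fst x)) n (snd x)) \<in> borel_measurable (lborel \<Otimes>\<^sub>M M)"
    by (rule borel_measurable_LIMSEQ_metric[OF _ lim]) (intro borel_measurable_sum w)
  then show ?thesis by (simp add: case_prod_beta)
qed

lemma holomorphic_gen_sum: "(\<lambda>z. gen_sum \<zeta> z n \<omega>) holomorphic_on S"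
  unfolding gen_sum_def cexpi_def by (intro holomorphic_intros)

end

context brw_contraction
begin

lemma AE_Fourier_away:
  assumes lt: "\<And>t. t \<noteq> 0 \<Longrightarrow> \<bar>t\<bar> \<le> pi \<Longrightarrow> norm (m (\<i> * of_real t)) < a"
    and \<eta>: "0 < \<eta>" "\<eta> \<le> pi"
  shows "\<exists>\<theta>>0. \<theta> < 1 \<and> (AE \<omega> in M. \<exists>K\<ge>0. \<forall>n. (\<integral>\<^sup>+t\<in>{-pi..pi} - {-\<eta>..\<eta>}. ennreal (norm (gen_sum \<zeta> (\<i> * of_real t) n \<omega> / of_real (a ^ n))) \<partial>lborel) \<le> ennreal (K * \<theta> ^ n))"
proof -
  obtain q where q: "0 < q" "q < 1" "\<And>t. \<eta> \<le> \<bar>t\<bar> \<Longrightarrow> \<bar>t\<bar> \<le> pi \<Longrightarrow> norm (m (\<i> * of_real t)) \<le> q * a"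
    using m_imag_sup[OF lt \<eta>] a by auto
  \<comment> \<open>The midpoint between max q \<rho> and 1: strictly above q and at least \<rho>,
    as the recursion requires, and still below 1.\<close>
  define q' where "q' = (1 + max q \<rho>) / 2"
  have q': "q < q'" "\<rho> \<le> q'" "0 < q'" "q' < 1" using q \<rho> by (auto simp: q'_def)
  define K where "K = max 1 (C / ((q' - q) * a))"
  have "AE \<omega> in M. \<exists>K\<ge>0. \<forall>n. (\<integral>\<^sup>+t\<in>{-pi..pi} - {-\<eta>..\<eta>}. ennreal (norm (gen_sum \<zeta> (\<i> * of_real t) n \<omega> / of_real (a ^ n))) \<partial>lborel) \<le> ennreal (K * sqrt q' ^ n)"
  proof (rule AE_integral_geometric_bound)
    have "(\<lambda>(t, \<omega>). gen_sum \<zeta> (\<i> * of_real t) n \<omega>) \<in> borel_measurable (lborel \<Otimes>\<^sub>M M)" for n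
      by (rule measurable_gen_sum_path) simp
    then show "(\<lambda>(t, \<omega>). gen_sum \<zeta> (\<i> * of_real t) n \<omega> / of_real (a ^ n)) \<in> borel_measurable (lborel \<Otimes>\<^sub>M M)" for n
      by (simp add: case_prod_beta)
    have "emeasure lborel ({-pi..pi} - {-\<eta>..\<eta>}) \<le> emeasure lborel {-pi..pi}" by (intro emeasure_mono) auto
    then show "emeasure lborel ({-pi..pi} - {-\<eta>..\<eta>}) < \<infinity>" by (rule le_less_trans) simp
    show "{-pi..pi} - {-\<eta>..\<eta>} \<in> sets borel" by measurable
    fix n t assume t: "t \<in> {-pi..pi} - {-\<eta>..\<eta>}"
    let ?z = "\<i> * complex_of_real t"
    have E: "(\<integral>\<^sup>+\<omega>. ennreal (norm (gen_sum \<zeta> ?z n \<omega>)) \<partial>M) \<le> ennreal (K * (q' * a) ^ n)"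
      unfolding K_def
    proof (rule expectation_away[OF key])
      show "norm (m ?z) \<le> q * a" using t by (intro q(3)) auto
    qed (use r q q' \<rho> a C in auto)
    have mg: "gen_sum \<zeta> ?z n \<in> borel_measurable M"
      unfolding gen_sum_def using measurable_gen_sum_mult[where z="?z" and n=n and g="\<lambda>_. 1"] by simp
    have "(\<integral>\<^sup>+\<omega>. ennreal (norm (gen_sum \<zeta> ?z n \<omega> / of_real (a ^ n))) \<partial>M) = (\<integral>\<^sup>+\<omega>. ennreal (1 / a ^ n) * ennreal (norm (gen_sum \<zeta> ?z n \<omega>)) \<partial>M)"
      using a by (intro nn_integral_cong) (simp add: norm_divide norm_power flip: ennreal_mult)
    also have "\<dots> = ennreal (1 / a ^ n) * (\<integral>\<^sup>+\<omega>. ennreal (norm (gen_sum \<zeta> ?z n \<omega>)) \<partial>M)"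
      using mg by (intro nn_integral_cmult) simp
    also have "\<dots> \<le> ennreal (1 / a ^ n) * ennreal (K * (q' * a) ^ n)" by (intro mult_left_mono E) simp
    also have "\<dots> = ennreal (K * q' ^ n)"
      using a q' by (simp add: K_def power_mult_distrib flip: ennreal_mult)
    finally show "(\<integral>\<^sup>+\<omega>. ennreal (norm (gen_sum \<zeta> ?z n \<omega> / of_real (a ^ n))) \<partial>M) \<le> ennreal (K * q' ^ n)" .
  qed (use q' in \<open>auto simp: K_def\<close>)
  moreover have "sqrt q' > 0" "sqrt q' < 1" using q' by (simp_all add: real_sqrt_lt_1_iff)
  ultimately show ?thesis by blast
qed

text \<open>The step errors are integrated over the circle |z| = r, all of whose points lie in the
  strip where they are small in mean. Dividing by a^n beforehand turns the mean bound into a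
  decaying geometric one.\<close>

lemma AE_limit:
  shows "AE \<omega> in M. \<exists>W. W holomorphic_on ball 0 (r / 2) \<and> (\<exists>K\<ge>0. \<forall>n z. norm z \<le> r / 2 \<longrightarrow> norm (gen_sum \<zeta> z n \<omega> / m z ^ n - W z) \<le> K * root 4 \<rho> ^ n)"
proof -
  let ?g = "circlepath 0 r"
  have ng: "norm (?g t) = r" for t using r by (simp add: circlepath norm_mult)
  have Reg: "\<bar>Re (?g t)\<bar> \<le> r" for t using abs_Re_le_cmod[of "?g t"] ng[of t] by simp
  have Reg': "\<bar>Re (?g t)\<bar> < \<delta>" for t using Reg[of t] r by linarith
  have cg: "continuous_on UNIV ?g" unfolding circlepath_def part_circlepath_def by (intro continuous_intros)
  have mg: "?g \<in> borel_measurable lborel" using borel_measurable_continuous_onI[OF cg] by simp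
  have "continuous_on UNIV (\<lambda>t. m (?g t))"
    by (rule continuous_on_compose2[OF holomorphic_on_imp_continuous_on[OF holomorphic_m] cg])
       (use Reg' in auto)
  then have mm: "(\<lambda>t. m (?g t)) \<in> borel_measurable borel" by (rule borel_measurable_continuous_onI)
  \<comment> \<open>Links the exponents: the almost sure rate sqrt \<rho> is \<theta>^2 for \<theta>
    = \<rho>^(1/4), the form in which the limit lemma takes it.\<close>
  have root: "(root 4 \<rho>)\<^sup>2 = sqrt \<rho>"
  proof -
    have "((root 4 \<rho>)\<^sup>2)\<^sup>2 = root 4 \<rho> ^ 4" by simp
    also have "\<dots> = \<rho>" using \<rho> by (intro real_root_pow_pos2) auto
    finally show ?thesis using \<rho> by (intro real_sqrt_unique[symmetric]) auto
  qed
  have "AE \<omega> in M. \<exists>K\<ge>0. \<forall>n. (\<integral>\<^sup>+t\<in>{0..1}. ennreal (norm (step_error (?g t) n \<omega> / of_real (a ^ n))) \<partial>lborel) \<le> ennreal (K * sqrt \<rho> ^ n)"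
  proof (rule AE_integral_geometric_bound)
    fix n
    have j: "(\<lambda>x. gen_sum \<zeta> (?g (fst x)) n (snd x)) \<in> borel_measurable (lborel \<Otimes>\<^sub>M M)" for n
      using measurable_gen_sum_path[OF mg, of n] by (simp add: case_prod_beta)
    have "(\<lambda>x. m (?g (fst x))) \<in> borel_measurable (lborel \<Otimes>\<^sub>M M)"
      by (rule measurable_compose[OF measurable_fst]) (use mm in simp)
    with j[of n] j[of "Suc n"] show "(\<lambda>(t, \<omega>). (step_error (?g t) n \<omega>) / of_real (a ^ n)) \<in> borel_measurable (lborel \<Otimes>\<^sub>M M)"
      unfolding case_prod_beta by (intro borel_measurable_divide borel_measurable_diff borel_measurable_times borel_measurable_const)
    fix t :: real assume t: "t \<in> {0..1}"
    let ?D = "\<lambda>\<omega>. step_error (?g t) n \<omega>"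
    have g: "gen_sum \<zeta> z n \<in> borel_measurable M" for z n
      unfolding gen_sum_def using measurable_gen_sum_mult[where z=z and n=n and g="\<lambda>_. 1"] by simp
    have "(\<integral>\<^sup>+\<omega>. ennreal (norm (?D \<omega> / of_real (a ^ n))) \<partial>M) = (\<integral>\<^sup>+\<omega>. ennreal (1 / a ^ n) * ennreal (norm (?D \<omega>)) \<partial>M)"
      using a by (intro nn_integral_cong) (simp add: norm_divide norm_power flip: ennreal_mult)
    also have "\<dots> = ennreal (1 / a ^ n) * (\<integral>\<^sup>+\<omega>. ennreal (norm (?D \<omega>)) \<partial>M)"
      using g by (intro nn_integral_cmult) simp
    also have "\<dots> \<le> ennreal (1 / a ^ n) * ennreal (C * (\<rho> * a) ^ n)" by (intro mult_left_mono key Reg) simp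
    also have "\<dots> = ennreal (C * \<rho> ^ n)"
      using a \<rho> C by (simp add: power_mult_distrib flip: ennreal_mult)
    finally show "(\<integral>\<^sup>+\<omega>. ennreal (norm (?D \<omega> / of_real (a ^ n))) \<partial>M) \<le> ennreal (C * \<rho> ^ n)" .
  qed (use C \<rho> in auto)
  then show ?thesis
  proof eventually_elim
    case (elim \<omega>)
    then obtain K where K: "K \<ge> 0" "\<And>n. (\<integral>\<^sup>+t\<in>{0..1}. ennreal (norm (step_error (?g t) n \<omega> / of_real (a ^ n))) \<partial>lborel) \<le> ennreal (K * sqrt \<rho> ^ n)"
      by blast
    show ?case
    proof (rule geometric_holomorphic_limit[where K=K and a=a])
      show "(\<lambda>z. gen_sum \<zeta> z n \<omega>) holomorphic_on cball 0 r" for n by (rule holomorphic_gen_sum)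
      show "m holomorphic_on cball 0 r"
      proof (rule holomorphic_on_subset[OF holomorphic_m], safe)
        fix x assume "x \<in> cball (0::complex) r"
        then show "\<bar>Re x\<bar> < \<delta>" using abs_Re_le_cmod[of x] r delta_pos by simp
      qed
      fix n
      let ?D = "\<lambda>t. step_error (?g t) n \<omega>"
      have cD: "continuous_on {0..1} (\<lambda>t. norm (?D t))"
      proof -
        have c1: "continuous_on {0..1} (\<lambda>t. gen_sum \<zeta> (?g t) n \<omega>)" for n
          by (rule continuous_on_compose2[OF holomorphic_on_imp_continuous_on[OF holomorphic_gen_sum] continuous_on_subset[OF cg]]) auto
        have "continuous_on {0..1} (\<lambda>t. m (?g t))"
          using \<open>continuous_on UNIV (\<lambda>t. m (?g t))\<close> by (rule continuous_on_subset) simp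
        with c1[of n] c1[of "Suc n"] show ?thesis by (intro continuous_intros)
      qed
      have "(\<integral>\<^sup>+t\<in>{0..1}. ennreal (norm (?D t)) \<partial>lborel) = (\<integral>\<^sup>+t. ennreal (a ^ n) * (ennreal (norm (?D t / of_real (a ^ n))) * indicator {0..1} t) \<partial>lborel)"
        using a by (intro nn_integral_cong) (simp add: norm_divide norm_power flip: mult.assoc ennreal_mult)
      also have "\<dots> = ennreal (a ^ n) * (\<integral>\<^sup>+t\<in>{0..1}. ennreal (norm (?D t / of_real (a ^ n))) \<partial>lborel)"
      proof (rule nn_integral_cmult)
        have "(\<lambda>t. indicator {0..1} t *\<^sub>R norm (?D t)) \<in> borel_measurable borel"
          by (rule borel_measurable_continuous_on_indicator[OF _ cD]) simp
        then have "(\<lambda>t. ennreal (indicator {0..1} t *\<^sub>R norm (?D t) / a ^ n)) \<in> borel_measurable lborel"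
          by simp
        also have "(\<lambda>t. ennreal (indicator {0..1} t *\<^sub>R norm (?D t) / a ^ n)) = (\<lambda>t. ennreal (norm (?D t / of_real (a ^ n))) * indicator {0..1} t)"
          using a by (auto simp: fun_eq_iff indicator_def norm_divide norm_power)
        finally show "(\<lambda>t. ennreal (norm (?D t / of_real (a ^ n))) * indicator {0..1} t) \<in> borel_measurable lborel" .
      qed
      also have "\<dots> \<le> ennreal (a ^ n) * ennreal (K * sqrt \<rho> ^ n)" by (intro mult_left_mono K) simp
      also have "\<dots> = ennreal (K * ((root 4 \<rho>)\<^sup>2 * a) ^ n)"
        using a K(1) \<rho> unfolding root by (simp add: power_mult_distrib mult_ac flip: ennreal_mult)
      finally show "(\<integral>\<^sup>+t\<in>{0..1}. ennreal (norm (?D t)) \<partial>lborel) \<le> ennreal (K * ((root 4 \<rho>)\<^sup>2 * a) ^ n)" .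
    qed (use r a \<rho> K(1) lo in \<open>auto simp: real_root_lt_1_iff\<close>)
  qed
qed

end

section \<open>Positivity of the limit\<close>

lemma gen_sum_zero: "gen_sum \<zeta> 0 n \<omega> = of_nat (Npop \<zeta> n \<omega>)"
  by (simp add: gen_sum_def Npop_def cexpi_def)

lemma offspring_sum_0: "offspring_sum 0 c = of_nat (length c)"
  by (induction c) (simp_all add: offspring_sum_def cexpi_def)

lemma Npop_subtree_le:
  assumes "i < length (\<zeta> [] \<omega>)"
  shows "Npop (\<lambda>v. \<zeta> (i # v)) n \<omega> \<le> Npop \<zeta> (Suc n) \<omega>"
  unfolding Npop_def
proof (rule card_inj_on_le)
  show "inj_on ((#) i) (gen (\<lambda>v. \<zeta> (i # v)) n \<omega>)" by simp
  show "(#) i ` gen (\<lambda>v. \<zeta> (i # v)) n \<omega> \<subseteq> gen \<zeta> (Suc n) \<omega>"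
    using assms by (auto simp: gen_def alive_def less_Suc_eq_0_disj)
qed (rule finite_gen)

text \<open>
  The argument is a whole family of clusters; the population is read off from it through the
  coordinate maps, so that the event depends measurably on the family and can be transported to subtrees.
\<close>

definition dies_out :: "real \<Rightarrow> (nat list \<Rightarrow> int list) \<Rightarrow> bool" where
  "dies_out a \<xi> \<longleftrightarrow> (\<lambda>n. real (Npop (\<lambda>v \<xi>. \<xi> v) n \<xi>) / a ^ n) \<longlonglongrightarrow> 0"

lemma Npop_coord: "Npop (\<lambda>v \<xi>. \<xi> v) n (\<lambda>v. \<zeta> v \<omega>) = Npop \<zeta> n \<omega>"
  by (simp add: Npop_def gen_def alive_def)

text \<open>Generation n of a first-level subtree embeds into generation n + 1 of the tree, and the
  shift costs only a constant factor a in the normalisation.\<close>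

lemma dies_out_subtree:
  assumes "dies_out a (\<lambda>v. \<zeta> v \<omega>)" "i < length (\<zeta> [] \<omega>)" "a > 0"
  shows "dies_out a (\<lambda>v. \<zeta> (i # v) \<omega>)"
proof -
  have "(\<lambda>n. a * (real (Npop \<zeta> (Suc n) \<omega>) / a ^ Suc n)) \<longlonglongrightarrow> a * 0"
    using assms(1) unfolding dies_out_def Npop_coord by (intro tendsto_mult_left) (rule LIMSEQ_Suc)
  then have lim: "(\<lambda>n. real (Npop \<zeta> (Suc n) \<omega>) / a ^ n) \<longlonglongrightarrow> 0"
    using assms(3) by simp
  have "(\<lambda>n. real (Npop (\<lambda>v. \<zeta> (i # v)) n \<omega>) / a ^ n) \<longlonglongrightarrow> 0"
    by (rule tendsto_sandwich[OF _ _ tendsto_const lim])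
       (use Npop_subtree_le[of i \<zeta> \<omega>] assms(2,3) in \<open>auto intro!: always_eventually divide_right_mono\<close>)
  then show ?thesis unfolding dies_out_def using Npop_coord[of _ "\<lambda>v. \<zeta> (i # v)" \<omega>] by simp
qed

context branching_random_walk
begin

lemma measurable_dies_out[measurable]: "Measurable.pred (PiM UNIV (\<lambda>_. count_space UNIV)) (dies_out a)"
proof -
  have "gen_sum (\<lambda>v \<xi>. \<xi> v) 0 n \<in> borel_measurable (PiM UNIV (\<lambda>_. count_space UNIV))" for n
    by (rule borel_measurable_LIMSEQ_metric[OF _ gen_sum_limit[where f="\<lambda>_. 1", simplified, folded gen_sum_def]])
       (intro borel_measurable_sum measurable_weight_coord; simp)
  then have "(\<lambda>\<xi>. Re (gen_sum (\<lambda>v \<xi>. \<xi> v) 0 n \<xi>)) \<in> borel_measurable (PiM UNIV (\<lambda>_. count_space UNIV))" for n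
    by (rule measurable_compose) simp
  then have [measurable]: "(\<lambda>\<xi>. real (Npop (\<lambda>v \<xi>. \<xi> v) n \<xi>)) \<in> borel_measurable (PiM UNIV (\<lambda>_. count_space UNIV))" for n
    by (simp add: gen_sum_zero)
  show ?thesis unfolding dies_out_def by measurable
qed

text \<open>Prefixing by w is injective, so the clusters below w are again independent with the
  common law. A subtree is a copy of the whole tree, and any event read off from the family keeps
  its probability.\<close>

lemma distr_subtree:
  "distr M (PiM UNIV (\<lambda>_. count_space UNIV)) (\<lambda>\<omega> v. \<zeta> (w @ v) \<omega>) = PiM UNIV (\<lambda>_. distr M (count_space UNIV) (\<zeta> []))"
proof -
  have "indep_vars (\<lambda>v. PiM {w @ v} (\<lambda>_. count_space UNIV)) (\<lambda>v \<omega>. restrict (\<lambda>i. \<zeta> i \<omega>) {w @ v}) UNIV"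
    by (rule indep_vars_restrict[OF indep]) (auto simp: disjoint_family_on_def)
  then have "indep_vars (\<lambda>_. count_space UNIV) (\<lambda>v \<omega>. (\<lambda>\<xi>. \<xi> (w @ v)) (restrict (\<lambda>i. \<zeta> i \<omega>) {w @ v})) UNIV"
    by (rule indep_vars_compose2) (rule measurable_component_singleton; simp)
  then have "indep_vars (\<lambda>_. count_space UNIV) (\<lambda>v. \<zeta> (w @ v)) UNIV" by simp
  then have "distr M (PiM UNIV (\<lambda>_. count_space UNIV)) (\<lambda>\<omega>. \<lambda>v\<in>UNIV. \<zeta> (w @ v) \<omega>) = PiM UNIV (\<lambda>v. distr M (count_space UNIV) (\<zeta> (w @ v)))"
    by (subst (asm) indep_vars_iff_distr_eq_PiM) auto
  also have "\<dots> = PiM UNIV (\<lambda>_. distr M (count_space UNIV) (\<zeta> []))"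
    by (intro PiM_cong refl ident)
  finally show ?thesis by (simp only: restrict_UNIV)
qed

lemma prob_dies_out_subtree:
  "prob {\<omega>\<in>space M. dies_out a (\<lambda>v. \<zeta> (w @ v) \<omega>)} = prob {\<omega>\<in>space M. dies_out a (\<lambda>v. \<zeta> v \<omega>)}"
proof -
  have m: "(\<lambda>\<omega> v. \<zeta> (w @ v) \<omega>) \<in> M \<rightarrow>\<^sub>M PiM UNIV (\<lambda>_. count_space UNIV)" for w
    by (rule measurable_abs_UNIV) measurable
  let ?A = "{\<xi>\<in>space (PiM UNIV (\<lambda>_. count_space (UNIV :: int list set))). dies_out a \<xi>}"
  have "prob {\<omega>\<in>space M. dies_out a (\<lambda>v. \<zeta> (w @ v) \<omega>)} = measure (distr M (PiM UNIV (\<lambda>_. count_space UNIV)) (\<lambda>\<omega> v. \<zeta> (w @ v) \<omega>)) ?A" for w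
  proof (subst measure_distr[OF m])
    show "?A \<in> sets (PiM UNIV (\<lambda>_. count_space UNIV))" using measurable_dies_out by (simp add: pred_def)
  qed (auto intro!: arg_cong[where f=prob] simp: space_PiM)
  from this[of w, unfolded distr_subtree] this[of "[]", unfolded distr_subtree] show ?thesis by simp
qed

lemma prob_conj_indep:
  assumes AB: "A \<inter> B = {}" and m: "Measurable.pred (PiM A (\<lambda>_. count_space UNIV)) P" "Measurable.pred (PiM B (\<lambda>_. count_space UNIV)) Q"
  shows "prob {\<omega>\<in>space M. P (\<lambda>v\<in>A. \<zeta> v \<omega>) \<and> Q (\<lambda>v\<in>B. \<zeta> v \<omega>)} =
     prob {\<omega>\<in>space M. P (\<lambda>v\<in>A. \<zeta> v \<omega>)} * prob {\<omega>\<in>space M. Q (\<lambda>v\<in>B. \<zeta> v \<omega>)}"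
proof -
  let ?X = "{\<xi>\<in>space (PiM A (\<lambda>_. count_space UNIV)). P \<xi>}" and ?Y = "{\<xi>\<in>space (PiM B (\<lambda>_. count_space UNIV)). Q \<xi>}"
  have "?X \<in> sets (PiM A (\<lambda>_. count_space UNIV))" "?Y \<in> sets (PiM B (\<lambda>_. count_space UNIV))"
    using m by (auto simp: pred_def)
  from indep_varD[OF indep_var_restrict[OF indep AB] this]
  have "prob ((\<lambda>\<omega>. (\<lambda>v\<in>A. \<zeta> v \<omega>, \<lambda>v\<in>B. \<zeta> v \<omega>)) -` (?X \<times> ?Y) \<inter> space M) =
     prob ((\<lambda>\<omega>. \<lambda>v\<in>A. \<zeta> v \<omega>) -` ?X \<inter> space M) * prob ((\<lambda>\<omega>. \<lambda>v\<in>B. \<zeta> v \<omega>) -` ?Y \<inter> space M)" by simp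
  also have "(\<lambda>\<omega>. (\<lambda>v\<in>A. \<zeta> v \<omega>, \<lambda>v\<in>B. \<zeta> v \<omega>)) -` (?X \<times> ?Y) \<inter> space M = {\<omega>\<in>space M. P (\<lambda>v\<in>A. \<zeta> v \<omega>) \<and> Q (\<lambda>v\<in>B. \<zeta> v \<omega>)}"
    by (auto simp: space_PiM)
  also have "(\<lambda>\<omega>. \<lambda>v\<in>A. \<zeta> v \<omega>) -` ?X \<inter> space M = {\<omega>\<in>space M. P (\<lambda>v\<in>A. \<zeta> v \<omega>)}"
    by (auto simp: space_PiM)
  also have "(\<lambda>\<omega>. \<lambda>v\<in>B. \<zeta> v \<omega>) -` ?Y \<inter> space M = {\<omega>\<in>space M. Q (\<lambda>v\<in>B. \<zeta> v \<omega>)}"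
    by (auto simp: space_PiM)
  finally show ?thesis .
qed

lemma measurable_dies_out_subtree:
  assumes "\<And>v. i # v \<in> A"
  shows "Measurable.pred (PiM A (\<lambda>_. count_space UNIV)) (\<lambda>\<xi>. dies_out a (\<lambda>v. \<xi> (i # v)))"
proof (rule measurable_compose[OF _ measurable_dies_out])
  show "(\<lambda>\<xi> v. \<xi> (i # v)) \<in> PiM A (\<lambda>_. count_space UNIV) \<rightarrow>\<^sub>M PiM UNIV (\<lambda>_. count_space UNIV)"
    by (rule measurable_abs_UNIV) (rule measurable_component_singleton[OF assms])
qed

lemma measurable_dies_out_zeta[measurable]: "Measurable.pred M (\<lambda>\<omega>. dies_out a (\<lambda>v. \<zeta> (f v) \<omega>))"
proof (rule measurable_compose[OF _ measurable_dies_out])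
  show "(\<lambda>\<omega> v. \<zeta> (f v) \<omega>) \<in> M \<rightarrow>\<^sub>M PiM UNIV (\<lambda>_. count_space UNIV)"
    by (rule measurable_abs_UNIV) measurable
qed

text \<open>
  If the tree dies out, so do all first-generation subtrees. One of them always exists, and two
  independent ones exist with probability r; with q < 1 this leaves only q = 0.
\<close>

lemma prob_dies_out_le:
  fixes a :: real
  assumes a: "a > 0" and ne: "AE \<omega> in M. \<zeta> [] \<omega> \<noteq> []"
  defines "q \<equiv> prob {\<omega>\<in>space M. dies_out a (\<lambda>v. \<zeta> v \<omega>)}" and "r \<equiv> prob {\<omega>\<in>space M. 2 \<le> length (\<zeta> [] \<omega>)}"
  shows "q \<le> (1 - r) * q + r * (q * q)"
proof -
  let ?Z = "\<lambda>i \<omega>. dies_out a (\<lambda>v. \<zeta> (i # v) \<omega>)"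
  let ?K = "\<lambda>i::nat. range (\<lambda>v. i # v)"
  have q: "prob {\<omega>\<in>space M. ?Z i \<omega>} = q" for i
    using prob_dies_out_subtree[of a "[i]"] by (simp add: q_def)
  have m1: "Measurable.pred (PiM {[]} (\<lambda>_. count_space UNIV)) (\<lambda>\<xi>. length (\<xi> []) < 2)"
    and m2: "Measurable.pred (PiM {[]} (\<lambda>_. count_space UNIV)) (\<lambda>\<xi>. 2 \<le> length (\<xi> []))"
    by (rule measurable_compose[OF measurable_component_singleton]; simp)+
  have m3: "Measurable.pred (PiM (?K i) (\<lambda>_. count_space UNIV)) (\<lambda>\<xi>. dies_out a (\<lambda>v. \<xi> (i # v)))" for i
    by (rule measurable_dies_out_subtree) simp
  have m4: "Measurable.pred (PiM (?K 0 \<union> ?K 1) (\<lambda>_. count_space UNIV)) (\<lambda>\<xi>. dies_out a (\<lambda>v. \<xi> (0 # v)) \<and> dies_out a (\<lambda>v. \<xi> (1 # v)))"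
    by (intro pred_intros_logic measurable_dies_out_subtree) simp_all
  have p1: "prob {\<omega>\<in>space M. length (\<zeta> [] \<omega>) < 2 \<and> ?Z 0 \<omega>} = (1 - r) * q"
  proof -
    have "prob {\<omega>\<in>space M. length (\<zeta> [] \<omega>) < 2 \<and> ?Z 0 \<omega>} = prob {\<omega>\<in>space M. length (\<zeta> [] \<omega>) < 2} * q"
      using prob_conj_indep[OF _ m1 m3[of 0]] by (auto simp: q)
    moreover have "prob {\<omega>\<in>space M. length (\<zeta> [] \<omega>) < 2} = 1 - r"
    proof -
      have "r = prob (space M - {\<omega>\<in>space M. length (\<zeta> [] \<omega>) < 2})"
        unfolding r_def by (intro arg_cong[where f=prob]) auto
      also have "\<dots> = 1 - prob {\<omega>\<in>space M. length (\<zeta> [] \<omega>) < 2}" by (rule prob_compl) measurable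
      finally show ?thesis by simp
    qed
    ultimately show ?thesis by simp
  qed
  have p2: "prob {\<omega>\<in>space M. ?Z 0 \<omega> \<and> ?Z 1 \<omega>} = q * q"
    using prob_conj_indep[OF _ m3[of 0] m3[of 1]] q[of 0] q[of 1] by auto
  have p3: "prob {\<omega>\<in>space M. 2 \<le> length (\<zeta> [] \<omega>) \<and> ?Z 0 \<omega> \<and> ?Z 1 \<omega>} = r * (q * q)"
    using prob_conj_indep[OF _ m2 m4] p2 by (auto simp: r_def)
  have "q \<le> prob ({\<omega>\<in>space M. length (\<zeta> [] \<omega>) < 2 \<and> ?Z 0 \<omega>} \<union> {\<omega>\<in>space M. 2 \<le> length (\<zeta> [] \<omega>) \<and> ?Z 0 \<omega> \<and> ?Z 1 \<omega>})"
    unfolding q_def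
  proof (rule finite_measure_mono_AE)
    show "AE \<omega> in M. \<omega> \<in> {\<omega>\<in>space M. dies_out a (\<lambda>v. \<zeta> v \<omega>)} \<longrightarrow>
       \<omega> \<in> {\<omega>\<in>space M. length (\<zeta> [] \<omega>) < 2 \<and> ?Z 0 \<omega>} \<union> {\<omega>\<in>space M. 2 \<le> length (\<zeta> [] \<omega>) \<and> ?Z 0 \<omega> \<and> ?Z 1 \<omega>}"
      using ne
    proof eventually_elim
      case (elim \<omega>)
      show ?case
      proof
        assume z: "\<omega> \<in> {\<omega>\<in>space M. dies_out a (\<lambda>v. \<zeta> v \<omega>)}"
        have "?Z i \<omega>" if "i < length (\<zeta> [] \<omega>)" for i
          using dies_out_subtree[of a \<zeta> \<omega> i] z that a by simp
        from this[of 0] this[of 1] z elim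
        show "\<omega> \<in> {\<omega>\<in>space M. length (\<zeta> [] \<omega>) < 2 \<and> ?Z 0 \<omega>} \<union> {\<omega>\<in>space M. 2 \<le> length (\<zeta> [] \<omega>) \<and> ?Z 0 \<omega> \<and> ?Z 1 \<omega>}"
          by (auto simp: not_less)
      qed
    qed
  qed measurable
  also have "\<dots> \<le> prob {\<omega>\<in>space M. length (\<zeta> [] \<omega>) < 2 \<and> ?Z 0 \<omega>} + prob {\<omega>\<in>space M. 2 \<le> length (\<zeta> [] \<omega>) \<and> ?Z 0 \<omega> \<and> ?Z 1 \<omega>}"
    by (rule measure_Un_le) measurable
  finally show ?thesis by (simp only: p1 p3)
qed

end

context brw_exp_moments
begin

lemma mean_weight_0: "(\<integral>\<^sup>+\<omega>. ennreal (real (Npop \<zeta> n \<omega>)) \<partial>M) = ennreal (a ^ n)"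
  using mean_weight_eq[of 0 n] mgf_eq[of 0] delta_pos m_nonneg[of 0]
  by (simp add: mean_weight_def gen_sum_zero a_def ennreal_power)

end

context brw_contraction
begin

text \<open>If the normalised population tended to 0 almost surely, telescoping from time k to
  infinity would bound it at time k by the sum of all later increments. Its mean is 1 for every k,
  whereas the increments after k have total mean at most C \<rho>^k / (1 - \<rho>), which tends to
  0.\<close>

lemma prob_dies_out_less_1:
  shows "prob {\<omega>\<in>space M. dies_out a (\<lambda>v. \<zeta> v \<omega>)} < 1"
proof (rule ccontr)
  assume "\<not> ?thesis"
  then have "prob {\<omega>\<in>space M. dies_out a (\<lambda>v. \<zeta> v \<omega>)} = 1" using prob_le_1 by (simp add: order.antisym not_less)
  then have AE0: "AE \<omega> in M. dies_out a (\<lambda>v. \<zeta> v \<omega>)"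
    using measurable_dies_out_zeta[of a "\<lambda>v. v"] by (subst (asm) prob_Collect_eq_1) (auto simp: pred_def)
  define x where "x n \<omega> = real (Npop \<zeta> n \<omega>) / a ^ n" for n \<omega>
  have [measurable]: "gen_sum \<zeta> 0 n \<in> borel_measurable M" for n
    unfolding gen_sum_def using measurable_gen_sum_mult[where z=0 and n=n and g="\<lambda>_. 1"] by simp
  have [measurable]: "(\<lambda>\<omega>. real (Npop \<zeta> n \<omega>)) \<in> borel_measurable M" for n
  proof -
    have "(\<lambda>\<omega>. Re (gen_sum \<zeta> 0 n \<omega>)) \<in> borel_measurable M" by measurable
    then show ?thesis by (simp add: gen_sum_zero)
  qed
  have [measurable]: "x n \<in> borel_measurable M" for n unfolding x_def by measurable
  have x0: "0 \<le> x n \<omega>" for n \<omega> using a by (simp add: x_def)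
  have Ex: "(\<integral>\<^sup>+\<omega>. ennreal (x n \<omega>) \<partial>M) = 1" for n
  proof -
    have "(\<integral>\<^sup>+\<omega>. ennreal (x n \<omega>) \<partial>M) = (\<integral>\<^sup>+\<omega>. ennreal (1 / a ^ n) * ennreal (real (Npop \<zeta> n \<omega>)) \<partial>M)"
      using a by (intro nn_integral_cong) (simp add: x_def flip: ennreal_mult)
    also have "\<dots> = ennreal (1 / a ^ n) * ennreal (a ^ n)"
      unfolding mean_weight_0[symmetric] by (intro nn_integral_cmult) measurable
    finally show ?thesis using a by (simp flip: ennreal_mult)
  qed
  have Ed: "(\<integral>\<^sup>+\<omega>. ennreal \<bar>x (Suc n) \<omega> - x n \<omega>\<bar> \<partial>M) \<le> ennreal (C * \<rho> ^ n)" for n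
  proof -
    have *: "ennreal \<bar>x (Suc n) \<omega> - x n \<omega>\<bar> = ennreal (1 / a ^ Suc n) * ennreal (norm (step_error 0 n \<omega>))" for \<omega>
    proof -
      have "step_error 0 n \<omega> = of_real (real (Npop \<zeta> (Suc n) \<omega>) - a * real (Npop \<zeta> n \<omega>))"
        by (simp add: gen_sum_zero m_0)
      then have "norm (step_error 0 n \<omega>) = \<bar>real (Npop \<zeta> (Suc n) \<omega>) - a * real (Npop \<zeta> n \<omega>)\<bar>"
        by (simp only: norm_of_real)
      moreover have "x (Suc n) \<omega> - x n \<omega> = (real (Npop \<zeta> (Suc n) \<omega>) - a * real (Npop \<zeta> n \<omega>)) / a ^ Suc n"
        using a by (simp add: x_def field_simps)
      ultimately show ?thesis using a by (simp add: abs_divide abs_mult flip: ennreal_mult)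
    qed
    have "(\<integral>\<^sup>+\<omega>. ennreal \<bar>x (Suc n) \<omega> - x n \<omega>\<bar> \<partial>M) = ennreal (1 / a ^ Suc n) * (\<integral>\<^sup>+\<omega>. ennreal (norm (step_error 0 n \<omega>)) \<partial>M)"
      unfolding * by (intro nn_integral_cmult) measurable
    also have "\<dots> \<le> ennreal (1 / a ^ Suc n) * ennreal (C * (\<rho> * a) ^ n)" by (intro mult_left_mono key) (use r in simp_all)
    also have "\<dots> = ennreal (C * \<rho> ^ n / a)"
      using a C \<rho> by (simp add: power_mult_distrib flip: ennreal_mult)
    also have "\<dots> \<le> ennreal (C * \<rho> ^ n)"
      using a mult_nonneg_nonneg[OF C zero_le_power[of \<rho> n]] \<rho> by (intro ennreal_leI) (simp add: divide_le_eq mult_le_cancel_left1)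
    finally show ?thesis .
  qed
  have bound: "ennreal (x k \<omega>) \<le> (\<Sum>j. ennreal \<bar>x (Suc (k + j)) \<omega> - x (k + j) \<omega>\<bar>)" if "dies_out a (\<lambda>v. \<zeta> v \<omega>)" for k \<omega>
  proof -
    let ?s = "\<Sum>j. ennreal \<bar>x (Suc (k + j)) \<omega> - x (k + j) \<omega>\<bar>"
    have "ennreal (x k \<omega>) \<le> ennreal (x (k + i) \<omega>) + ?s" for i
    proof -
      have "x k \<omega> = x (k + i) \<omega> - (\<Sum>j<i. x (Suc (k + j)) \<omega> - x (k + j) \<omega>)"
        using sum_lessThan_telescope[of "\<lambda>j. x (k + j) \<omega>" i] by simp
      also have "\<dots> \<le> x (k + i) \<omega> + (\<Sum>j<i. \<bar>x (Suc (k + j)) \<omega> - x (k + j) \<omega>\<bar>)"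
        using sum_abs[of "\<lambda>j. x (Suc (k + j)) \<omega> - x (k + j) \<omega>" "{..<i}"] by linarith
      finally have le: "x k \<omega> \<le> x (k + i) \<omega> + (\<Sum>j<i. \<bar>x (Suc (k + j)) \<omega> - x (k + j) \<omega>\<bar>)" .
      have e: "ennreal (x (k + i) \<omega>) + (\<Sum>j<i. ennreal \<bar>x (Suc (k + j)) \<omega> - x (k + j) \<omega>\<bar>)
         = ennreal (x (k + i) \<omega> + (\<Sum>j<i. \<bar>x (Suc (k + j)) \<omega> - x (k + j) \<omega>\<bar>))"
        by (simp only: sum_ennreal[OF abs_ge_zero] ennreal_plus[OF x0 sum_nonneg[OF abs_ge_zero]])
      have "ennreal (x k \<omega>) \<le> ennreal (x (k + i) \<omega>) + (\<Sum>j<i. ennreal \<bar>x (Suc (k + j)) \<omega> - x (k + j) \<omega>\<bar>)"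
        unfolding e by (rule ennreal_leI[OF le])
      also have "\<dots> \<le> ennreal (x (k + i) \<omega>) + ?s"
        by (intro add_left_mono sum_le_suminf) auto
      finally show ?thesis .
    qed
    moreover have "(\<lambda>i. ennreal (x (k + i) \<omega>) + ?s) \<longlonglongrightarrow> ennreal 0 + ?s"
    proof (intro tendsto_add tendsto_const tendsto_ennrealI)
      have "(\<lambda>n. x n \<omega>) \<longlonglongrightarrow> 0" using that unfolding dies_out_def Npop_coord x_def .
      from LIMSEQ_ignore_initial_segment[OF this, of k] show "(\<lambda>i. x (k + i) \<omega>) \<longlonglongrightarrow> 0" by (simp only: add.commute)
    qed
    ultimately have "ennreal (x k \<omega>) \<le> ennreal 0 + ?s"
      by (rule LIMSEQ_le_const[rotated, OF exI[of _ 0], OF allI, OF impI])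
    then show ?thesis by simp
  qed
  \<comment> \<open>The contradiction: a mean of 1 at each time k is bounded by a geometric
    tail.\<close>
  have "1 \<le> C * \<rho> ^ k / (1 - \<rho>)" for k
  proof -
    have "ennreal 1 = (\<integral>\<^sup>+\<omega>. ennreal (x k \<omega>) \<partial>M)" by (simp add: Ex)
    also have "\<dots> \<le> (\<integral>\<^sup>+\<omega>. (\<Sum>j. ennreal \<bar>x (Suc (k + j)) \<omega> - x (k + j) \<omega>\<bar>) \<partial>M)"
      by (intro nn_integral_mono_AE) (use AE0 bound in \<open>auto elim: eventually_mono\<close>)
    also have "\<dots> = (\<Sum>j. \<integral>\<^sup>+\<omega>. ennreal \<bar>x (Suc (k + j)) \<omega> - x (k + j) \<omega>\<bar> \<partial>M)"
      by (rule nn_integral_suminf) measurable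
    also have "\<dots> \<le> (\<Sum>j. ennreal (C * \<rho> ^ k * \<rho> ^ j))"
      using Ed[of "k + _"] by (intro suminf_le) (auto simp: power_add mult_ac)
    also have "\<dots> = ennreal (\<Sum>j. C * \<rho> ^ k * \<rho> ^ j)"
      using C \<rho> by (intro suminf_ennreal2 summable_mult summable_geometric) auto
    also have "(\<Sum>j. C * \<rho> ^ k * \<rho> ^ j) = C * \<rho> ^ k / (1 - \<rho>)"
      using \<rho> by (subst suminf_mult) (auto simp: summable_geometric suminf_geometric)
    finally show ?thesis using C \<rho> by (subst (asm) ennreal_le_iff) auto
  qed
  moreover have "(\<lambda>k. C * \<rho> ^ k / (1 - \<rho>)) \<longlonglongrightarrow> C * 0 / (1 - \<rho>)"
    using \<rho> by (intro tendsto_divide tendsto_mult_left tendsto_const LIMSEQ_power_zero) auto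
  ultimately have "1 \<le> C * 0 / (1 - \<rho>)"
    by (intro tendsto_lowerbound[of "\<lambda>k. C * \<rho> ^ k / (1 - \<rho>)"] always_eventually) auto
  then show False by simp
qed

lemma AE_not_dies_out:
  assumes ne: "AE \<omega> in M. \<zeta> [] \<omega> \<noteq> []"
  shows "AE \<omega> in M. \<not> (\<lambda>n. real (Npop \<zeta> n \<omega>) / a ^ n) \<longlonglongrightarrow> 0"
proof -
  define q where "q = prob {\<omega>\<in>space M. dies_out a (\<lambda>v. \<zeta> v \<omega>)}"
  define r where "r = prob {\<omega>\<in>space M. 2 \<le> length (\<zeta> [] \<omega>)}"
  have q1: "q < 1" "0 \<le> q" using prob_dies_out_less_1 by (auto simp: q_def)
  have "q \<le> (1 - r) * q + r * (q * q)"
    using prob_dies_out_le[OF _ ne, of a] a by (simp add: q_def r_def)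
  then have rq: "r * (q * (1 - q)) \<le> 0" by (simp add: algebra_simps)
  \<comment> \<open>Otherwise almost every cluster would have at most one point, and the mean
    offspring number could not exceed 1.\<close>
  have "r > 0"
  proof (rule ccontr)
    assume "\<not> r > 0"
    then have "r = 0" by (simp add: r_def order.antisym not_less)
    then have "AE \<omega> in M. \<not> 2 \<le> length (\<zeta> [] \<omega>)"
      unfolding r_def by (subst (asm) prob_Collect_eq_0) auto
    then have "AE \<omega> in M. ennreal (real (Npop \<zeta> 1 \<omega>)) \<le> 1"
    proof eventually_elim
      case (elim \<omega>)
      have "of_nat (Npop \<zeta> 1 \<omega>) = (of_nat (length (\<zeta> [] \<omega>)) :: complex)"
        unfolding gen_sum_zero[symmetric] gen_sum_1 offspring_sum_0 ..
      then have "Npop \<zeta> 1 \<omega> = length (\<zeta> [] \<omega>)" by (simp only: of_nat_eq_iff)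
      with elim show ?case by simp
    qed
    then have "(\<integral>\<^sup>+\<omega>. ennreal (real (Npop \<zeta> 1 \<omega>)) \<partial>M) \<le> (\<integral>\<^sup>+\<omega>. 1 \<partial>M)" by (rule nn_integral_mono_AE)
    then have "ennreal a \<le> 1" using mean_weight_0[of 1] by (simp add: emeasure_space_1)
    with a show False by simp
  qed
  with rq q1 have "q = 0" by (simp add: mult_le_0_iff)
  then have "AE \<omega> in M. \<not> dies_out a (\<lambda>v. \<zeta> v \<omega>)"
    unfolding q_def by (subst (asm) prob_Collect_eq_0) (use measurable_dies_out_zeta[of a "\<lambda>v. v"] in \<open>auto simp: pred_def\<close>)
  then show ?thesis unfolding dies_out_def Npop_coord .
qed

end

section \<open>Edgeworth expansion\<close>

lemma norm_exp_second_order: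
  fixes w :: complex
  shows "norm (exp w - 1 - w - w\<^sup>2 / 2) \<le> norm w ^ 3 * exp (norm w)"
proof -
  have "norm (exp w - (\<Sum>i\<le>2. w ^ i / fact i)) \<le> exp \<bar>Re w\<bar> * norm w ^ Suc 2 / fact 2"
    by (rule Taylor_exp)
  also have "\<dots> \<le> exp (norm w) * norm w ^ 3"
  proof -
    have "exp \<bar>Re w\<bar> \<le> exp (norm w)" using abs_Re_le_cmod[of w] by simp
    then have "exp \<bar>Re w\<bar> * norm w ^ 3 \<le> exp (norm w) * norm w ^ 3" by (intro mult_right_mono) auto
    moreover have "0 \<le> exp \<bar>Re w\<bar> * norm w ^ 3" "0 \<le> exp (norm w) * norm w ^ 3" by simp_all
    moreover have "exp \<bar>Re w\<bar> * norm w ^ Suc 2 / fact 2 = exp \<bar>Re w\<bar> * norm w ^ 3 / 2"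
      by (simp add: numeral_3_eq_3 fact_2)
    ultimately show ?thesis by linarith
  qed
  finally show ?thesis by (simp add: numeral_2_eq_2 algebra_simps)
qed

text \<open>Not an asymptotic relation but an inequality at one s: later the coefficients and K are
  functions of the integration variable x, and K must be tracked explicitly so that it can be
  integrated against the normal density. One constant for coefficients and remainder lets constants
  simply multiply under products.\<close>

definition expansion :: "real \<Rightarrow> real \<Rightarrow> complex \<Rightarrow> complex \<Rightarrow> complex \<Rightarrow> bool" where
  "expansion s K x x1 x2 \<longleftrightarrow> norm x1 \<le> K \<and> norm x2 \<le> K \<and> norm (x - (1 + of_real s * x1 + of_real s ^ 2 * x2)) \<le> s ^ 3 * K"

text \<open>The 10 is 3 + 4 + 1 + 1 + 1: the first polynomial against the second remainder, the
  first remainder against the whole second factor, and three products of coefficients carrying s^3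
  or s^4.\<close>

lemma expansion_mult:
  assumes "expansion s Ka x x1 x2" "expansion s Kb y y1 y2" "0 \<le> s" "s \<le> 1" "1 \<le> Ka" "1 \<le> Kb"
  shows "expansion s (10 * Ka * Kb) (x * y) (x1 + y1) (x2 + y2 + x1 * y1)"
proof -
  define S where "S = complex_of_real s"
  define rx where "rx = x - (1 + S * x1 + S ^ 2 * x2)"
  define ry where "ry = y - (1 + S * y1 + S ^ 2 * y2)"
  have nS: "norm S = s" using assms by (simp add: S_def)
  have x: "norm x1 \<le> Ka" "norm x2 \<le> Ka" "norm rx \<le> s ^ 3 * Ka"
    and y: "norm y1 \<le> Kb" "norm y2 \<le> Kb" "norm ry \<le> s ^ 3 * Kb"
    using assms(1,2) by (auto simp: expansion_def rx_def ry_def S_def)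
  have KK: "Ka \<le> Ka * Kb" "Kb \<le> Ka * Kb" "1 \<le> Ka * Kb"
    using assms(5,6) mult_mono[of 1 Ka 1 Kb] by (auto simp: mult_le_cancel_left1 mult_le_cancel_right1)
  have s_le: "s ^ 2 \<le> 1" "s ^ 3 \<le> 1" "s ^ 4 \<le> s ^ 3"
    using assms(3,4) by (auto intro!: power_le_one power_decreasing)
  have pm: "norm (u * v) \<le> a * b" if "norm u \<le> a" "norm v \<le> b" for u v :: complex and a b
    unfolding norm_mult using that norm_ge_zero order_trans by (intro mult_mono) blast+
  have s2: "norm (S ^ 2) \<le> 1" "norm S \<le> 1" using s_le assms by (simp_all add: norm_power nS)
  have npx: "norm (1 + S * x1 + S ^ 2 * x2) \<le> 3 * Ka"
    using norm_triangle_ineq[of "1 + S * x1" "S ^ 2 * x2"] norm_triangle_ineq[of 1 "S * x1"]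
      pm[OF s2(2) x(1)] pm[OF s2(1) x(2)] assms(5) by simp
  have ny: "norm y \<le> 4 * Kb"
  proof -
    have "y = 1 + S * y1 + S ^ 2 * y2 + ry" by (simp add: ry_def)
    also have "norm \<dots> \<le> 1 + Kb + Kb + norm ry"
      using norm_triangle_ineq[of "1 + S * y1 + S ^ 2 * y2" ry] norm_triangle_ineq[of "1 + S * y1" "S ^ 2 * y2"] norm_triangle_ineq[of 1 "S * y1"]
      pm[OF s2(2) y(1)] pm[OF s2(1) y(2)] by simp
    also have "norm ry \<le> Kb"
    proof -
      have "s ^ 3 * Kb \<le> 1 * Kb" using s_le assms(6) by (intro mult_right_mono) auto
      with y(3) show ?thesis by linarith
    qed
    finally show ?thesis using assms(6) by simp
  qed
  have "x * y - (1 + S * (x1 + y1) + S ^ 2 * (x2 + y2 + x1 * y1))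
    = (1 + S * x1 + S ^ 2 * x2) * ry + rx * y + S ^ 3 * (x1 * y2) + S ^ 3 * (x2 * y1) + S ^ 4 * (x2 * y2)"
    by (simp add: rx_def ry_def power2_eq_square power3_eq_cube power4_eq_xxxx algebra_simps)
  also have "norm \<dots> \<le> norm ((1 + S * x1 + S ^ 2 * x2) * ry) + norm (rx * y) + norm (S ^ 3 * (x1 * y2)) + norm (S ^ 3 * (x2 * y1)) + norm (S ^ 4 * (x2 * y2))"
    by (intro norm_triangle_le add_mono order_refl norm_triangle_ineq)
  also have "\<dots> \<le> 3 * Ka * (s ^ 3 * Kb) + s ^ 3 * Ka * (4 * Kb) + s ^ 3 * (Ka * Kb) + s ^ 3 * (Ka * Kb) + s ^ 3 * (Ka * Kb)"
    using s_le by (intro add_mono pm npx x y ny) (simp_all add: norm_power nS)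
  also have "\<dots> = s ^ 3 * (10 * Ka * Kb)" by simp
  finally have 1: "norm (x * y - (1 + S * (x1 + y1) + S ^ 2 * (x2 + y2 + x1 * y1))) \<le> s ^ 3 * (10 * Ka * Kb)" .
  have 2: "norm (x1 + y1) \<le> 10 * Ka * Kb"
    using norm_triangle_ineq[of x1 y1] x y KK by linarith
  have 3: "norm (x2 + y2 + x1 * y1) \<le> 10 * Ka * Kb"
    using norm_triangle_ineq[of "x2 + y2" "x1 * y1"] norm_triangle_ineq[of x2 y2] pm[OF x(1) y(1)] x y KK by linarith
  show ?thesis using 1 2 3 by (simp add: expansion_def S_def)
qed

text \<open>Separate from \<open>expansion_exp\<close> because an imaginary exponent has a Taylor
  remainder without exponential factor. The constant stays polynomial in b, which will be - y
  x.\<close>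

lemma expansion_iexp:
  assumes "0 \<le> s" "\<bar>b\<bar> \<le> K" "1 \<le> K"
  shows "expansion s (K ^ 3) (exp (\<i> * of_real (s * b))) (\<i> * of_real b) (- of_real (b\<^sup>2 / 2))"
proof -
  have "norm (iexp (s * b) - (\<Sum>k\<le>2. (\<i> * of_real (s * b)) ^ k / fact k)) \<le> \<bar>s * b\<bar> ^ Suc 2 / fact (Suc 2)"
    by (rule iexp_approx1)
  also have "\<dots> \<le> s ^ 3 * K ^ 3"
  proof -
    have "\<bar>b\<bar> ^ 3 \<le> K ^ 3" using assms by (intro power_mono) auto
    then have "s ^ 3 * \<bar>b\<bar> ^ 3 \<le> s ^ 3 * K ^ 3" using assms by (intro mult_left_mono) auto
    moreover have "0 \<le> s ^ 3 * \<bar>b\<bar> ^ 3" using assms by simp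
    ultimately have "s ^ 3 * \<bar>b\<bar> ^ 3 / 6 \<le> s ^ 3 * K ^ 3" by linarith
    then show ?thesis using assms by (simp add: abs_mult power_mult_distrib fact_numeral numeral_3_eq_3[symmetric] del: power_Suc)
  qed
  finally have 1: "norm (exp (\<i> * of_real (s * b)) - (1 + of_real s * (\<i> * of_real b) + of_real s ^ 2 * (- of_real (b\<^sup>2 / 2)))) \<le> s ^ 3 * K ^ 3"
    by (simp add: numeral_2_eq_2 power_mult_distrib algebra_simps)
  have "K \<le> K ^ 3" "K ^ 2 \<le> K ^ 3" using assms by (auto intro!: self_le_power power_increasing)
  moreover have "\<bar>b\<bar> ^ 2 \<le> K ^ 2" using assms by (intro power_mono) auto
  ultimately have "\<bar>b\<bar> \<le> K ^ 3" "b\<^sup>2 / 2 \<le> K ^ 3" using assms by (auto simp: power2_abs)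
  then show ?thesis using 1 by (simp add: expansion_def norm_mult norm_divide norm_power)
qed

text \<open>The size B of the exponent is kept apart from the coefficient bound K. Here B will be
  x^2/4, whose exponential the normal density still absorbs, while K grows only polynomially in
  x.\<close>

lemma expansion_exp:
  fixes w c1 c2 :: complex
  assumes s: "0 \<le> s" "s \<le> 1" and K: "1 \<le> K" and c: "norm c1 \<le> K" "norm c2 \<le> K"
    and w: "norm (w - (of_real s * c1 + of_real s ^ 2 * c2)) \<le> s ^ 3 * K" and B: "norm w \<le> B"
  shows "expansion s (40 * K ^ 3 * exp B) (exp w) c1 (c2 + c1\<^sup>2 / 2)"
proof -
  define S where "S = complex_of_real s"
  have nS: "norm S = s" using s by (simp add: S_def)
  have B0: "0 \<le> B" using B norm_ge_zero order_trans by blast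
  have s_le: "s ^ 2 \<le> 1" "s ^ 3 \<le> s" "s ^ 2 \<le> s" "s ^ 3 \<le> s ^ 2"
    using s power_decreasing[of 1 3 s] power_decreasing[of 1 2 s] by (auto intro!: power_le_one power_decreasing)
  define d where "d = w - S * c1"
  have nd: "norm d \<le> s ^ 2 * (2 * K)"
  proof -
    have "d = (w - (S * c1 + S ^ 2 * c2)) + S ^ 2 * c2" by (simp add: d_def)
    also have "norm \<dots> \<le> s ^ 3 * K + s ^ 2 * K"
      using w c(2) s by (intro norm_triangle_mono) (auto simp: S_def norm_mult norm_power intro!: mult_left_mono)
    also have "\<dots> \<le> s ^ 2 * K + s ^ 2 * K" using s_le K by (intro add_mono mult_right_mono) auto
    finally show ?thesis by (simp add: algebra_simps)
  qed
  have nsc: "norm (S * c1) \<le> s * K" using c s by (simp add: norm_mult nS mult_left_mono)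
  have nw: "norm w \<le> s * (3 * K)"
  proof -
    have "w = d + S * c1" by (simp add: d_def)
    also have "norm \<dots> \<le> s ^ 2 * (2 * K) + s * K" by (intro norm_triangle_mono nd nsc)
    also have "\<dots> \<le> s * (2 * K) + s * K" using s_le K by (intro add_mono mult_right_mono) auto
    finally show ?thesis by (simp add: algebra_simps)
  qed
  have e1: "1 \<le> exp B" using B0 by simp
  have K3: "K \<le> K ^ 3" "K ^ 2 \<le> K ^ 3" using K by (auto intro!: self_le_power power_increasing)
  \<comment> \<open>The last summand is (w^2 - (s c1)^2) / 2, factored so that the order s^2 of d
    and the order s of w + s c1 multiply to s^3.\<close>
  have "exp w - (1 + S * c1 + S ^ 2 * (c2 + c1\<^sup>2 / 2)) = (exp w - 1 - w - w\<^sup>2 / 2) + (w - (S * c1 + S ^ 2 * c2)) + d * (w + S * c1) / 2"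
    by (simp add: d_def power2_eq_square algebra_simps add_divide_distrib diff_divide_distrib)
  also have "norm \<dots> \<le> norm (exp w - 1 - w - w\<^sup>2 / 2) + norm (w - (S * c1 + S ^ 2 * c2)) + norm (d * (w + S * c1) / 2)"
    by (intro norm_triangle_le add_mono order_refl norm_triangle_ineq)
  also have "\<dots> \<le> s ^ 3 * (27 * K ^ 3 * exp B) + s ^ 3 * K + s ^ 3 * (4 * K ^ 2)"
  proof (intro add_mono)
    have "norm (exp w - 1 - w - w\<^sup>2 / 2) \<le> norm w ^ 3 * exp (norm w)" by (rule norm_exp_second_order)
    also have "\<dots> \<le> (s * (3 * K)) ^ 3 * exp B" using nw B s K by (intro mult_mono power_mono) (auto intro!: mult_nonneg_nonneg)
    finally show "norm (exp w - 1 - w - w\<^sup>2 / 2) \<le> s ^ 3 * (27 * K ^ 3 * exp B)" by (simp add: power_mult_distrib)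
    show "norm (w - (S * c1 + S ^ 2 * c2)) \<le> s ^ 3 * K" using w by (simp add: S_def)
    have "norm (w + S * c1) \<le> s * (4 * K)"
      using norm_triangle_ineq[of w "S * c1"] nw nsc by (simp add: algebra_simps)
    then have "norm d * norm (w + S * c1) \<le> (s ^ 2 * (2 * K)) * (s * (4 * K))"
      using nd s K by (intro mult_mono) auto
    then show "norm (d * (w + S * c1) / 2) \<le> s ^ 3 * (4 * K ^ 2)"
      by (simp only: norm_mult norm_divide) (simp add: power2_eq_square power3_eq_cube mult_ac)
  qed
  also have "\<dots> = s ^ 3 * (27 * K ^ 3 * exp B + K + 4 * K ^ 2)" by (simp add: algebra_simps)
  also have "\<dots> \<le> s ^ 3 * (40 * K ^ 3 * exp B)"
  proof (intro mult_left_mono)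
    have "K ^ 3 \<le> K ^ 3 * exp B" using e1 K by (simp add: mult_le_cancel_left1)
    moreover have "0 \<le> K ^ 3 * exp B" using K by simp
    ultimately show "27 * K ^ 3 * exp B + K + 4 * K ^ 2 \<le> 40 * K ^ 3 * exp B" using K3 unfolding mult.assoc by linarith
  qed (use s in auto)
  finally have 1: "norm (exp w - (1 + S * c1 + S ^ 2 * (c2 + c1\<^sup>2 / 2))) \<le> s ^ 3 * (40 * K ^ 3 * exp B)" .
  have KB: "K ^ 3 \<le> K ^ 3 * exp B" "0 \<le> K ^ 3 * exp B" using e1 K by (simp_all add: mult_le_cancel_left1)
  have "norm (c1\<^sup>2) \<le> K ^ 2" using c by (simp add: norm_power power_mono)
  then have 2: "norm (c2 + c1\<^sup>2 / 2) \<le> 40 * K ^ 3 * exp B"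
    using norm_triangle_ineq[of c2 "c1\<^sup>2 / 2"] c K3 KB by (simp add: norm_divide mult.assoc)
  have 3: "norm c1 \<le> 40 * K ^ 3 * exp B" using c K3 KB K unfolding mult.assoc by linarith
  show ?thesis using 1 2 3 by (simp add: expansion_def S_def)
qed

text \<open>The factor exp (x^2 / 4) halves the Gaussian exponent: up to sqrt 2 what remains is the
  density with variance 2, which has all absolute moments.\<close>

lemma integrable_gaussian_poly:
  "integrable lborel (\<lambda>x. std_normal_density x * ((1 + \<bar>x\<bar>) ^ k * exp (x\<^sup>2 / 4)))"
proof (rule Bochner_Integration.integrable_bound)
  let ?f = "\<lambda>x. sqrt 2 * 2 ^ k * (normal_density 0 (sqrt 2) x + normal_density 0 (sqrt 2) x * \<bar>x - 0\<bar> ^ k)"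
  show "integrable lborel ?f"
    by (intro integrable_mult_right Bochner_Integration.integrable_add integrable_normal_moment_abs integrable_normal_density) simp_all
  show "AE x in lborel. norm (std_normal_density x * ((1 + \<bar>x\<bar>) ^ k * exp (x\<^sup>2 / 4))) \<le> norm (?f x)"
  proof (rule AE_I2)
    fix x :: real
    have d: "std_normal_density x * exp (x\<^sup>2 / 4) = sqrt 2 * normal_density 0 (sqrt 2) x"
    proof -
      have "std_normal_density x * exp (x\<^sup>2 / 4) = 1 / sqrt (2 * pi) * exp (- x\<^sup>2 / 2 + x\<^sup>2 / 4)"
        unfolding std_normal_density_def exp_add by (simp only: mult.assoc)
      also have "- x\<^sup>2 / 2 + x\<^sup>2 / 4 = - (x\<^sup>2 / 4)" by simp
      finally show ?thesis
        by (simp add: normal_density_def real_sqrt_mult field_simps)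
    qed
    have "(1 + \<bar>x\<bar>) ^ k \<le> (2 * max 1 \<bar>x\<bar>) ^ k" by (intro power_mono) auto
    also have "\<dots> \<le> 2 ^ k * (1 + \<bar>x\<bar> ^ k)" by (auto simp: power_mult_distrib max_def)
    finally have p: "(1 + \<bar>x\<bar>) ^ k \<le> 2 ^ k * (1 + \<bar>x\<bar> ^ k)" .
    have "std_normal_density x * ((1 + \<bar>x\<bar>) ^ k * exp (x\<^sup>2 / 4)) = (sqrt 2 * normal_density 0 (sqrt 2) x) * (1 + \<bar>x\<bar>) ^ k"
      unfolding d[symmetric] by (simp add: mult_ac)
    also have "\<dots> \<le> (sqrt 2 * normal_density 0 (sqrt 2) x) * (2 ^ k * (1 + \<bar>x\<bar> ^ k))"
      by (intro mult_left_mono p) (simp add: normal_density_nonneg)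
    also have "\<dots> = ?f x" by (simp add: algebra_simps)
    finally have "std_normal_density x * ((1 + \<bar>x\<bar>) ^ k * exp (x\<^sup>2 / 4)) \<le> ?f x" .
    moreover have "0 \<le> std_normal_density x * ((1 + \<bar>x\<bar>) ^ k * exp (x\<^sup>2 / 4))" by (simp add: normal_density_nonneg)
    ultimately show "norm (std_normal_density x * ((1 + \<bar>x\<bar>) ^ k * exp (x\<^sup>2 / 4))) \<le> norm (?f x)" by simp
  qed
qed simp

lemma integral_gaussian_cos:
  "integrable lborel (\<lambda>x. std_normal_density x * cos (b * x))" "(\<integral>x. std_normal_density x * cos (b * x) \<partial>lborel) = exp (- (b\<^sup>2 / 2))"
proof -
  have i: "integrable lborel (\<lambda>x. std_normal_density x *\<^sub>R iexp (b * x))"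
  proof (rule Bochner_Integration.integrable_bound)
    show "integrable lborel std_normal_density" by (rule integrable_normal_density) simp
  qed (auto simp: norm_mult normal_density_nonneg intro!: AE_I2)
  have re: "Re (std_normal_density x *\<^sub>R iexp (b * x)) = std_normal_density x * cos (b * x)" for x
    by (simp add: Re_exp)
  show "integrable lborel (\<lambda>x. std_normal_density x * cos (b * x))"
    using integrable_Re[OF i] unfolding re .
  have "(\<integral>x. std_normal_density x * cos (b * x) \<partial>lborel) = Re (\<integral>x. std_normal_density x *\<^sub>R iexp (b * x) \<partial>lborel)"
    using integral_Re[OF i] unfolding re by simp
  also have "(\<integral>x. std_normal_density x *\<^sub>R iexp (b * x) \<partial>lborel) = char std_normal_distribution b"
    unfolding char_def by (subst integral_density) (auto simp: normal_density_nonneg)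
  finally show "(\<integral>x. std_normal_density x * cos (b * x) \<partial>lborel) = exp (- (b\<^sup>2 / 2))"
    by (simp add: char_std_normal_distribution)
qed

lemma gaussian_even_moments:
  "integrable lborel (\<lambda>x. std_normal_density x * (1 + e * (x ^ 2 * c2 + x ^ 4 * c4 + x ^ 6 * c6)))"
  "(\<integral>x. std_normal_density x * (1 + e * (x ^ 2 * c2 + x ^ 4 * c4 + x ^ 6 * c6)) \<partial>lborel) = 1 + e * (c2 + 3 * c4 + 15 * c6)"
proof -
  have h: "has_bochner_integral lborel (\<lambda>x. std_normal_density x * x ^ (2 * k)) (fact (2 * k) / (2^k * fact k))" for k
    by (rule std_normal_moment_even)
  have "has_bochner_integral lborel (\<lambda>x. std_normal_density x * x ^ (2 * 0) + (e * c2) * (std_normal_density x * x ^ (2 * 1)) + (e * c4) * (std_normal_density x * x ^ (2 * 2)) + (e * c6) * (std_normal_density x * x ^ (2 * 3)))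
     (fact (2 * 0) / (2^0 * fact 0) + (e * c2) * (fact (2 * 1) / (2^1 * fact 1)) + (e * c4) * (fact (2 * 2) / (2^2 * fact 2)) + (e * c6) * (fact (2 * 3) / (2^3 * fact 3)))"
    by (intro has_bochner_integral_add has_bochner_integral_mult_right h)
  then have "has_bochner_integral lborel (\<lambda>x. std_normal_density x * (1 + e * (x ^ 2 * c2 + x ^ 4 * c4 + x ^ 6 * c6))) (1 + e * (c2 + 3 * c4 + 15 * c6))"
    by (simp add: algebra_simps fact_numeral power2_eq_square)
  then show "integrable lborel (\<lambda>x. std_normal_density x * (1 + e * (x ^ 2 * c2 + x ^ 4 * c4 + x ^ 6 * c6)))"
    "(\<integral>x. std_normal_density x * (1 + e * (x ^ 2 * c2 + x ^ 4 * c4 + x ^ 6 * c6)) \<partial>lborel) = 1 + e * (c2 + 3 * c4 + 15 * c6)"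
    by (auto simp: has_bochner_integral_iff)
qed

text \<open>Pure analysis, for one sample point. V stands for W(it) / W(0) and G for m(it) / a;
  \<mu>, \<sigma>2, \<kappa>3, \<kappa>4 are the first four cumulants, \<alpha> and \<beta> are
  W'(0) / W(0) and W''(0) / W(0). The last assumption keeps |exp (n \<psi>)| below the inverse
  square root of the Gaussian factor on the whole window.\<close>

locale edgeworth =
  fixes V G \<psi> :: "real \<Rightarrow> complex" and \<mu> \<sigma>2 \<kappa>3 \<kappa>4 \<alpha> \<beta> K \<eta> :: real
  assumes sigma: "\<sigma>2 > 0" and eta: "\<eta> > 0" and K: "K \<ge> 0"
    and cont_V: "continuous_on {-\<eta>..\<eta>} V" and cont_G: "continuous_on {-\<eta>..\<eta>} G"
    and V: "\<And>t. \<bar>t\<bar> \<le> \<eta> \<Longrightarrow> norm (V t - (1 + \<i> * of_real (\<alpha> * t) - of_real (\<beta> * t\<^sup>2 / 2))) \<le> K * \<bar>t\<bar> ^ 3"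
    and G: "\<And>t. \<bar>t\<bar> \<le> \<eta> \<Longrightarrow> G t = exp (\<i> * of_real (\<mu> * t) - of_real (\<sigma>2 * t\<^sup>2 / 2) + \<psi> t)"
    and psi: "\<And>t. \<bar>t\<bar> \<le> \<eta> \<Longrightarrow> norm (\<psi> t - (- \<i> * of_real (\<kappa>3 * t ^ 3 / 6) + of_real (\<kappa>4 * t ^ 4 / 24))) \<le> K * \<bar>t\<bar> ^ 5"
    and psi_small: "\<And>t. \<bar>t\<bar> \<le> \<eta> \<Longrightarrow> norm (\<psi> t) \<le> \<sigma>2 * t\<^sup>2 / 4"
begin

text \<open>
  With s = 1 / sqrt (sigma^2 n) and t = s x, the local integral becomes an expectation over a
  standard normal x; the integrand below is what remains besides the normal density.
\<close>

definition local_integral :: "nat \<Rightarrow> int \<Rightarrow> complex" where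
  "local_integral n k = (LBINT t:{-\<eta>..\<eta>}. exp (- (\<i> * of_real t * of_int k)) * V t * G t ^ n)"

definition integrand :: "real \<Rightarrow> nat \<Rightarrow> real \<Rightarrow> real \<Rightarrow> complex" where
  "integrand s n y x = (if \<bar>s * x\<bar> \<le> \<eta> then exp (\<i> * of_real (s * (- (y * x)))) * V (s * x) * exp (of_nat n * \<psi> (s * x)) else 0)"

lemma local_integral_rescale:
  assumes n: "n > 0" and s: "s = 1 / sqrt (\<sigma>2 * real n)" and y: "y = real_of_int k - \<mu> * real n"
  shows "integrable lborel (\<lambda>x. std_normal_density x * Re (integrand s n y x))"
    and "sqrt (2 * pi * real n) * sqrt \<sigma>2 * (Re (local_integral n k) / (2 * pi)) = (\<integral>x. std_normal_density x * Re (integrand s n y x) \<partial>lborel)"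
proof -
  have s0: "s > 0" and s2: "real n * \<sigma>2 * s\<^sup>2 = 1" using n sigma by (auto simp: s power_divide)
  define f where "f t = indicator {-\<eta>..\<eta>} t *\<^sub>R (exp (- (\<i> * of_real t * of_int k)) * V t * G t ^ n)" for t
  have i: "integrable lborel f"
  proof -
    have "set_integrable lborel {-\<eta>..\<eta>} (\<lambda>t. exp (- (\<i> * of_real t * of_int k)) * V t * G t ^ n)"
      by (intro borel_integrable_atLeastAtMost' continuous_intros cont_V cont_G)
    then show ?thesis by (simp add: set_integrable_def f_def[abs_def])
  qed
  have fi: "f (0 + s * x) = of_real (sqrt (2 * pi)) * (of_real (std_normal_density x) * integrand s n y x)" for x
  proof (cases "\<bar>s * x\<bar> \<le> \<eta>")
    case True
    have "exp (- (\<i> * of_real (s * x) * of_int k)) * G (s * x) ^ n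
        = exp (- (\<i> * of_real (s * x) * of_int k) + of_nat n * (\<i> * of_real (\<mu> * (s * x)) - of_real (\<sigma>2 * (s * x)\<^sup>2 / 2) + \<psi> (s * x)))"
      unfolding G[OF True] by (simp only: exp_of_nat_mult exp_add)
    \<comment> \<open>The drift \<mu> n is subtracted from k, which leaves y, and n \<sigma>2 s^2 =
      1 turns the quadratic term into the exponent of the standard normal density.\<close>
    also have "- (\<i> * of_real (s * x) * of_int k) + of_nat n * (\<i> * of_real (\<mu> * (s * x)) - of_real (\<sigma>2 * (s * x)\<^sup>2 / 2) + \<psi> (s * x))
       = \<i> * of_real (s * (- (y * x))) + of_nat n * \<psi> (s * x) + of_real (- (real n * \<sigma>2 * s\<^sup>2) * x\<^sup>2 / 2)"
      unfolding y by (simp add: algebra_simps power2_eq_square)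
    also have "exp \<dots> = exp (\<i> * of_real (s * (- (y * x)))) * exp (of_nat n * \<psi> (s * x)) * of_real (exp (- x\<^sup>2 / 2))"
      unfolding s2 by (simp only: exp_add exp_of_real[symmetric]) simp
    also have "exp (- x\<^sup>2 / 2) = sqrt (2 * pi) * std_normal_density x"
      by (simp add: std_normal_density_def)
    finally show ?thesis using True
      by (simp add: f_def integrand_def indicator_def abs_le_iff mult_ac)
  next
    case False
    then show ?thesis by (auto simp: f_def integrand_def indicator_def abs_le_iff)
  qed
  have i2: "integrable lborel (\<lambda>x. of_real (std_normal_density x) * integrand s n y x)"
  proof -
    have "integrable lborel (\<lambda>x. complex_of_real (1 / sqrt (2 * pi)) * f (0 + s * x))"
      using lborel_integrable_real_affine[OF i, of s 0] s0 by (intro integrable_mult_right) simp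
    moreover have "complex_of_real (1 / sqrt (2 * pi)) * (of_real (sqrt (2 * pi)) * z) = z" for z
      by (simp add: field_simps)
    ultimately show ?thesis unfolding fi by simp
  qed
  have re: "Re (of_real (std_normal_density x) * integrand s n y x) = std_normal_density x * Re (integrand s n y x)" for x
    by simp
  show "integrable lborel (\<lambda>x. std_normal_density x * Re (integrand s n y x))"
    using integrable_Re[OF i2] unfolding re .
  have "local_integral n k = of_real (s * sqrt (2 * pi)) * (\<integral>x. of_real (std_normal_density x) * integrand s n y x \<partial>lborel)"
    using lborel_integral_real_affine[of s f 0] s0 unfolding fi
    by (simp add: local_integral_def set_lebesgue_integral_def f_def scaleR_conv_of_real)
  then have "Re (local_integral n k) = s * sqrt (2 * pi) * (\<integral>x. std_normal_density x * Re (integrand s n y x) \<partial>lborel)"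
    using integral_Re[OF i2] unfolding re by simp
  moreover have "sqrt (2 * pi * real n) * sqrt \<sigma>2 * (s * sqrt (2 * pi) * I / (2 * pi)) = I" for I
  proof -
    have "sqrt (2 * pi * real n) * sqrt \<sigma>2 * s = sqrt (2 * pi)"
      using n sigma by (simp add: s real_sqrt_mult)
    then have "sqrt (2 * pi * real n) * sqrt \<sigma>2 * (s * sqrt (2 * pi) * I / (2 * pi)) = sqrt (2 * pi) * sqrt (2 * pi) * I / (2 * pi)"
      by (simp only: times_divide_eq_right mult.assoc[symmetric])
    then show ?thesis by simp
  qed
  ultimately show "sqrt (2 * pi * real n) * sqrt \<sigma>2 * (Re (local_integral n k) / (2 * pi)) = (\<integral>x. std_normal_density x * Re (integrand s n y x) \<partial>lborel)"
    by simp
qed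

text \<open>
  The factor V(s x) exp (n psi(s x)) expands as 1 + i s g1(x) + s^2 g2(x) + O(s^3), with errors
  dominated by a multiple of some \<open>H k\<close>, which is integrable against the normal density.
\<close>

definition g1 :: "real \<Rightarrow> real" where
  "g1 x = \<alpha> * x - \<kappa>3 * x ^ 3 / (6 * \<sigma>2)"

definition g2 :: "real \<Rightarrow> real" where
  "g2 x = - (\<beta> * x\<^sup>2 / 2) + (\<kappa>4 * x ^ 4 / (24 * \<sigma>2) - \<kappa>3\<^sup>2 * x ^ 6 / (72 * \<sigma>2\<^sup>2)) + \<alpha> * \<kappa>3 * x ^ 4 / (6 * \<sigma>2)"

definition KV :: real where "KV = 1 + \<bar>\<alpha>\<bar> + \<bar>\<beta>\<bar> + K"
definition KG :: real where "KG = 1 + (\<bar>\<kappa>3\<bar> + \<bar>\<kappa>4\<bar> + K) / \<sigma>2"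

definition H :: "nat \<Rightarrow> real \<Rightarrow> real" where "H k x = (1 + \<bar>x\<bar>) ^ k * exp (x\<^sup>2 / 4)"

lemma H_ge_1: "1 \<le> H k x"
proof -
  have "1 \<le> (1 + \<bar>x\<bar>) ^ k" "1 \<le> exp (x\<^sup>2 / 4)" by (auto intro: one_le_power)
  then show ?thesis unfolding H_def using mult_mono[of 1 "(1 + \<bar>x\<bar>) ^ k" 1 "exp (x\<^sup>2 / 4)"] by simp
qed

lemma H_mult: "(1 + \<bar>x\<bar>) ^ j * H k x = H (j + k) x"
  by (simp add: H_def power_add)

lemma H_mono: "j \<le> k \<Longrightarrow> H j x \<le> H k x"
  unfolding H_def by (intro mult_right_mono power_increasing) auto

lemma abs_power_le: "j \<le> k \<Longrightarrow> \<bar>x\<bar> ^ j \<le> (1 + \<bar>x\<bar>) ^ k" for x :: real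
  using power_mono[of "\<bar>x\<bar>" "1 + \<bar>x\<bar>" j] power_increasing[of j k "1 + \<bar>x\<bar>"] by simp

lemma KV_ge: "1 \<le> KV" "\<bar>\<alpha>\<bar> \<le> KV" "\<bar>\<beta>\<bar> / 2 \<le> KV" "K \<le> KV"
  using K by (auto simp: KV_def)

lemma KG_ge: "1 \<le> KG" "\<bar>\<kappa>3\<bar> / (6 * \<sigma>2) \<le> KG" "\<bar>\<kappa>4\<bar> / (24 * \<sigma>2) \<le> KG" "K / \<sigma>2 \<le> KG"
proof -
  have nn: "0 \<le> \<bar>\<kappa>3\<bar> / \<sigma>2" "0 \<le> \<bar>\<kappa>4\<bar> / \<sigma>2" "0 \<le> K / \<sigma>2" using K sigma by auto
  have aux: "1 \<le> 1 + (u + v + w)" "u / 6 \<le> 1 + (u + v + w)" "v / 24 \<le> 1 + (u + v + w)" "w \<le> 1 + (u + v + w)"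
    if "0 \<le> u" "0 \<le> v" "0 \<le> w" for u v w :: real
    using that by linarith+
  have e: "\<bar>\<kappa>3\<bar> / (6 * \<sigma>2) = \<bar>\<kappa>3\<bar> / \<sigma>2 / 6" "\<bar>\<kappa>4\<bar> / (24 * \<sigma>2) = \<bar>\<kappa>4\<bar> / \<sigma>2 / 24" by auto
  show "1 \<le> KG" "\<bar>\<kappa>3\<bar> / (6 * \<sigma>2) \<le> KG" "\<bar>\<kappa>4\<bar> / (24 * \<sigma>2) \<le> KG" "K / \<sigma>2 \<le> KG"
    unfolding KG_def add_divide_distrib e by (rule aux[OF nn])+
qed

text \<open>The exponents 3 and 5 are those of the remainders of V and \<psi>; majorising the lower
  powers of |x| by them gives each factor a single constant.\<close>

lemma coefficient_bounds:
  shows "norm (\<i> * of_real (\<alpha> * x)) \<le> KV * (1 + \<bar>x\<bar>) ^ 3"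
    and "norm (complex_of_real (- (\<beta> * x\<^sup>2 / 2))) \<le> KV * (1 + \<bar>x\<bar>) ^ 3"
    and "norm (- \<i> * of_real (\<kappa>3 * x ^ 3 / (6 * \<sigma>2))) \<le> KG * (1 + \<bar>x\<bar>) ^ 5"
    and "norm (complex_of_real (\<kappa>4 * x ^ 4 / (24 * \<sigma>2))) \<le> KG * (1 + \<bar>x\<bar>) ^ 5"
proof -
  have "\<bar>\<alpha>\<bar> * \<bar>x\<bar> ^ 1 \<le> KV * (1 + \<bar>x\<bar>) ^ 3"
    by (rule mult_mono[OF KV_ge(2) abs_power_le]) (use KV_ge in auto)
  then show "norm (\<i> * of_real (\<alpha> * x)) \<le> KV * (1 + \<bar>x\<bar>) ^ 3" by (simp add: norm_mult abs_mult)
  have "\<bar>\<beta>\<bar> / 2 * \<bar>x\<bar> ^ 2 \<le> KV * (1 + \<bar>x\<bar>) ^ 3"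
    by (rule mult_mono[OF KV_ge(3) abs_power_le]) (use KV_ge in auto)
  then show "norm (complex_of_real (- (\<beta> * x\<^sup>2 / 2))) \<le> KV * (1 + \<bar>x\<bar>) ^ 3"
    unfolding norm_of_real by (simp add: abs_mult)
  have "\<bar>\<kappa>3\<bar> / (6 * \<sigma>2) * \<bar>x\<bar> ^ 3 \<le> KG * (1 + \<bar>x\<bar>) ^ 5"
    by (rule mult_mono[OF KG_ge(2) abs_power_le]) (use KG_ge in auto)
  then show "norm (- \<i> * of_real (\<kappa>3 * x ^ 3 / (6 * \<sigma>2))) \<le> KG * (1 + \<bar>x\<bar>) ^ 5"
    unfolding norm_mult norm_of_real using sigma by (simp add: abs_mult power_abs)
  have "\<bar>\<kappa>4\<bar> / (24 * \<sigma>2) * \<bar>x\<bar> ^ 4 \<le> KG * (1 + \<bar>x\<bar>) ^ 5"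
    by (rule mult_mono[OF KG_ge(3) abs_power_le]) (use KG_ge in auto)
  then show "norm (complex_of_real (\<kappa>4 * x ^ 4 / (24 * \<sigma>2))) \<le> KG * (1 + \<bar>x\<bar>) ^ 5"
    unfolding norm_of_real using sigma by (simp add: abs_mult power_abs)
qed

definition KD :: real where "KD = 400 * KV * KG ^ 3"

lemma KD_ge_1: "1 \<le> KD"
proof -
  have "1 * 1 \<le> KV * KG ^ 3" using KV_ge KG_ge by (intro mult_mono one_le_power) auto
  then show ?thesis unfolding KD_def by simp
qed

text \<open>The factors are abstract v and exp w, so that s = 0 may be inserted later. The constant
  400 in \<open>KD\<close> is 10 from the product times 40 from the exponential; the exponent 18 is
  3 + 3 * 5, because the exponential cubes its coefficient bound.\<close>

lemma expansion_VG_aux: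
  assumes "0 \<le> s" "s \<le> 1"
    and v: "norm (v - (1 + of_real s * (\<i> * of_real (\<alpha> * x)) + of_real s ^ 2 * of_real (- (\<beta> * x\<^sup>2 / 2)))) \<le> s ^ 3 * (KV * (1 + \<bar>x\<bar>) ^ 3)"
    and w: "norm (w - (of_real s * (- \<i> * of_real (\<kappa>3 * x ^ 3 / (6 * \<sigma>2))) + of_real s ^ 2 * of_real (\<kappa>4 * x ^ 4 / (24 * \<sigma>2)))) \<le> s ^ 3 * (KG * (1 + \<bar>x\<bar>) ^ 5)"
    and w_small: "norm w \<le> x\<^sup>2 / 4"
  shows "expansion s (KD * H 18 x) (v * exp w) (\<i> * of_real (g1 x)) (of_real (g2 x))"
proof -
  have X: "1 \<le> (1 + \<bar>x\<bar>) ^ j" for j by (rule one_le_power) simp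
  have K1: "1 \<le> KV * (1 + \<bar>x\<bar>) ^ 3" "1 \<le> KG * (1 + \<bar>x\<bar>) ^ 5"
    using mult_mono[OF KV_ge(1) X[of 3]] mult_mono[OF KG_ge(1) X[of 5]] KV_ge KG_ge by auto
  have "expansion s (KV * (1 + \<bar>x\<bar>) ^ 3) v (\<i> * of_real (\<alpha> * x)) (of_real (- (\<beta> * x\<^sup>2 / 2)))"
    unfolding expansion_def using coefficient_bounds v by blast
  moreover have "expansion s (40 * (KG * (1 + \<bar>x\<bar>) ^ 5) ^ 3 * exp (x\<^sup>2 / 4)) (exp w) (- \<i> * of_real (\<kappa>3 * x ^ 3 / (6 * \<sigma>2)))
     (of_real (\<kappa>4 * x ^ 4 / (24 * \<sigma>2)) + (- \<i> * of_real (\<kappa>3 * x ^ 3 / (6 * \<sigma>2)))\<^sup>2 / 2)"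
    using assms K1 coefficient_bounds by (intro expansion_exp) auto
  ultimately have "expansion s (10 * (KV * (1 + \<bar>x\<bar>) ^ 3) * (40 * (KG * (1 + \<bar>x\<bar>) ^ 5) ^ 3 * exp (x\<^sup>2 / 4))) (v * exp w)
     (\<i> * of_real (\<alpha> * x) + - \<i> * of_real (\<kappa>3 * x ^ 3 / (6 * \<sigma>2)))
     (of_real (- (\<beta> * x\<^sup>2 / 2)) + (of_real (\<kappa>4 * x ^ 4 / (24 * \<sigma>2)) + (- \<i> * of_real (\<kappa>3 * x ^ 3 / (6 * \<sigma>2)))\<^sup>2 / 2) + \<i> * of_real (\<alpha> * x) * (- \<i> * of_real (\<kappa>3 * x ^ 3 / (6 * \<sigma>2))))"
  proof (rule expansion_mult[OF _ _ assms(1,2) K1(1)])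
    have "1 \<le> (KG * (1 + \<bar>x\<bar>) ^ 5) ^ 3" using K1(2) by (rule one_le_power)
    then have "1 \<le> 40 * (KG * (1 + \<bar>x\<bar>) ^ 5) ^ 3" by linarith
    then have "1 * 1 \<le> (40 * (KG * (1 + \<bar>x\<bar>) ^ 5) ^ 3) * exp (x\<^sup>2 / 4)" by (rule mult_mono) (use K1(2) in auto)
    then show "1 \<le> 40 * (KG * (1 + \<bar>x\<bar>) ^ 5) ^ 3 * exp (x\<^sup>2 / 4)" by simp
  qed
  also have "10 * (KV * (1 + \<bar>x\<bar>) ^ 3) * (40 * (KG * (1 + \<bar>x\<bar>) ^ 5) ^ 3 * exp (x\<^sup>2 / 4)) = KD * H 18 x"
  proof -
    have "(1 + \<bar>x\<bar>) ^ 18 = (1 + \<bar>x\<bar>) ^ 3 * ((1 + \<bar>x\<bar>) ^ 5) ^ 3" by (simp flip: power_mult power_add)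
    then show ?thesis by (simp add: KD_def H_def power_mult_distrib)
  qed
  also have "\<i> * of_real (\<alpha> * x) + - \<i> * of_real (\<kappa>3 * x ^ 3 / (6 * \<sigma>2)) = \<i> * of_real (g1 x)"
    by (simp add: g1_def algebra_simps)
  also have "of_real (- (\<beta> * x\<^sup>2 / 2)) + (of_real (\<kappa>4 * x ^ 4 / (24 * \<sigma>2)) + (- \<i> * of_real (\<kappa>3 * x ^ 3 / (6 * \<sigma>2)))\<^sup>2 / 2) + \<i> * of_real (\<alpha> * x) * (- \<i> * of_real (\<kappa>3 * x ^ 3 / (6 * \<sigma>2))) = complex_of_real (g2 x)"
  proof -
    have "(- \<i> * complex_of_real (\<kappa>3 * x ^ 3 / (6 * \<sigma>2)))\<^sup>2 / 2 = of_real (- (\<kappa>3\<^sup>2 * x ^ 6 / (72 * \<sigma>2\<^sup>2)))"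
      by (simp add: power_mult_distrib power_divide flip: power_mult)
    moreover have "\<i> * of_real (\<alpha> * x) * (- \<i> * of_real (\<kappa>3 * x ^ 3 / (6 * \<sigma>2))) = complex_of_real (\<alpha> * \<kappa>3 * x ^ 4 / (6 * \<sigma>2))"
    proof -
      have "\<i> * (\<i> * z) = - z" for z :: complex by (simp flip: mult.assoc)
      then show ?thesis by (simp add: power4_eq_xxxx power3_eq_cube mult_ac)
    qed
    ultimately show ?thesis unfolding g2_def by simp
  qed
  finally show ?thesis .
qed

text \<open>At s = 0 with v = 1 and w = 0 the remainder conditions become trivial, and the expansion
  reduces to its coefficient bounds.\<close>

lemma g_bounds: "\<bar>g1 x\<bar> \<le> KD * H 18 x" "\<bar>g2 x\<bar> \<le> KD * H 18 x"
proof -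
  have "expansion 0 (KD * H 18 x) (1 * exp 0) (\<i> * of_real (g1 x)) (of_real (g2 x))"
    by (rule expansion_VG_aux) auto
  then show "\<bar>g1 x\<bar> \<le> KD * H 18 x" "\<bar>g2 x\<bar> \<le> KD * H 18 x"
    by (simp_all add: expansion_def norm_mult)
qed

text \<open>Since n s^2 = 1 / \<sigma>2, the cubic term of n \<psi>(s x) is of order s, the quartic
  one of order s^2, and the remainder n K |s x|^5 of order s^3. The smallness of \<psi> becomes the
  bound x^2/4.\<close>

lemma expansion_VG:
  assumes s: "0 < s" "s \<le> 1" and ns: "real n * \<sigma>2 * s\<^sup>2 = 1" and x: "\<bar>s * x\<bar> \<le> \<eta>"
  shows "expansion s (KD * H 18 x) (V (s * x) * exp (of_nat n * \<psi> (s * x))) (\<i> * of_real (g1 x)) (of_real (g2 x))"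
proof (rule expansion_VG_aux)
  have n2: "real n * s\<^sup>2 = 1 / \<sigma>2" using ns sigma by (simp add: field_simps)
  have "norm (V (s * x) - (1 + of_real s * (\<i> * of_real (\<alpha> * x)) + of_real s ^ 2 * of_real (- (\<beta> * x\<^sup>2 / 2))))
     = norm (V (s * x) - (1 + \<i> * of_real (\<alpha> * (s * x)) - of_real (\<beta> * (s * x)\<^sup>2 / 2)))"
    by (rule arg_cong[where f=norm]) (simp add: power_mult_distrib algebra_simps)
  also have "\<dots> \<le> K * \<bar>s * x\<bar> ^ 3" by (rule V[OF x])
  also have "\<dots> = s ^ 3 * (K * \<bar>x\<bar> ^ 3)" using s by (simp add: abs_mult power_mult_distrib)
  also have "\<dots> \<le> s ^ 3 * (KV * (1 + \<bar>x\<bar>) ^ 3)"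
    using s K KV_ge by (intro mult_left_mono mult_mono abs_power_le) auto
  finally show "norm (V (s * x) - (1 + of_real s * (\<i> * of_real (\<alpha> * x)) + of_real s ^ 2 * of_real (- (\<beta> * x\<^sup>2 / 2)))) \<le> s ^ 3 * (KV * (1 + \<bar>x\<bar>) ^ 3)" .
  have e: "of_real s * (- \<i> * of_real (\<kappa>3 * x ^ 3 / (6 * \<sigma>2))) + of_real s ^ 2 * of_real (\<kappa>4 * x ^ 4 / (24 * \<sigma>2))
     = complex_of_real (real n) * (- \<i> * of_real (\<kappa>3 * (s * x) ^ 3 / 6) + of_real (\<kappa>4 * (s * x) ^ 4 / 24))"
  proof -
    have "s * (\<kappa>3 * x ^ 3 / (6 * \<sigma>2)) = real n * s\<^sup>2 * s * \<kappa>3 * x ^ 3 / 6" unfolding n2 by simp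
    then have 1: "s * (\<kappa>3 * x ^ 3 / (6 * \<sigma>2)) = real n * (\<kappa>3 * (s * x) ^ 3 / 6)"
      by (simp add: power_mult_distrib power3_eq_cube power2_eq_square mult_ac)
    have "s ^ 2 * (\<kappa>4 * x ^ 4 / (24 * \<sigma>2)) = real n * s\<^sup>2 * s\<^sup>2 * \<kappa>4 * x ^ 4 / 24" unfolding n2 by simp
    then have 2: "s ^ 2 * (\<kappa>4 * x ^ 4 / (24 * \<sigma>2)) = real n * (\<kappa>4 * (s * x) ^ 4 / 24)"
      by (simp add: power_mult_distrib power4_eq_xxxx power2_eq_square mult_ac)
    have "of_real s * (- \<i> * of_real (\<kappa>3 * x ^ 3 / (6 * \<sigma>2))) + of_real s ^ 2 * of_real (\<kappa>4 * x ^ 4 / (24 * \<sigma>2))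
      = - \<i> * complex_of_real (s * (\<kappa>3 * x ^ 3 / (6 * \<sigma>2))) + complex_of_real (s ^ 2 * (\<kappa>4 * x ^ 4 / (24 * \<sigma>2)))"
      by simp
    also have "\<dots> = complex_of_real (real n) * (- \<i> * of_real (\<kappa>3 * (s * x) ^ 3 / 6) + of_real (\<kappa>4 * (s * x) ^ 4 / 24))"
      unfolding 1 2 by (simp add: algebra_simps)
    finally show ?thesis .
  qed
  have "norm (of_nat n * \<psi> (s * x) - (of_real s * (- \<i> * of_real (\<kappa>3 * x ^ 3 / (6 * \<sigma>2))) + of_real s ^ 2 * of_real (\<kappa>4 * x ^ 4 / (24 * \<sigma>2))))
     = norm (of_nat n * (\<psi> (s * x) - (- \<i> * of_real (\<kappa>3 * (s * x) ^ 3 / 6) + of_real (\<kappa>4 * (s * x) ^ 4 / 24))))"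
    unfolding e by (simp only: right_diff_distrib of_real_of_nat_eq)
  also have "\<dots> \<le> real n * (K * \<bar>s * x\<bar> ^ 5)"
    unfolding norm_mult using psi[OF x] by (intro mult_mono) auto
  also have "\<dots> = (real n * s\<^sup>2) * s ^ 3 * K * \<bar>x\<bar> ^ 5"
    using s by (simp add: abs_mult power_mult_distrib mult_ac flip: power_add)
  also have "\<dots> = s ^ 3 * ((K / \<sigma>2) * \<bar>x\<bar> ^ 5)" unfolding n2 by simp
  also have "\<dots> \<le> s ^ 3 * (KG * (1 + \<bar>x\<bar>) ^ 5)"
    using s K KG_ge by (intro mult_left_mono mult_mono abs_power_le) auto
  finally show "norm (of_nat n * \<psi> (s * x) - (of_real s * (- \<i> * of_real (\<kappa>3 * x ^ 3 / (6 * \<sigma>2))) + of_real s ^ 2 * of_real (\<kappa>4 * x ^ 4 / (24 * \<sigma>2)))) \<le> s ^ 3 * (KG * (1 + \<bar>x\<bar>) ^ 5)" .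
  have "norm (of_nat n * \<psi> (s * x)) \<le> real n * (\<sigma>2 * (s * x)\<^sup>2 / 4)"
    unfolding norm_mult using psi_small[OF x] by (intro mult_mono) auto
  also have "\<dots> = (real n * \<sigma>2 * s\<^sup>2) * x\<^sup>2 / 4" by (simp add: power_mult_distrib)
  finally show "norm (of_nat n * \<psi> (s * x)) \<le> x\<^sup>2 / 4" unfolding ns by simp
qed (use s in auto)

lemma integrable_H: "integrable lborel (\<lambda>x. std_normal_density x * H k x)"
  unfolding H_def by (rule integrable_gaussian_poly)

lemma integral_diff_le:
  assumes "integrable lborel (\<lambda>x. std_normal_density x * f x)" "integrable lborel (\<lambda>x. std_normal_density x * g x)"
    and "\<And>x. \<bar>f x - g x\<bar> \<le> c * H k x"
  shows "\<bar>(\<integral>x. std_normal_density x * f x \<partial>lborel) - (\<integral>x. std_normal_density x * g x \<partial>lborel)\<bar> \<le> c * (\<integral>x. std_normal_density x * H k x \<partial>lborel)"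
proof -
  have "(\<integral>x. std_normal_density x * f x \<partial>lborel) - (\<integral>x. std_normal_density x * g x \<partial>lborel) = (\<integral>x. std_normal_density x * f x - std_normal_density x * g x \<partial>lborel)"
    using assms by simp
  also have "\<bar>\<dots>\<bar> \<le> (\<integral>x. \<bar>std_normal_density x * f x - std_normal_density x * g x\<bar> \<partial>lborel)"
    by (rule integral_abs_bound)
  also have "\<dots> \<le> (\<integral>x. c * (std_normal_density x * H k x) \<partial>lborel)"
  proof (rule integral_mono)
    fix x
    have "\<bar>std_normal_density x * f x - std_normal_density x * g x\<bar> = std_normal_density x * \<bar>f x - g x\<bar>"
      by (simp add: abs_mult normal_density_nonneg flip: right_diff_distrib)
    also have "\<dots> \<le> std_normal_density x * (c * H k x)"
      by (intro mult_left_mono assms(3)) (simp add: normal_density_nonneg)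
    finally show "\<bar>std_normal_density x * f x - std_normal_density x * g x\<bar> \<le> c * (std_normal_density x * H k x)" by (simp add: mult_ac)
  qed (intro integrable_abs Bochner_Integration.integrable_diff integrable_mult_right integrable_H assms)+
  finally show ?thesis by simp
qed

text \<open>
  The first-order term of the integrand is purely imaginary, so its real part is
  1 + s^2 p(x) + O(s^3), where y = k - mu n.
\<close>

definition p :: "real \<Rightarrow> real \<Rightarrow> real" where
  "p y x = x ^ 2 * (- (y\<^sup>2 / 2) - \<beta> / 2 + y * \<alpha>) + x ^ 4 * (\<kappa>4 / (24 * \<sigma>2) - y * \<kappa>3 / (6 * \<sigma>2) + \<alpha> * \<kappa>3 / (6 * \<sigma>2)) + x ^ 6 * (- (\<kappa>3\<^sup>2 / (72 * \<sigma>2\<^sup>2)))"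

lemma p_eq: "p y x = - ((y * x)\<^sup>2 / 2) + g2 x + y * x * g1 x"
proof -
  have "x * x ^ 3 = x ^ 4" by (simp flip: power_Suc)
  then have "y * x * g1 x = y * \<alpha> * x\<^sup>2 - y * \<kappa>3 / (6 * \<sigma>2) * x ^ 4"
    by (simp add: g1_def right_diff_distrib power2_eq_square mult_ac)
  then show ?thesis
    by (simp add: p_def g2_def power_mult_distrib ring_distribs mult_ac)
qed

text \<open>For bounded y the phase may be expanded as well; it contributes a cubic factor, hence 21
  = 3 + 18. Taking real parts removes the first-order term, which is imaginary. The remaining 3 in
  24 pays for the region outside the window.\<close>

lemma integrand_expansion:
  assumes A: "A \<ge> 1" "\<bar>y\<bar> \<le> A" and s: "0 < s" "s \<le> 1" and ns: "real n * \<sigma>2 * s\<^sup>2 = 1"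
  shows "\<bar>Re (integrand s n y x) - (1 + s\<^sup>2 * p y x)\<bar> \<le> (s ^ 3 * (10 * A ^ 3 * KD * (1 + 2 / \<eta> ^ 3))) * H 24 x"
proof -
  define B where "B = 10 * A ^ 3 * KD * H 21 x"
  have "1 * 1 * 1 \<le> A ^ 3 * KD * H 21 x"
    using A KD_ge_1 H_ge_1 by (intro mult_mono one_le_power) auto
  then have B1: "1 \<le> B" by (simp add: B_def)
  have b: "\<bar>- (y * x)\<bar> \<le> A * (1 + \<bar>x\<bar>)" "1 \<le> A * (1 + \<bar>x\<bar>)"
    using A mult_mono[of 1 A 1 "1 + \<bar>x\<bar>"] by (auto simp: abs_mult intro!: mult_mono)
  have BB: "10 * (A * (1 + \<bar>x\<bar>)) ^ 3 * (KD * H 18 x) = B"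
    by (simp add: B_def H_def power_mult_distrib flip: power_add)
  have exps: "expansion s' B (exp (\<i> * of_real (s' * (- (y * x)))) * u) (\<i> * of_real (- (y * x)) + \<i> * of_real (g1 x))
     (- of_real ((- (y * x))\<^sup>2 / 2) + of_real (g2 x) + \<i> * of_real (- (y * x)) * (\<i> * of_real (g1 x)))"
    if "0 \<le> s'" "s' \<le> 1" "expansion s' (KD * H 18 x) u (\<i> * of_real (g1 x)) (of_real (g2 x))" for s' u
    unfolding BB[symmetric]
  proof (rule expansion_mult[OF expansion_iexp[OF that(1) b] that(3,1,2)])
    show "1 \<le> (A * (1 + \<bar>x\<bar>)) ^ 3" using b(2) by (rule one_le_power)
    show "1 \<le> KD * H 18 x" using mult_mono[OF KD_ge_1 H_ge_1[of 18 x]] KD_ge_1 by simp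
  qed
  have x2: "- of_real ((- (y * x))\<^sup>2 / 2) + of_real (g2 x) + \<i> * of_real (- (y * x)) * (\<i> * of_real (g1 x)) = complex_of_real (p y x)"
    unfolding p_eq by (simp add: algebra_simps)
  have pB: "\<bar>p y x\<bar> \<le> B"
  proof -
    \<comment> \<open>The case s = 0 again extracts the coefficient bounds, here for the product
      with the phase.\<close>
    have "expansion 0 (KD * H 18 x) 1 (\<i> * of_real (g1 x)) (of_real (g2 x))"
      using g_bounds[of x] by (simp add: expansion_def norm_mult)
    from exps[OF _ _ this] show ?thesis unfolding x2 by (simp add: expansion_def)
  qed
  have BH: "B \<le> 10 * A ^ 3 * KD * H 24 x"
    unfolding B_def using A KD_ge_1 by (intro mult_left_mono H_mono) auto
  have c: "0 \<le> 10 * A ^ 3 * KD * H 24 x" using BH B1 by linarith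
  show ?thesis
  proof (cases "\<bar>s * x\<bar> \<le> \<eta>")
    case True
    from exps[OF _ s(2) expansion_VG[OF s ns True]] s(1)
    have nd: "norm (integrand s n y x - (1 + of_real s * (\<i> * of_real (- (y * x)) + \<i> * of_real (g1 x)) + of_real s ^ 2 * of_real (p y x))) \<le> s ^ 3 * B"
      unfolding x2 using True by (simp add: expansion_def integrand_def mult.assoc)
    have re: "Re (integrand s n y x - (1 + of_real s * (\<i> * of_real (- (y * x)) + \<i> * of_real (g1 x)) + of_real s ^ 2 * of_real (p y x)))
      = Re (integrand s n y x) - (1 + s\<^sup>2 * p y x)"
      by (simp flip: of_real_power)
    have "\<bar>Re (integrand s n y x) - (1 + s\<^sup>2 * p y x)\<bar> \<le> s ^ 3 * B"
      using order_trans[OF abs_Re_le_cmod nd] unfolding re .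
    also have "\<dots> \<le> s ^ 3 * ((10 * A ^ 3 * KD * H 24 x) * (1 + 2 / \<eta> ^ 3))"
      using BH c s eta by (intro mult_left_mono order_trans[OF BH]) (auto simp: mult_le_cancel_left1)
    finally show ?thesis by (simp add: mult_ac)
  next
    case False
    then have sx: "\<eta> < s * \<bar>x\<bar>" using s by (simp add: abs_mult)
    \<comment> \<open>Outside the window the integrand is 0 but its expansion is not; since s |x|
      exceeds \<eta> there, a factor (s |x| / \<eta>)^3 can be inserted and supplies the missing
      s^3.\<close>
    have "1 \<le> (s * \<bar>x\<bar> / \<eta>) ^ 3" using sx eta by (intro one_le_power) simp
    also have "\<dots> \<le> s ^ 3 * (1 + \<bar>x\<bar>) ^ 3 / \<eta> ^ 3"
      using s eta by (simp add: power_divide power_mult_distrib divide_right_mono mult_left_mono power_mono)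
    finally have one: "1 \<le> s ^ 3 * (1 + \<bar>x\<bar>) ^ 3 / \<eta> ^ 3" .
    have s2: "s\<^sup>2 \<le> 1" using s by (simp add: power_le_one)
    have "\<bar>Re (integrand s n y x) - (1 + s\<^sup>2 * p y x)\<bar> = \<bar>1 + s\<^sup>2 * p y x\<bar>"
      using False by (simp add: integrand_def)
    also have "\<dots> \<le> 1 + s\<^sup>2 * \<bar>p y x\<bar>" by (simp add: abs_mult abs_triangle_ineq[THEN order_trans])
    also have "\<dots> \<le> 1 + 1 * B" using s2 pB by (intro add_left_mono mult_mono) auto
    also have "\<dots> \<le> 2 * B * 1" using B1 by simp
    also have "\<dots> \<le> 2 * B * (s ^ 3 * (1 + \<bar>x\<bar>) ^ 3 / \<eta> ^ 3)" using B1 by (intro mult_left_mono one) auto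
    also have "\<dots> = s ^ 3 * ((10 * A ^ 3 * KD * H 24 x) * (2 / \<eta> ^ 3))"
      using H_mult[of x 3 21] by (simp add: B_def mult_ac)
    also have "\<dots> \<le> s ^ 3 * ((10 * A ^ 3 * KD * H 24 x) * (1 + 2 / \<eta> ^ 3))"
      using s eta c by (intro mult_left_mono) auto
    finally show ?thesis by (simp add: mult_ac)
  qed
qed

text \<open>Valid for every y, so the phase is left unexpanded. The main term is the cosine and the
  first-order term is s g1(x) sin (y s x). Bounding the sine by min 1 (|y| s) (1 + |x|) keeps this
  correction below the quadratic drop for moderate y; with the bound 1 alone it would be of order s
  and useless there.\<close>

lemma integrand_upper:
  assumes s: "0 < s" "s \<le> 1" and ns: "real n * \<sigma>2 * s\<^sup>2 = 1"
  shows "Re (integrand s n y x) \<le> cos (y * s * x) + ((s * min 1 (\<bar>y\<bar> * s) + s\<^sup>2) * (KD * (2 + 1 / \<eta>\<^sup>2))) * H 20 x"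
proof -
  define m where "m = min 1 (\<bar>y\<bar> * s)"
  have m0: "0 \<le> m" using s by (simp add: m_def)
  have HH: "(1 + \<bar>x\<bar>) * H 18 x \<le> H 20 x" "H 18 x \<le> H 20 x" "(1 + \<bar>x\<bar>)\<^sup>2 \<le> KD * H 20 x"
  proof -
    have "(1 + \<bar>x\<bar>) * H 18 x = H 19 x" using H_mult[of x 1 18] by simp
    then show "(1 + \<bar>x\<bar>) * H 18 x \<le> H 20 x" by (simp add: H_mono)
    show "H 18 x \<le> H 20 x" by (simp add: H_mono)
    have "(1 + \<bar>x\<bar>)\<^sup>2 * 1 \<le> (1 + \<bar>x\<bar>)\<^sup>2 * H 18 x" by (intro mult_left_mono H_ge_1) simp
    also have "\<dots> = 1 * H 20 x" using H_mult[of x 2 18] by simp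
    also have "\<dots> \<le> KD * H 20 x" using KD_ge_1 H_ge_1[of 20 x] by (intro mult_right_mono) auto
    finally show "(1 + \<bar>x\<bar>)\<^sup>2 \<le> KD * H 20 x" by simp
  qed
  define D where "D = KD * H 20 x"
  have D1: "1 \<le> D" using mult_mono[OF KD_ge_1 H_ge_1[of 20 x]] KD_ge_1 by (simp add: D_def)
  have tot: "s * m * D + 2 * s\<^sup>2 * D \<le> (s * m + s\<^sup>2) * (D * (2 + 1 / \<eta>\<^sup>2))" (is "?l \<le> ?r")
    and tot2: "s\<^sup>2 * D / \<eta>\<^sup>2 \<le> (s * m + s\<^sup>2) * (D * (2 + 1 / \<eta>\<^sup>2))"
  proof -
    have e: "?r = (s * m * D) * 2 + (s * m * D) / \<eta>\<^sup>2 + 2 * s\<^sup>2 * D + s\<^sup>2 * D / \<eta>\<^sup>2" by (simp add: algebra_simps)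
    have nn: "0 \<le> s * m * D" "0 \<le> s * m * D / \<eta>\<^sup>2" "0 \<le> s\<^sup>2 * D / \<eta>\<^sup>2" "0 \<le> s\<^sup>2 * D" using s m0 D1 by auto
    show "?l \<le> ?r" "s\<^sup>2 * D / \<eta>\<^sup>2 \<le> ?r" unfolding e using nn by linarith+
  qed
  have "Re (integrand s n y x) \<le> cos (y * s * x) + (s * m + s\<^sup>2) * (D * (2 + 1 / \<eta>\<^sup>2))"
  proof (cases "\<bar>s * x\<bar> \<le> \<eta>")
    case True
    define u where "u = V (s * x) * exp (of_nat n * \<psi> (s * x))"
    define \<theta> where "\<theta> = y * s * x"
    have "norm (u - (1 + of_real s * (\<i> * of_real (g1 x)) + of_real s ^ 2 * of_real (g2 x))) \<le> s ^ 3 * (KD * H 18 x)"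
      using expansion_VG[OF s ns True] by (simp add: expansion_def u_def)
    also have "\<dots> \<le> s\<^sup>2 * D"
      using s HH KD_ge_1 H_ge_1[of 18 x] unfolding D_def by (intro mult_mono power_decreasing) auto
    finally have u1: "norm (u - (1 + of_real s * (\<i> * of_real (g1 x)) + of_real s ^ 2 * of_real (g2 x))) \<le> s\<^sup>2 * D" .
    have gD: "\<bar>g1 x\<bar> \<le> D" "\<bar>g2 x\<bar> \<le> D"
    proof -
      have "KD * H 18 x \<le> D" unfolding D_def using HH(2) KD_ge_1 by (intro mult_left_mono) auto
      then show "\<bar>g1 x\<bar> \<le> D" "\<bar>g2 x\<bar> \<le> D" using g_bounds[of x] by linarith+
    qed
    have u2: "norm (u - (1 + of_real s * (\<i> * of_real (g1 x)))) \<le> 2 * s\<^sup>2 * D"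
    proof -
      have "norm (u - (1 + of_real s * (\<i> * of_real (g1 x)))) \<le> norm (u - (1 + of_real s * (\<i> * of_real (g1 x)) + of_real s ^ 2 * of_real (g2 x))) + norm (complex_of_real (s\<^sup>2 * g2 x))"
      proof -
        have "u - (1 + of_real s * (\<i> * of_real (g1 x))) = (u - (1 + of_real s * (\<i> * of_real (g1 x)) + of_real s ^ 2 * of_real (g2 x))) + complex_of_real (s\<^sup>2 * g2 x)"
          by simp
        then show ?thesis by (simp only: norm_triangle_ineq)
      qed
      also have "norm (complex_of_real (s\<^sup>2 * g2 x)) \<le> s\<^sup>2 * D"
        unfolding norm_of_real abs_mult using gD by (simp add: mult_left_mono)
      finally show ?thesis using u1 by simp
    qed
    have int: "integrand s n y x = exp (\<i> * of_real (- \<theta>)) * u"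
      using True by (simp add: integrand_def u_def \<theta>_def mult_ac)
    have "Re (integrand s n y x) = Re (exp (\<i> * of_real (- \<theta>)) * (1 + of_real s * (\<i> * of_real (g1 x)))) + Re (exp (\<i> * of_real (- \<theta>)) * (u - (1 + of_real s * (\<i> * of_real (g1 x)))))"
      unfolding int by (simp add: algebra_simps)
    also have "Re (exp (\<i> * of_real (- \<theta>)) * (u - (1 + of_real s * (\<i> * of_real (g1 x))))) \<le> 2 * s\<^sup>2 * D"
      using complex_Re_le_cmod[of "exp (\<i> * of_real (- \<theta>)) * (u - (1 + of_real s * (\<i> * of_real (g1 x))))"] u2 by (simp add: norm_mult)
    also have "Re (exp (\<i> * of_real (- \<theta>)) * (1 + of_real s * (\<i> * of_real (g1 x)))) = cos \<theta> + s * g1 x * sin \<theta>"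
      by (simp add: Re_exp Im_exp algebra_simps)
    also have "s * g1 x * sin \<theta> \<le> s * m * D"
    proof -
      have "\<bar>sin \<theta>\<bar> \<le> m * (1 + \<bar>x\<bar>)"
      proof (cases "\<bar>y\<bar> * s \<le> 1")
        case True
        have "\<bar>sin \<theta>\<bar> \<le> \<bar>\<theta>\<bar>" by (rule abs_sin_x_le_abs_x)
        also have "\<dots> = (\<bar>y\<bar> * s) * \<bar>x\<bar>" using s by (simp add: \<theta>_def abs_mult)
        also have "\<dots> \<le> m * (1 + \<bar>x\<bar>)" using True s by (intro mult_mono) (auto simp: m_def)
        finally show ?thesis .
      next
        case False
        then have "m = 1" by (simp add: m_def)
        then show ?thesis using order_trans[OF abs_sin_le_one[of \<theta>], of "1 + \<bar>x\<bar>"] by simp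
      qed
      moreover have "\<bar>g1 x\<bar> \<le> KD * H 18 x" using g_bounds[of x] by simp
      ultimately have "\<bar>g1 x\<bar> * \<bar>sin \<theta>\<bar> \<le> (KD * H 18 x) * (m * (1 + \<bar>x\<bar>))"
        using m0 KD_ge_1 H_ge_1[of 18 x] by (intro mult_mono) auto
      also have "\<dots> = m * (KD * ((1 + \<bar>x\<bar>) * H 18 x))" by (simp add: mult_ac)
      also have "\<dots> \<le> m * D" unfolding D_def using m0 KD_ge_1 HH(1) by (intro mult_left_mono) auto
      finally have "s * (\<bar>g1 x\<bar> * \<bar>sin \<theta>\<bar>) \<le> s * (m * D)" using s by (intro mult_left_mono) auto
      moreover have "s * g1 x * sin \<theta> \<le> s * (\<bar>g1 x\<bar> * \<bar>sin \<theta>\<bar>)"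
        using s abs_ge_self[of "g1 x * sin \<theta>"] by (simp add: abs_mult mult.assoc mult_left_mono)
      ultimately show ?thesis by (simp add: mult.assoc)
    qed
    finally show ?thesis using tot by (simp add: \<theta>_def)
  next
    case False
    then have sx: "\<eta> < s * \<bar>x\<bar>" using s by (simp add: abs_mult)
    have "1 \<le> (s * \<bar>x\<bar> / \<eta>)\<^sup>2" using sx eta by (intro one_le_power) simp
    also have "\<dots> \<le> s\<^sup>2 * (1 + \<bar>x\<bar>)\<^sup>2 / \<eta>\<^sup>2"
      using s eta by (simp only: power_divide power_mult_distrib) (intro divide_right_mono mult_left_mono power_mono, auto)
    also have "\<dots> \<le> s\<^sup>2 * D / \<eta>\<^sup>2"
      using HH(3) unfolding D_def by (intro divide_right_mono mult_left_mono) auto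
    \<comment> \<open>Here the integrand vanishes, so the error term has only to offset a cosine
      that may be as low as -1.\<close>
    finally have "1 \<le> (s * m + s\<^sup>2) * (D * (2 + 1 / \<eta>\<^sup>2))" using tot2 by linarith
    moreover have "Re (integrand s n y x) = 0" using False by (simp add: integrand_def)
    ultimately show ?thesis using cos_ge_minus_one[of "y * s * x"] by linarith
  qed
  then show ?thesis by (simp add: m_def D_def mult_ac)
qed

definition IH :: "nat \<Rightarrow> real" where "IH k = (\<integral>x. std_normal_density x * H k x \<partial>lborel)"

text \<open>Offset of the vertex of the quadratic in y below: \<open>\<mu> * real n + shift\<close>
  is the predicted position of the mode.\<close>

definition shift :: real where "shift = \<alpha> - \<kappa>3 / (2 * \<sigma>2)"

definition normalized :: "nat \<Rightarrow> int \<Rightarrow> real" where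
  "normalized n k = sqrt (2 * pi * real n) * sqrt \<sigma>2 * (Re (local_integral n k) / (2 * pi))"

text \<open>Inserting the normal moments 1, 3 and 15 into p gives a quadratic in y with leading
  coefficient - 1/2; completing the square places its vertex at \<open>shift\<close> and leaves
  \<beta> - \<alpha>^2, the second logarithmic derivative of W at 0.\<close>

lemma local_expansion:
  assumes n: "real n * \<sigma>2 \<ge> 1" and A: "A \<ge> 1" "\<bar>real_of_int k - \<mu> * real n\<bar> \<le> A"
  shows "\<bar>normalized n k - (1 - 1 / (2 * \<sigma>2 * real n) * (\<kappa>3\<^sup>2 / (6 * \<sigma>2\<^sup>2) - \<kappa>4 / (4 * \<sigma>2) + (real_of_int k - (\<mu> * real n + shift))\<^sup>2 + (\<beta> - \<alpha>\<^sup>2)))\<bar>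
     \<le> (1 / sqrt (\<sigma>2 * real n)) ^ 3 * (10 * A ^ 3 * KD * (1 + 2 / \<eta> ^ 3) * IH 24)"
proof -
  define s where "s = 1 / sqrt (\<sigma>2 * real n)"
  define y where "y = real_of_int k - \<mu> * real n"
  have n0: "n > 0" using n by (cases n) auto
  have s: "0 < s" "s \<le> 1" and ns: "real n * \<sigma>2 * s\<^sup>2 = 1"
    using n n0 sigma by (auto simp: s_def power_divide mult.commute)
  have moments: "(\<integral>x. std_normal_density x * (1 + s\<^sup>2 * p y x) \<partial>lborel) = 1 + s\<^sup>2 * ((- (y\<^sup>2 / 2) - \<beta> / 2 + y * \<alpha>) + 3 * (\<kappa>4 / (24 * \<sigma>2) - y * \<kappa>3 / (6 * \<sigma>2) + \<alpha> * \<kappa>3 / (6 * \<sigma>2)) + 15 * (- (\<kappa>3\<^sup>2 / (72 * \<sigma>2\<^sup>2))))"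
    unfolding p_def by (rule gaussian_even_moments(2))
  have "\<bar>normalized n k - (1 + s\<^sup>2 * ((- (y\<^sup>2 / 2) - \<beta> / 2 + y * \<alpha>) + 3 * (\<kappa>4 / (24 * \<sigma>2) - y * \<kappa>3 / (6 * \<sigma>2) + \<alpha> * \<kappa>3 / (6 * \<sigma>2)) + 15 * (- (\<kappa>3\<^sup>2 / (72 * \<sigma>2\<^sup>2)))))\<bar>
     \<le> (s ^ 3 * (10 * A ^ 3 * KD * (1 + 2 / \<eta> ^ 3))) * (\<integral>x. std_normal_density x * H 24 x \<partial>lborel)"
    unfolding normalized_def local_integral_rescale(2)[OF n0 s_def y_def] moments[symmetric]
  proof (rule integral_diff_le[OF local_integral_rescale(1)[OF n0 s_def y_def]])
    show "integrable lborel (\<lambda>x. std_normal_density x * (1 + s\<^sup>2 * p y x))"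
      unfolding p_def by (rule gaussian_even_moments(1))
    show "\<bar>Re (integrand s n y x) - (1 + s\<^sup>2 * p y x)\<bar> \<le> s ^ 3 * (10 * A ^ 3 * KD * (1 + 2 / \<eta> ^ 3)) * H 24 x" for x
      using A by (intro integrand_expansion s ns) (auto simp: y_def)
  qed
  also have "s\<^sup>2 * ((- (y\<^sup>2 / 2) - \<beta> / 2 + y * \<alpha>) + 3 * (\<kappa>4 / (24 * \<sigma>2) - y * \<kappa>3 / (6 * \<sigma>2) + \<alpha> * \<kappa>3 / (6 * \<sigma>2)) + 15 * (- (\<kappa>3\<^sup>2 / (72 * \<sigma>2\<^sup>2))))
     = - (1 / (2 * \<sigma>2 * real n) * (\<kappa>3\<^sup>2 / (6 * \<sigma>2\<^sup>2) - \<kappa>4 / (4 * \<sigma>2) + (y - shift)\<^sup>2 + (\<beta> - \<alpha>\<^sup>2)))"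
  proof -
    have s2: "s\<^sup>2 = 1 / (\<sigma>2 * real n)" using n n0 sigma by (simp add: s_def power_divide)
    define z where "z = \<kappa>3 / \<sigma>2"
    have z: "y * \<kappa>3 / (6 * \<sigma>2) = y * z / 6" "\<alpha> * \<kappa>3 / (6 * \<sigma>2) = \<alpha> * z / 6" "\<kappa>3\<^sup>2 / (72 * \<sigma>2\<^sup>2) = z\<^sup>2 / 72"
      "\<kappa>3\<^sup>2 / (6 * \<sigma>2\<^sup>2) = z\<^sup>2 / 6" "\<kappa>3 / (2 * \<sigma>2) = z / 2"
      by (simp_all add: z_def power_divide)
    have w: "\<kappa>4 / (24 * \<sigma>2) = \<kappa>4 / \<sigma>2 / 24" "\<kappa>4 / (4 * \<sigma>2) = \<kappa>4 / \<sigma>2 / 4" by simp_all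
    have "(- (y\<^sup>2 / 2) - \<beta> / 2 + y * \<alpha>) + 3 * (\<kappa>4 / \<sigma>2 / 24 - y * z / 6 + \<alpha> * z / 6) + 15 * (- (z\<^sup>2 / 72))
       = - (z\<^sup>2 / 6 - \<kappa>4 / \<sigma>2 / 4 + (y - (\<alpha> - z / 2))\<^sup>2 + (\<beta> - \<alpha>\<^sup>2)) / 2"
      by (simp add: power2_eq_square field_simps)
    note eq = this
    have "1 / (\<sigma>2 * real n) * (- Q / 2) = - (1 / (2 * \<sigma>2 * real n) * Q)" for Q by simp
    then show ?thesis unfolding s2 shift_def z w eq .
  qed
  finally show ?thesis by (simp add: s_def y_def IH_def algebra_simps)
qed

text \<open>The Gaussian mean of the cosine is exactly exp (- (y s)^2 / 2), so the bound remains
  informative for sites far beyond the scale 1/s.\<close>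

lemma local_upper:
  assumes n: "real n * \<sigma>2 \<ge> 1" and s: "s = 1 / sqrt (\<sigma>2 * real n)" and y: "y = real_of_int k - \<mu> * real n"
  shows "normalized n k \<le> exp (- ((y * s)\<^sup>2 / 2)) + (s * min 1 (\<bar>y\<bar> * s) + s\<^sup>2) * (KD * (2 + 1 / \<eta>\<^sup>2) * IH 20)"
proof -
  have n0: "n > 0" using n by (cases n) auto
  have s': "0 < s" "s \<le> 1" and ns: "real n * \<sigma>2 * s\<^sup>2 = 1"
    using n n0 sigma by (auto simp: s power_divide mult.commute)
  let ?c = "(s * min 1 (\<bar>y\<bar> * s) + s\<^sup>2) * (KD * (2 + 1 / \<eta>\<^sup>2))"
  have "normalized n k \<le> (\<integral>x. std_normal_density x * cos (y * s * x) + ?c * (std_normal_density x * H 20 x) \<partial>lborel)"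
    unfolding normalized_def local_integral_rescale(2)[OF n0 s y]
  proof (rule integral_mono[OF local_integral_rescale(1)[OF n0 s y]])
    show "integrable lborel (\<lambda>x. std_normal_density x * cos (y * s * x) + ?c * (std_normal_density x * H 20 x))"
      by (intro Bochner_Integration.integrable_add integral_gaussian_cos(1) integrable_mult_right integrable_H)
    fix x
    have "std_normal_density x * Re (integrand s n y x) \<le> std_normal_density x * (cos (y * s * x) + ?c * H 20 x)"
      by (intro mult_left_mono integrand_upper[OF s' ns]) (simp add: normal_density_nonneg)
    then show "std_normal_density x * Re (integrand s n y x) \<le> std_normal_density x * cos (y * s * x) + ?c * (std_normal_density x * H 20 x)"
      by (simp only: distrib_left) (simp only: mult_ac)
  qed
  also have "\<dots> = exp (- ((y * s)\<^sup>2 / 2)) + ?c * IH 20"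
    unfolding IH_def
    by (subst Bochner_Integration.integral_add) (simp_all only: integral_gaussian_cos integrable_H integral_mult_right_zero integrable_mult_right)
  finally show ?thesis by (simp only: mult.assoc)
qed

end

section \<open>Mode and height of a profile with an Edgeworth expansion\<close>

lemma dist_Z_eq: "dist_Z x = \<bar>x - of_int (round x)\<bar>"
  unfolding dist_Z_def by (rule cInf_eq_minimum) (auto simp: round_diff_minimal)

lemma exp_minus_le: "exp (- x) \<le> 1 - x / 2" if "0 \<le> x" "x \<le> 1" for x :: real
proof -
  have "1 + x \<le> exp x" by simp
  then have "exp (- x) \<le> 1 / (1 + x)" using that by (simp add: exp_minus field_simps)
  also have "\<dots> \<le> 1 - x / 2"
    using that mult_left_mono[of x 1 x] by (simp add: field_simps)
  finally show ?thesis .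
qed

context edgeworth
begin

definition sc :: "nat \<Rightarrow> real" where "sc n = 1 / sqrt (\<sigma>2 * real n)"

lemma sc_limit: "sc \<longlonglongrightarrow> 0"
  unfolding sc_def[abs_def] using sigma by real_asymp

lemma eventually_n: "\<forall>\<^sub>F n in sequentially. real n * \<sigma>2 \<ge> 1"
  using sigma by real_asymp

text \<open>Here q is to be the profile divided by W(0) a^n, and C, \<theta> describe the error made
  by passing to the local integral, uniformly in the site.\<close>

context
  fixes q :: "nat \<Rightarrow> int \<Rightarrow> real" and C \<theta> :: real and u :: "nat \<Rightarrow> int"
  assumes theta: "0 < \<theta>" "\<theta> < 1" and C: "C \<ge> 0"
    and approx: "\<And>n k. \<bar>q n k - Re (local_integral n k) / (2 * pi)\<bar> \<le> C * \<theta> ^ n"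
    and u_max: "\<And>n k. q n k \<le> q n (u n)"
begin

definition Q :: "nat \<Rightarrow> int \<Rightarrow> real" where "Q n k = sqrt (2 * pi * real n) * sqrt \<sigma>2 * q n k"

definition ustar :: "nat \<Rightarrow> real" where "ustar n = \<mu> * real n + shift"

definition cst :: real where "cst = \<kappa>3\<^sup>2 / (6 * \<sigma>2\<^sup>2) - \<kappa>4 / (4 * \<sigma>2) + (\<beta> - \<alpha>\<^sup>2)"

lemma Q_mono: "q n k \<le> q n k' \<Longrightarrow> Q n k \<le> Q n k'"
  unfolding Q_def using sigma by (intro mult_left_mono) auto

text \<open>A geometric error beats the factor n^2 that comes from the normalisation and from sc n ^
  (-3), so it disappears in the Edgeworth error simultaneously for all sites.\<close>

lemma Q_normalized: "\<forall>\<^sub>F n in sequentially. \<forall>k. \<bar>Q n k - normalized n k\<bar> \<le> sc n ^ 3"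
proof -
  have "(\<lambda>n. sqrt (2 * pi * real n) * sqrt \<sigma>2 * (C * \<theta> ^ n) * (sqrt (\<sigma>2 * real n)) ^ 3) \<longlonglongrightarrow> 0"
  proof -
    have "(\<lambda>n. real n ^ 2 * \<theta> ^ n) \<longlonglongrightarrow> 0" using theta by real_asymp
    then have "(\<lambda>n. sqrt (2 * pi) * \<sigma>2\<^sup>2 * C * (real n ^ 2 * \<theta> ^ n)) \<longlonglongrightarrow> 0"
      by (rule tendsto_mult_right_zero)
    also have "(\<lambda>n. sqrt (2 * pi) * \<sigma>2\<^sup>2 * C * (real n ^ 2 * \<theta> ^ n)) = (\<lambda>n. sqrt (2 * pi * real n) * sqrt \<sigma>2 * (C * \<theta> ^ n) * (sqrt (\<sigma>2 * real n)) ^ 3)"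
    proof
      fix n
      have "sqrt (2 * pi * real n) * sqrt \<sigma>2 = sqrt (2 * pi) * sqrt (\<sigma>2 * real n)" by (simp add: real_sqrt_mult)
      moreover have "r * r ^ 3 = (r\<^sup>2)\<^sup>2" for r :: real by (simp add: eval_nat_numeral)
      then have "sqrt (\<sigma>2 * real n) * sqrt (\<sigma>2 * real n) ^ 3 = (\<sigma>2 * real n) ^ 2"
        using sigma by (simp only: real_sqrt_pow2 less_imp_le zero_le_mult_iff of_nat_0_le_iff simp_thms)
      ultimately show "sqrt (2 * pi) * \<sigma>2\<^sup>2 * C * (real n ^ 2 * \<theta> ^ n) = sqrt (2 * pi * real n) * sqrt \<sigma>2 * (C * \<theta> ^ n) * (sqrt (\<sigma>2 * real n)) ^ 3"
        by (simp add: power_mult_distrib mult_ac)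
    qed
    finally show ?thesis .
  qed
  then have "\<forall>\<^sub>F n in sequentially. sqrt (2 * pi * real n) * sqrt \<sigma>2 * (C * \<theta> ^ n) * (sqrt (\<sigma>2 * real n)) ^ 3 < 1"
    by (rule order_tendstoD) simp
  then show ?thesis using eventually_n
  proof eventually_elim
    case (elim n)
    have p: "sqrt (\<sigma>2 * real n) ^ 3 > 0" using elim(2) by (simp add: mult.commute)
    have e: "sqrt (2 * pi * real n) * sqrt \<sigma>2 * (C * \<theta> ^ n) \<le> sc n ^ 3"
      using elim(1) p by (simp add: sc_def power_divide pos_le_divide_eq)
    show ?case
    proof
      fix k
      have "\<bar>Q n k - normalized n k\<bar> = sqrt (2 * pi * real n) * sqrt \<sigma>2 * \<bar>q n k - Re (local_integral n k) / (2 * pi)\<bar>"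
        unfolding Q_def normalized_def right_diff_distrib[symmetric] using sigma by (simp add: abs_mult)
      also have "\<dots> \<le> sqrt (2 * pi * real n) * sqrt \<sigma>2 * (C * \<theta> ^ n)"
        using sigma by (intro mult_left_mono approx) auto
      finally show "\<bar>Q n k - normalized n k\<bar> \<le> sc n ^ 3" using e by linarith
    qed
  qed
qed

lemma sc_sq: "n > 0 \<Longrightarrow> 1 / (2 * \<sigma>2 * real n) = (sc n)\<^sup>2 / 2"
  using sigma by (simp add: sc_def power_divide)

lemma Q_expansion:
  assumes A: "A \<ge> 1"
  shows "\<exists>D\<ge>0. \<forall>\<^sub>F n in sequentially. \<forall>k. \<bar>real_of_int k - \<mu> * real n\<bar> \<le> A \<longrightarrow>
     \<bar>Q n k - (1 - (sc n)\<^sup>2 / 2 * (cst + (real_of_int k - ustar n)\<^sup>2))\<bar> \<le> D * sc n ^ 3"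
proof -
  \<comment> \<open>The added 1 covers the difference between \<open>Q\<close> and
    \<open>normalized\<close>.\<close>
  define D where "D = \<bar>10 * A ^ 3 * KD * (1 + 2 / \<eta> ^ 3) * IH 24\<bar> + 1"
  have "\<forall>\<^sub>F n in sequentially. \<forall>k. \<bar>real_of_int k - \<mu> * real n\<bar> \<le> A \<longrightarrow>
     \<bar>Q n k - (1 - (sc n)\<^sup>2 / 2 * (cst + (real_of_int k - ustar n)\<^sup>2))\<bar> \<le> D * sc n ^ 3"
    using Q_normalized eventually_n
  proof eventually_elim
    case (elim n)
    have n0: "n > 0" using elim(2) by (cases n) auto
    have s3: "0 \<le> sc n ^ 3" by (simp add: sc_def sigma less_imp_le)
    show ?case
    proof (intro allI impI)
      fix k assume k: "\<bar>real_of_int k - \<mu> * real n\<bar> \<le> A"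
      have "\<bar>normalized n k - (1 - (sc n)\<^sup>2 / 2 * (cst + (real_of_int k - ustar n)\<^sup>2))\<bar> \<le> sc n ^ 3 * (10 * A ^ 3 * KD * (1 + 2 / \<eta> ^ 3) * IH 24)"
        using local_expansion[OF elim(2) A k] unfolding sc_sq[OF n0] sc_def[symmetric] ustar_def cst_def
        by (simp add: algebra_simps)
      also have "\<dots> \<le> sc n ^ 3 * \<bar>10 * A ^ 3 * KD * (1 + 2 / \<eta> ^ 3) * IH 24\<bar>"
        using s3 by (intro mult_left_mono) auto
      finally show "\<bar>Q n k - (1 - (sc n)\<^sup>2 / 2 * (cst + (real_of_int k - ustar n)\<^sup>2))\<bar> \<le> D * sc n ^ 3"
        using elim(1)[rule_format, of k] unfolding D_def distrib_right by (simp add: mult.commute)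
    qed
  qed
  then show ?thesis by (intro exI[of _ D]) (simp add: D_def)
qed

text \<open>The benchmark for the mode: a maximiser must do at least as well as the integer nearest
  to \<open>ustar n\<close>.\<close>

lemma Q_round_lower:
  "\<exists>B\<ge>0. \<forall>\<^sub>F n in sequentially. Q n (round (ustar n)) \<ge> 1 - B * (sc n)\<^sup>2"
proof -
  define A where "A = 1 + \<bar>shift\<bar>"
  obtain D where D: "D \<ge> 0" "\<forall>\<^sub>F n in sequentially. \<forall>k. \<bar>real_of_int k - \<mu> * real n\<bar> \<le> A \<longrightarrow>
     \<bar>Q n k - (1 - (sc n)\<^sup>2 / 2 * (cst + (real_of_int k - ustar n)\<^sup>2))\<bar> \<le> D * sc n ^ 3"
    using Q_expansion[of A] by (auto simp: A_def)
  have "\<forall>\<^sub>F n in sequentially. Q n (round (ustar n)) \<ge> 1 - (\<bar>cst\<bar> + 1 + D) * (sc n)\<^sup>2"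
    using D(2) order_tendstoD(2)[OF sc_limit zero_less_one]
  proof eventually_elim
    case (elim n)
    let ?k = "round (ustar n)"
    have s: "0 \<le> sc n" by (simp add: sc_def sigma less_imp_le)
    have r: "\<bar>of_int ?k - ustar n\<bar> \<le> 1 / 2" by (rule of_int_round_abs_le)
    then have "\<bar>real_of_int ?k - \<mu> * real n\<bar> \<le> A" unfolding ustar_def A_def by linarith
    with elim(1) have "\<bar>Q n ?k - (1 - (sc n)\<^sup>2 / 2 * (cst + (real_of_int ?k - ustar n)\<^sup>2))\<bar> \<le> D * sc n ^ 3" by blast
    then have "Q n ?k \<ge> 1 - (sc n)\<^sup>2 / 2 * (cst + (real_of_int ?k - ustar n)\<^sup>2) - D * sc n ^ 3" by linarith
    moreover have "(sc n)\<^sup>2 / 2 * (cst + (real_of_int ?k - ustar n)\<^sup>2) \<le> (sc n)\<^sup>2 * (\<bar>cst\<bar> + 1)"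
    proof -
      have "(real_of_int ?k - ustar n)\<^sup>2 \<le> (1/2)\<^sup>2" using r by (intro power2_le_iff_abs_le[THEN iffD2]) auto
      then have "cst + (real_of_int ?k - ustar n)\<^sup>2 \<le> 2 * (\<bar>cst\<bar> + 1)" by (simp add: power_divide)
      then have "(sc n)\<^sup>2 / 2 * (cst + (real_of_int ?k - ustar n)\<^sup>2) \<le> (sc n)\<^sup>2 / 2 * (2 * (\<bar>cst\<bar> + 1))" by (intro mult_left_mono) auto
      also have "\<dots> = (sc n)\<^sup>2 * (\<bar>cst\<bar> + 1)" by simp
      finally show ?thesis .
    qed
    moreover have "D * sc n ^ 3 \<le> D * (sc n)\<^sup>2" using D(1) s elim(2) by (intro mult_left_mono power_decreasing) auto
    ultimately show ?case by (simp add: algebra_simps)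
  qed
  then show ?thesis using D(1) by (intro exI[of _ "\<bar>cst\<bar> + 1 + D"]) auto
qed

text \<open>Comparison of the benchmark 1 - B s^2 with the uniform upper bound at the mode. If |y| s
  <= 1, the Gaussian loses (y s)^2 / 4 while the corrections are at most s^2 (|y| D + D + 1), so the
  quadratic wins for |y| > A. If |y| s > 1, the upper bound is near 3/4 and the benchmark near
  1.\<close>

lemma mode_bounded: "\<exists>A\<ge>1. \<forall>\<^sub>F n in sequentially. \<bar>real_of_int (u n) - \<mu> * real n\<bar> \<le> A"
proof -
  obtain B where B: "B \<ge> 0" "\<forall>\<^sub>F n in sequentially. Q n (round (ustar n)) \<ge> 1 - B * (sc n)\<^sup>2"
    using Q_round_lower by blast
  define D where "D = \<bar>KD * (2 + 1 / \<eta>\<^sup>2) * IH 20\<bar>"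
  have D0: "D \<ge> 0" by (simp add: D_def)
  \<comment> \<open>For |y| > A this gives |y|/4 - D >= D + B + 2, and since |y| >= 1 the quantity
    |y| (|y|/4 - D) - D - 1 exceeds B.\<close>
  define A where "A = 4 * D + 4 * (D + B + 2)"
  have A1: "A \<ge> 1" using B D0 by (simp add: A_def)
  have "(\<lambda>n. D * (sc n + (sc n)\<^sup>2) + sc n ^ 3 + B * (sc n)\<^sup>2) \<longlonglongrightarrow> D * (0 + 0\<^sup>2) + 0 ^ 3 + B * 0\<^sup>2"
    by (intro tendsto_intros sc_limit)
  then have small: "\<forall>\<^sub>F n in sequentially. D * (sc n + (sc n)\<^sup>2) + sc n ^ 3 + B * (sc n)\<^sup>2 < 1 / 4"
    by (intro order_tendstoD(2)) auto
  have "\<forall>\<^sub>F n in sequentially. \<bar>real_of_int (u n) - \<mu> * real n\<bar> \<le> A"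
    using B(2) small Q_normalized eventually_n order_tendstoD(2)[OF sc_limit zero_less_one]
  proof eventually_elim
    case (elim n)
    define s where "s = sc n"
    define y where "y = real_of_int (u n) - \<mu> * real n"
    have n0: "n > 0" using elim(4) by (cases n) auto
    have s: "0 < s" "s < 1" using n0 sigma elim(5) by (auto simp: s_def sc_def)
    have ge: "Q n (u n) \<ge> 1 - B * s\<^sup>2" using elim(1) Q_mono[OF u_max[of n "round (ustar n)"]] by (simp add: s_def)
    have "normalized n (u n) \<le> exp (- ((y * s)\<^sup>2 / 2)) + (s * min 1 (\<bar>y\<bar> * s) + s\<^sup>2) * (KD * (2 + 1 / \<eta>\<^sup>2) * IH 20)"
      by (rule local_upper[OF elim(4)]) (auto simp: s_def sc_def y_def)
    also have "\<dots> \<le> exp (- ((y * s)\<^sup>2 / 2)) + (s * min 1 (\<bar>y\<bar> * s) + s\<^sup>2) * D"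
      unfolding D_def using s by (intro add_left_mono mult_left_mono) auto
    finally have le: "Q n (u n) \<le> exp (- ((y * s)\<^sup>2 / 2)) + (s * min 1 (\<bar>y\<bar> * s) + s\<^sup>2) * D + s ^ 3"
      using elim(3)[rule_format, of "u n"] unfolding s_def by linarith
    show ?case
    proof (rule ccontr)
      assume "\<not> ?case"
      then have yA: "\<bar>y\<bar> > A" by (simp add: y_def)
      show False
      proof (cases "\<bar>y\<bar> * s \<le> 1")
        case True
        have "(y * s)\<^sup>2 \<le> 1" using True s by (simp add: abs_square_le_1 abs_mult)
        then have "exp (- ((y * s)\<^sup>2 / 2)) \<le> 1 - (y * s)\<^sup>2 / 2 / 2" by (intro exp_minus_le) auto
        moreover have "s ^ 3 \<le> s\<^sup>2" using s by (intro power_decreasing) auto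
        ultimately have "Q n (u n) \<le> 1 - (y * s)\<^sup>2 / 4 + (s * (\<bar>y\<bar> * s) + s\<^sup>2) * D + s\<^sup>2"
          using le True by simp
        also have "\<dots> = 1 - s\<^sup>2 * (\<bar>y\<bar> * (\<bar>y\<bar> / 4 - D) - D - 1)"
          by (simp add: power_mult_distrib power2_eq_square algebra_simps)
        also have "\<dots> < 1 - s\<^sup>2 * B"
        proof -
          have "\<bar>y\<bar> / 4 - D \<ge> D + B + 2" using yA by (simp add: A_def)
          then have "\<bar>y\<bar> * (\<bar>y\<bar> / 4 - D) \<ge> 1 * (D + B + 2)" using yA A1 B(1) D0 by (intro mult_mono) auto
          moreover have "B < t - D - 1" if "1 * (D + B + 2) \<le> t" for t using that by simp
          ultimately have "B < \<bar>y\<bar> * (\<bar>y\<bar> / 4 - D) - D - 1" by blast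
          then show ?thesis using s by simp
        qed
        finally show False using ge by (simp add: mult.commute)
      next
        case False
        then have "1 \<le> \<bar>y * s\<bar>\<^sup>2" using s by (intro one_le_power) (simp add: abs_mult)
        then have "1 \<le> (y * s)\<^sup>2" by simp
        then have "exp (- ((y * s)\<^sup>2 / 2)) \<le> exp (- (1 / 2))" by simp
        also have "\<dots> \<le> 1 - 1 / 2 / 2" by (rule exp_minus_le) auto
        finally have "exp (- ((y * s)\<^sup>2 / 2)) \<le> 3 / 4" by simp
        then have "Q n (u n) \<le> 3 / 4 + (s + s\<^sup>2) * D + s ^ 3" using le False by simp
        with ge elim(2) show False by (simp add: s_def mult.commute)
      qed
    qed
  qed
  then show ?thesis using A1 by blast
qed

text \<open>Let a and b be the squared distances of the nearest integer and of the mode from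
  \<open>ustar n\<close>. Maximality gives 0 <= b - a <= 4 D s, and a <= 1/4, so b < 1 eventually.
  Near a half-integer this does not single out the nearest neighbour; for the height that does not
  matter, since replacing b by a changes it only by order s^3.\<close>

lemma mode_asymptotics:
  "\<exists>D\<ge>0. \<forall>\<^sub>F n in sequentially. \<bar>real_of_int (u n) - ustar n\<bar> < 1 \<and>
     \<bar>Q n (u n) - (1 - 1 / (2 * \<sigma>2 * real n) * (cst + (dist_Z (ustar n))\<^sup>2))\<bar> \<le> D * sc n ^ 3"
proof -
  obtain A0 where A0: "A0 \<ge> 1" "\<forall>\<^sub>F n in sequentially. \<bar>real_of_int (u n) - \<mu> * real n\<bar> \<le> A0"
    using mode_bounded by blast
  define A where "A = A0 + \<bar>shift\<bar>"
  obtain D where D: "D \<ge> 0" "\<forall>\<^sub>F n in sequentially. \<forall>k. \<bar>real_of_int k - \<mu> * real n\<bar> \<le> A \<longrightarrow>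
     \<bar>Q n k - (1 - (sc n)\<^sup>2 / 2 * (cst + (real_of_int k - ustar n)\<^sup>2))\<bar> \<le> D * sc n ^ 3"
    using Q_expansion[of A] A0(1) unfolding A_def by fastforce
  have "(\<lambda>n. 4 * D * sc n) \<longlonglongrightarrow> 4 * D * 0" by (intro tendsto_intros sc_limit)
  \<comment> \<open>3/4 is what separates the largest squared distance 1/4 to a nearest integer from
    1.\<close>
  then have small: "\<forall>\<^sub>F n in sequentially. 4 * D * sc n < 3 / 4" by (intro order_tendstoD(2)) auto
  have "\<forall>\<^sub>F n in sequentially. \<bar>real_of_int (u n) - ustar n\<bar> < 1 \<and>
     \<bar>Q n (u n) - (1 - 1 / (2 * \<sigma>2 * real n) * (cst + (dist_Z (ustar n))\<^sup>2))\<bar> \<le> 3 * D * sc n ^ 3"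
    using A0(2) D(2) small eventually_n
  proof eventually_elim
    case (elim n)
    define s where "s = sc n"
    define k where "k = round (ustar n)"
    define a where "a = (real_of_int k - ustar n)\<^sup>2"
    define b where "b = (real_of_int (u n) - ustar n)\<^sup>2"
    have n0: "n > 0" using elim(4) by (cases n) auto
    have s: "0 < s" using n0 sigma by (auto simp: s_def sc_def)
    have r: "\<bar>of_int k - ustar n\<bar> \<le> 1 / 2" unfolding k_def by (rule of_int_round_abs_le)
    have ab: "a \<le> b"
      unfolding a_def b_def using round_diff_minimal[of "ustar n" "u n"]
      by (simp add: k_def abs_le_square_iff power2_commute)
    have a14: "a \<le> 1 / 4"
      unfolding a_def using power_mono[OF r, of 2] by (simp add: power_divide)
    have "\<bar>real_of_int k - \<mu> * real n\<bar> \<le> A" using r A0(1) unfolding ustar_def A_def by linarith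
    then have Qk: "\<bar>Q n k - (1 - s\<^sup>2 / 2 * (cst + a))\<bar> \<le> D * s ^ 3" using elim(2) by (simp add: a_def s_def)
    have "\<bar>real_of_int (u n) - \<mu> * real n\<bar> \<le> A" using elim(1) unfolding A_def by linarith
    then have Qu: "\<bar>Q n (u n) - (1 - s\<^sup>2 / 2 * (cst + b))\<bar> \<le> D * s ^ 3" using elim(2) by (simp add: b_def s_def)
    have "Q n k \<le> Q n (u n)" by (rule Q_mono[OF u_max])
    with Qk Qu have "s\<^sup>2 / 2 * (cst + b) - s\<^sup>2 / 2 * (cst + a) \<le> 2 * (D * s ^ 3)" by linarith
    then have "s\<^sup>2 / 2 * (b - a) \<le> s\<^sup>2 / 2 * (4 * D * s)"
      by (simp add: algebra_simps power2_eq_square power3_eq_cube)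
    then have ba: "b - a \<le> 4 * D * s" using s by (simp add: mult_le_cancel_left)
    then have "b < 1" using elim(3) a14 by (simp add: s_def)
    then have 1: "\<bar>real_of_int (u n) - ustar n\<bar> < 1"
      by (simp add: b_def abs_square_less_1)
    have "a = (dist_Z (ustar n))\<^sup>2" by (simp add: a_def dist_Z_eq k_def power2_commute)
    then have "Q n (u n) - (1 - 1 / (2 * \<sigma>2 * real n) * (cst + (dist_Z (ustar n))\<^sup>2)) = (Q n (u n) - (1 - s\<^sup>2 / 2 * (cst + b))) - s\<^sup>2 / 2 * (b - a)"
      unfolding sc_sq[OF n0] s_def by (simp add: algebra_simps)
    also have "\<bar>\<dots>\<bar> \<le> D * s ^ 3 + \<bar>s\<^sup>2 / 2 * (b - a)\<bar>" using Qu by linarith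
    also have "\<bar>s\<^sup>2 / 2 * (b - a)\<bar> \<le> s\<^sup>2 / 2 * (4 * D * s)"
    proof -
      have "0 \<le> s\<^sup>2 / 2 * (b - a)" using ab by simp
      moreover have "s\<^sup>2 / 2 * (b - a) \<le> s\<^sup>2 / 2 * (4 * D * s)" using ba by (intro mult_left_mono) auto
      ultimately show ?thesis by linarith
    qed
    finally show ?case using 1 by (simp add: s_def power2_eq_square power3_eq_cube)
  qed
  then show ?thesis using D(1) by (intro exI[of _ "3 * D"]) auto
qed

lemma mode_floor_ceiling: "\<exists>N. \<forall>n>N. u n = \<lfloor>ustar n\<rfloor> \<or> u n = \<lceil>ustar n\<rceil>"
proof -
  have "\<forall>\<^sub>F n in sequentially. \<bar>real_of_int (u n) - ustar n\<bar> < 1"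
    using mode_asymptotics by (auto elim: eventually_mono)
  then obtain N where N: "\<And>n. n \<ge> N \<Longrightarrow> \<bar>real_of_int (u n) - ustar n\<bar> < 1"
    unfolding eventually_sequentially by blast
  have "u n = \<lfloor>ustar n\<rfloor> \<or> u n = \<lceil>ustar n\<rceil>" if "n > N" for n
    using N[of n] that by (cases "real_of_int (u n) \<le> ustar n") linarith+
  then show ?thesis by blast
qed

lemma height_asymptotics:
  "(\<lambda>n. Q n (u n) - (1 - 1 / (2 * \<sigma>2 * real n) * (cst + (dist_Z (ustar n))\<^sup>2))) \<in> o(\<lambda>n. 1 / real n)"
proof -
  obtain D where D: "D \<ge> 0" "\<forall>\<^sub>F n in sequentially. \<bar>real_of_int (u n) - ustar n\<bar> < 1 \<and>
     \<bar>Q n (u n) - (1 - 1 / (2 * \<sigma>2 * real n) * (cst + (dist_Z (ustar n))\<^sup>2))\<bar> \<le> D * sc n ^ 3"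
    using mode_asymptotics by blast
  have "(\<lambda>n. Q n (u n) - (1 - 1 / (2 * \<sigma>2 * real n) * (cst + (dist_Z (ustar n))\<^sup>2))) \<in> O(\<lambda>n. sc n ^ 3)"
  proof (rule bigoI[where c=D])
    show "\<forall>\<^sub>F n in sequentially. norm (Q n (u n) - (1 - 1 / (2 * \<sigma>2 * real n) * (cst + (dist_Z (ustar n))\<^sup>2))) \<le> D * norm (sc n ^ 3)"
      using D(2) by eventually_elim (use D(1) sigma in \<open>auto simp: sc_def\<close>)
  qed
  also have "(\<lambda>n. sc n ^ 3) \<in> o(\<lambda>n. 1 / real n)"
    unfolding sc_def using sigma by real_asymp
  finally show ?thesis .
qed

end

end

section \<open>The cumulant generating function\<close>

lemma Taylor_holomorphic_bound:
  assumes F: "F holomorphic_on ball 0 R" and \<rho>: "\<rho> < R"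
  shows "\<exists>K\<ge>0. \<forall>z. norm z \<le> \<rho> \<longrightarrow> norm (F z - (\<Sum>i\<le>n. (deriv ^^ i) F 0 * z ^ i / fact i)) \<le> K * norm z ^ Suc n"
proof (cases "\<rho> \<ge> 0")
  case True
  have hol: "(deriv ^^ i) F holomorphic_on ball 0 R" for i
    by (rule holomorphic_higher_deriv[OF F]) simp
  have "compact ((deriv ^^ Suc n) F ` cball 0 \<rho>)"
    by (intro compact_continuous_image holomorphic_on_imp_continuous_on holomorphic_on_subset[OF hol]) (use \<rho> in auto)
  then obtain B where B: "B > 0" "\<And>z. z \<in> cball 0 \<rho> \<Longrightarrow> norm ((deriv ^^ Suc n) F z) \<le> B"
  proof -
    assume "compact ((deriv ^^ Suc n) F ` cball 0 \<rho>)"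
    then have "bounded ((deriv ^^ Suc n) F ` cball 0 \<rho>)" by (rule compact_imp_bounded)
    then show ?thesis using that unfolding bounded_pos by blast
  qed
  have "norm (F z - (\<Sum>i\<le>n. (deriv ^^ i) F 0 * z ^ i / fact i)) \<le> B / fact n * norm z ^ Suc n" if z: "norm z \<le> \<rho>" for z
  proof -
    have "norm ((deriv ^^ 0) F z - (\<Sum>i\<le>n. (deriv ^^ i) F 0 * (z - 0) ^ i / fact i)) \<le> B * norm (z - 0) ^ Suc n / fact n"
    proof (rule complex_Taylor[of "cball 0 \<rho>" n "\<lambda>i. (deriv ^^ i) F" B 0 z])
      fix i and x :: complex assume x: "x \<in> cball 0 \<rho>"
      have "((deriv ^^ i) F has_field_derivative deriv ((deriv ^^ i) F) x) (at x)"
        using x \<rho> by (intro holomorphic_derivI[OF hol open_ball]) auto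
      then show "((deriv ^^ i) F has_field_derivative (deriv ^^ Suc i) F x) (at x within cball 0 \<rho>)"
        by (simp add: has_field_derivative_at_within)
    qed (use B z True in auto)
    then show ?thesis by simp
  qed
  then show ?thesis using B(1) by (intro exI[of _ "B / fact n"]) auto
next
  case False
  then have "\<not> norm z \<le> \<rho>" for z :: complex using norm_ge_zero[of z] by linarith
  then show ?thesis by (intro exI[of _ 0]) auto
qed

text \<open>Cumulants and derivatives of the limit are real derivatives, while the estimates are
  complex. They agree because the imaginary part vanishes along the real axis and so does its
  derivative.\<close>

lemma real_derivative_of_holomorphic:
  assumes F: "F holomorphic_on ball 0 R" and f: "\<And>x. \<bar>x\<bar> < R \<Longrightarrow> F (of_real x) = of_real (f x)" and x: "\<bar>x\<bar> < R"
  shows "(f has_field_derivative Re (deriv F (of_real x))) (at x)" "deriv F (of_real x) = of_real (deriv f x)"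
proof -
  have "(F has_field_derivative deriv F (of_real x)) (at (of_real x))"
    using x by (intro holomorphic_derivI[OF F open_ball]) simp
  then have v: "((\<lambda>x. F (of_real x)) has_vector_derivative deriv F (of_real x)) (at x)"
    by (rule has_vector_derivative_real_field)
  have v': "((\<lambda>x. complex_of_real (f x)) has_vector_derivative deriv F (of_real x)) (at x)"
    using v by (rule has_vector_derivative_transform_within_open[of _ _ _ "{-R<..<R}"]) (use x f in auto)
  have re: "((\<lambda>x. Re (complex_of_real (f x))) has_vector_derivative Re (deriv F (of_real x))) (at x)"
    using bounded_linear.has_vector_derivative[OF bounded_linear_Re v'] .
  have im: "((\<lambda>x. Im (complex_of_real (f x))) has_vector_derivative Im (deriv F (of_real x))) (at x)"
    using bounded_linear.has_vector_derivative[OF bounded_linear_Im v'] .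
  show d: "(f has_field_derivative Re (deriv F (of_real x))) (at x)"
    using re by (simp add: has_real_derivative_iff_has_vector_derivative)
  have "((\<lambda>x. 0::real) has_field_derivative Im (deriv F (of_real x))) (at x)"
    using im by (simp add: has_real_derivative_iff_has_vector_derivative)
  then have "Im (deriv F (of_real x)) = 0" using DERIV_const DERIV_unique by blast
  then show "deriv F (of_real x) = of_real (deriv f x)"
    using DERIV_imp_deriv[OF d] by (simp add: complex_eq_iff)
qed

lemma higher_deriv_of_holomorphic:
  assumes F: "F holomorphic_on ball 0 R" and f: "\<And>x. \<bar>x\<bar> < R \<Longrightarrow> F (of_real x) = of_real (f x)"
  shows "\<bar>x\<bar> < R \<Longrightarrow> (deriv ^^ j) F (of_real x) = of_real ((deriv ^^ j) f x)"
proof (induction j arbitrary: x)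
  case (Suc j)
  have "(deriv ^^ j) F holomorphic_on ball 0 R" by (rule holomorphic_higher_deriv[OF F]) simp
  from real_derivative_of_holomorphic(2)[OF this Suc.IH Suc.prems] show ?case by simp
qed (use f in simp)

lemma profile_sum_1: "profile_sum \<zeta> 1 (\<lambda>k. exp (\<beta> * real_of_int k)) \<omega> = Re (offspring_sum (of_real \<beta>) (\<zeta> [] \<omega>))"
  unfolding profile_sum_def sum_gen_eq_sum_L[symmetric] gen_sum_1[symmetric]
  by (simp add: gen_sum_def cexpi_of_real)

lemma (in branching_random_walk) laplace_eq_mgf: "laplace M \<zeta> \<beta> = mgf \<beta>"
  unfolding laplace_def mgf_def profile_sum_1 ..

lemma exp_sum_ge: "2 + t\<^sup>2 / 2 \<le> exp t + exp (- t)" for t :: real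
proof -
  have *: "2 + t\<^sup>2 / 2 \<le> exp t + exp (- t)" if "0 \<le> t" for t :: real
    using exp_lower_Taylor_quadratic[OF that] exp_ge_add_one_self[of "- t"] by linarith
  from *[of t] *[of "- t"] show ?thesis by (cases "0 \<le> t") (auto simp: add.commute)
qed

context brw_exp_moments
begin

lemma mean_offspring_eq: "mean_offspring M \<zeta> = a"
  using mean_weight_0[of 1] m_nonneg[of 0]
  by (simp add: mean_offspring_def a_def flip: ennreal_of_nat_eq_real_of_nat)

text \<open>Continuity at 0 and a > 0 keep m in the right half-plane on a small disc, so the
  principal logarithm is holomorphic there and agrees with \<phi> on the real axis.\<close>

lemma log_m:
  assumes a: "a > 0"
  shows "\<exists>R>0. R < \<delta> \<and> (\<exists>F. F holomorphic_on ball 0 R \<and> (\<forall>z. norm z < R \<longrightarrow> m z = of_real a * exp (F z - F 0)) \<and>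
    (\<forall>x. \<bar>x\<bar> < R \<longrightarrow> F (of_real x) = of_real (phi M \<zeta> x)))"
proof -
  have "(m \<longlongrightarrow> of_real a) (at 0)"
    using isCont_m[of 0] delta_pos by (simp add: isCont_def m_0)
  then have "((\<lambda>z. Re (m z)) \<longlongrightarrow> a) (at 0)" using tendsto_Re by fastforce
  then have "\<forall>\<^sub>F z in at 0. Re (m z) > 0" using a by (rule order_tendstoD(1))
  then obtain d where d: "d > 0" "\<And>z. z \<noteq> 0 \<Longrightarrow> norm z < d \<Longrightarrow> Re (m z) > 0"
    unfolding eventually_at by (auto simp: dist_norm)
  have pos: "Re (m z) > 0" if "norm z < d" for z
    using d(2)[of z] that a by (cases "z = 0") (auto simp: m_0)
  define R where "R = min d (\<delta> / 2)"
  have R: "R > 0" "R < \<delta>" "R \<le> d" using d delta_pos by (auto simp: R_def)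
  define F where "F z = Ln (m z)" for z
  have hm: "m holomorphic_on ball 0 R"
  proof (rule holomorphic_on_subset[OF holomorphic_m], safe)
    fix z :: complex assume "z \<in> ball 0 R"
    then show "\<bar>Re z\<bar> < \<delta>" using abs_Re_le_cmod[of z] R by simp
  qed
  have "F holomorphic_on ball 0 R"
    unfolding F_def
  proof (rule holomorphic_on_Ln'[OF _ hm])
    fix z :: complex assume "z \<in> ball 0 R"
    then have "Re (m z) > 0" using R by (intro pos) simp
    then show "m z \<notin> \<real>\<^sub>\<le>\<^sub>0" by (auto simp: complex_nonpos_Reals_iff)
  qed
  moreover have "m z = of_real a * exp (F z - F 0)" if "norm z < R" for z
  proof -
    have "m z \<noteq> 0" "m 0 \<noteq> 0" using pos[of z] pos[of 0] that R d by auto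
    then show ?thesis by (simp add: F_def exp_diff flip: m_0)
  qed
  moreover have "F (of_real x) = of_real (phi M \<zeta> x)" if x: "\<bar>x\<bar> < R" for x
  proof -
    have p: "Re (m (of_real x)) > 0" using x R by (intro pos) simp
    have "laplace M \<zeta> x = ennreal (Re (m (of_real x)))"
      unfolding laplace_eq_mgf using x R by (intro mgf_eq) simp
    then have "phi M \<zeta> x = ln (Re (m (of_real x)))" using p by (simp add: phi_def)
    then show ?thesis using p m_of_real[of x] by (simp add: F_def flip: Ln_of_real)
  qed
  ultimately show ?thesis using R by blast
qed

text \<open>
  With h(x) = m(x) exp (- mu x), the second difference h(x) + h(-x) - 2 h(0) is at least of order
  x^2 by non-degeneracy, but of order x^3 if the second cumulant is not positive.
\<close>

lemma kappa2_pos: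
  assumes a: "a > 0" and R: "R > 0" "R < \<delta>" and F: "F holomorphic_on ball 0 R"
    and mF: "\<And>z. norm z < R \<Longrightarrow> m z = of_real a * exp (F z - F 0)" and phi: "\<And>x. \<bar>x\<bar> < R \<Longrightarrow> F (of_real x) = of_real (phi M \<zeta> x)"
    and k: "vartheta1 M \<zeta> k0 > 0" "vartheta1 M \<zeta> k1 > 0" "k1 \<noteq> k0"
  shows "kappa M \<zeta> 2 > 0"
proof (rule ccontr)
  assume "\<not> kappa M \<zeta> 2 > 0"
  then have le0: "kappa M \<zeta> 2 \<le> 0" by simp
  define \<mu> where "\<mu> = deriv (phi M \<zeta>) 0"
  \<comment> \<open>The two charged sites differ, so at least one of them is not the drift \<mu>;
    particles there give a strictly positive quadratic lower bound.\<close>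
  obtain kk where kk: "vartheta1 M \<zeta> kk > 0" "real_of_int kk \<noteq> \<mu>"
    using k by (cases "real_of_int k0 = \<mu>") auto
  define pr where "pr = prob {\<omega>\<in>space M. kk \<in> set (\<zeta> [] \<omega>)}"
  have [measurable]: "Measurable.pred M (\<lambda>\<omega>. kk \<in> set (\<zeta> [] \<omega>))"
    by (rule measurable_compose[OF measurable_zeta]) simp
  have "pr > 0"
  proof (rule ccontr)
    assume "\<not> pr > 0"
    then have "pr = 0" by (simp add: pr_def order.antisym not_less)
    then have "AE \<omega> in M. kk \<notin> set (\<zeta> [] \<omega>)" unfolding pr_def by (subst (asm) prob_Collect_eq_0) auto
    then have "AE \<omega> in M. of_nat (L \<zeta> 1 kk \<omega>) = (0::ennreal)"
      using L_1_pos_iff[of \<zeta> kk] by (auto elim!: eventually_mono)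
    then have "vartheta1 M \<zeta> kk = 0"
      unfolding vartheta1_def by (subst nn_integral_cong_AE[of _ "\<lambda>_. 0"]) auto
    with kk show False by simp
  qed
  define c where "c = (real_of_int kk - \<mu>)\<^sup>2 * pr"
  have c: "c > 0" using kk(2) \<open>pr > 0\<close> by (simp add: c_def)
  obtain K where K: "K \<ge> 0" "\<And>z. norm z \<le> R / 2 \<Longrightarrow> norm (F z - (\<Sum>i\<le>2. (deriv ^^ i) F 0 * z ^ i / fact i)) \<le> K * norm z ^ Suc 2"
    using Taylor_holomorphic_bound[OF F, of "R / 2" 2] R by auto
  \<comment> \<open>Second-order Taylor: the factor exp (- (\<mu> * x)) removes the linear term, the
    quadratic one is at most 0 by the contrary assumption, and only the cubic remainder is
    left.\<close>
  have up: "Re (m (of_real x)) * exp (- (\<mu> * x)) \<le> a * exp (K * \<bar>x\<bar> ^ 3)" if x: "\<bar>x\<bar> \<le> R / 2" for x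
  proof -
    have xR: "\<bar>x\<bar> < R" using x R by linarith
    have h: "(deriv ^^ j) F 0 = of_real ((deriv ^^ j) (phi M \<zeta>) 0)" for j
      using higher_deriv_of_holomorphic[OF F phi, of 0 j] R by simp
    have "norm (F (of_real x) - (\<Sum>i\<le>2. (deriv ^^ i) F 0 * of_real x ^ i / fact i)) \<le> K * \<bar>x\<bar> ^ 3"
      using K(2)[of "of_real x"] x by (simp add: eval_nat_numeral)
    also have "F (of_real x) - (\<Sum>i\<le>2. (deriv ^^ i) F 0 * of_real x ^ i / fact i) = of_real (phi M \<zeta> x - phi M \<zeta> 0 - \<mu> * x - kappa M \<zeta> 2 * x\<^sup>2 / 2)"
      unfolding h using phi[OF xR] by (simp add: eval_nat_numeral \<mu>_def kappa_def)
    finally have "phi M \<zeta> x - phi M \<zeta> 0 - \<mu> * x - kappa M \<zeta> 2 * x\<^sup>2 / 2 \<le> K * \<bar>x\<bar> ^ 3"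
      unfolding norm_of_real by simp
    moreover have "kappa M \<zeta> 2 * x\<^sup>2 \<le> 0" using le0 by (simp add: mult_nonpos_nonneg)
    ultimately have le: "phi M \<zeta> x - phi M \<zeta> 0 - \<mu> * x \<le> K * \<bar>x\<bar> ^ 3" by linarith
    have mx: "m (of_real x) = of_real (a * exp (phi M \<zeta> x - phi M \<zeta> 0))"
      using mF[of "of_real x"] phi[OF xR] phi[of 0] xR R by (simp flip: exp_of_real)
    have "Re (m (of_real x)) * exp (- (\<mu> * x)) = a * exp (phi M \<zeta> x - phi M \<zeta> 0 - \<mu> * x)"
      unfolding mx Re_complex_of_real by (simp add: mult.assoc flip: exp_add)
    also have "\<dots> \<le> a * exp (K * \<bar>x\<bar> ^ 3)" using le a by simp
    finally show ?thesis .
  qed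
  \<comment> \<open>A particle at k contributes exp t + exp (- t) - 2 >= t^2 / 2 with t = x (k -
    \<mu>); only one particle at kk, if there is any, is retained.\<close>
  have low: "x\<^sup>2 / 2 * c \<le> Re (m (of_real x)) * exp (- (\<mu> * x)) + Re (m (of_real (- x))) * exp (\<mu> * x) - 2 * a" if x: "\<bar>x\<bar> \<le> \<delta>" for x
  proof -
    define o1 where "o1 y \<omega> = Re (offspring_sum (of_real y) (\<zeta> [] \<omega>))" for y \<omega>
    have i: "integrable M (o1 y)" if "\<bar>y\<bar> \<le> \<delta>" for y
      unfolding o1_def using that by (intro integrable_Re integrable_offspring_sum) simp
    have e: "expectation (o1 y) = Re (m (of_real y))" if "\<bar>y\<bar> \<le> \<delta>" for y
      unfolding o1_def m_def using that by (intro integral_Re integrable_offspring_sum) simp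
    have pt: "indicator {\<omega>\<in>space M. kk \<in> set (\<zeta> [] \<omega>)} \<omega> * (x\<^sup>2 / 2 * (real_of_int kk - \<mu>)\<^sup>2)
       \<le> exp (- (\<mu> * x)) * o1 x \<omega> + exp (\<mu> * x) * o1 (- x) \<omega> - 2 * o1 0 \<omega>" if "\<omega> \<in> space M" for \<omega>
    proof -
      have "indicator (set l) kk * (x\<^sup>2 / 2 * (real_of_int kk - \<mu>)\<^sup>2)
         \<le> exp (- (\<mu> * x)) * Re (offspring_sum (of_real x) l) + exp (\<mu> * x) * Re (offspring_sum (of_real (- x)) l) - 2 * Re (offspring_sum (of_real 0) l)" for l
      proof (induction l)
        case (Cons k l)
        have "exp (- (\<mu> * x)) * exp (x * real_of_int k) + exp (\<mu> * x) * exp (- x * real_of_int k) = exp (x * (real_of_int k - \<mu>)) + exp (- (x * (real_of_int k - \<mu>)))"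
          by (simp add: algebra_simps flip: exp_add)
        also have "\<dots> \<ge> 2 + (x * (real_of_int k - \<mu>))\<^sup>2 / 2" by (rule exp_sum_ge)
        finally have t: "exp (- (\<mu> * x)) * exp (x * real_of_int k) + exp (\<mu> * x) * exp (- x * real_of_int k) - 2 \<ge> x\<^sup>2 / 2 * (real_of_int k - \<mu>)\<^sup>2"
          by (simp add: power_mult_distrib)
        have z: "0 \<le> x\<^sup>2 / 2 * (real_of_int k - \<mu>)\<^sup>2" by simp
        have "indicator (set (k # l)) kk * (x\<^sup>2 / 2 * (real_of_int kk - \<mu>)\<^sup>2) \<le> indicator (set l) kk * (x\<^sup>2 / 2 * (real_of_int kk - \<mu>)\<^sup>2) + x\<^sup>2 / 2 * (real_of_int k - \<mu>)\<^sup>2"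
          by (auto simp: indicator_def)
        then show ?case using Cons t unfolding Re_offspring_sum by (simp add: ring_distribs)
      qed (simp add: offspring_sum_def)
      from this[of "\<zeta> [] \<omega>"] show ?thesis
        using that by (simp add: o1_def indicator_def)
    qed
    have "x\<^sup>2 / 2 * c = expectation (\<lambda>\<omega>. indicator {\<omega>\<in>space M. kk \<in> set (\<zeta> [] \<omega>)} \<omega> * (x\<^sup>2 / 2 * (real_of_int kk - \<mu>)\<^sup>2))"
      by (simp add: c_def pr_def)
    also have "\<dots> \<le> expectation (\<lambda>\<omega>. exp (- (\<mu> * x)) * o1 x \<omega> + exp (\<mu> * x) * o1 (- x) \<omega> - 2 * o1 0 \<omega>)"
    proof (rule integral_mono)
      show "integrable M (\<lambda>\<omega>. indicator {\<omega>\<in>space M. kk \<in> set (\<zeta> [] \<omega>)} \<omega> * (x\<^sup>2 / 2 * (real_of_int kk - \<mu>)\<^sup>2))"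
        by (intro integrable_mult_left integrable_real_indicator) (auto simp: emeasure_eq_measure)
      show "integrable M (\<lambda>\<omega>. exp (- (\<mu> * x)) * o1 x \<omega> + exp (\<mu> * x) * o1 (- x) \<omega> - 2 * o1 0 \<omega>)"
        using x delta_pos by (intro Bochner_Integration.integrable_diff Bochner_Integration.integrable_add integrable_mult_right i) auto
    qed (rule pt)
    also have "\<dots> = exp (- (\<mu> * x)) * expectation (o1 x) + exp (\<mu> * x) * expectation (o1 (- x)) - 2 * expectation (o1 0)"
      using i[of x] i[of "- x"] i[of 0] x delta_pos by simp
    also have "\<dots> = Re (m (of_real x)) * exp (- (\<mu> * x)) + Re (m (of_real (- x))) * exp (\<mu> * x) - 2 * a"
      using e[of x] e[of "- x"] e[of 0] x delta_pos by (simp add: a_def)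
    finally show ?thesis .
  qed
  \<comment> \<open>The bound R/2 admits \<open>up\<close>, the bounds 1/(K + 1) and 1 give K x^3 <=
    1, and the last makes 4 a K x at most c/4, which contradicts the lower bound c/2.\<close>
  define x where "x = min (R / 2) (min (1 / (K + 1)) (min 1 (c / (16 * a * (K + 1)))))"
  have x: "0 < x" "x \<le> R / 2" "x \<le> 1 / (K + 1)" "x \<le> 1" "x \<le> c / (16 * a * (K + 1))"
    using R K(1) a c by (auto simp: x_def)
  have Kx: "K * x \<le> 1" using x(1,3) K(1) by (simp add: field_simps)
  have Kx3: "0 \<le> K * x ^ 3" "K * x ^ 3 \<le> 1"
  proof -
    have "x ^ 3 \<le> x" using x power_decreasing[of 1 3 x] by simp
    then have "K * x ^ 3 \<le> K * x" using K(1) by (rule mult_left_mono)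
    then show "K * x ^ 3 \<le> 1" using Kx by linarith
  qed (use K(1) x in simp)
  have "exp (K * x ^ 3) \<le> 1 + 2 * (K * x ^ 3)"
  proof -
    have "exp (K * x ^ 3) \<le> 1 + K * x ^ 3 + (K * x ^ 3)\<^sup>2" by (rule exp_bound[OF Kx3])
    also have "(K * x ^ 3)\<^sup>2 \<le> K * x ^ 3" using Kx3 mult_left_le[of "K * x ^ 3" "K * x ^ 3"] by (simp add: power2_eq_square)
    finally show ?thesis by simp
  qed
  then have aa: "a * exp (K * x ^ 3) \<le> a * (1 + 2 * (K * x ^ 3))" using a by simp
  have "x\<^sup>2 / 2 * c \<le> Re (m (of_real x)) * exp (- (\<mu> * x)) + Re (m (of_real (- x))) * exp (\<mu> * x) - 2 * a"
    using x R by (intro low) auto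
  also have "\<dots> \<le> 2 * (a * exp (K * x ^ 3)) - 2 * a"
    using up[of x] up[of "- x"] x by simp
  also have "\<dots> \<le> 2 * (a * (1 + 2 * (K * x ^ 3))) - 2 * a" using aa by simp
  also have "\<dots> = x\<^sup>2 * (4 * a * K * x)" by (simp add: algebra_simps power2_eq_square power3_eq_cube)
  finally have "x\<^sup>2 * (c / 2) \<le> x\<^sup>2 * (4 * a * K * x)" by simp
  then have "c / 2 \<le> 4 * a * K * x" using x(1) by (simp add: mult_le_cancel_left)
  also have "\<dots> \<le> 4 * a * (K + 1) * x" using a x by (simp add: mult_left_mono mult_right_mono)
  also have "\<dots> \<le> 4 * a * (K + 1) * (c / (16 * a * (K + 1)))" using a K(1) by (intro mult_left_mono x) auto
  also have "\<dots> = c / 4"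
  proof -
    have "4 * P * (c / (16 * P)) = c / 4" if "P > 0" for P using that by simp
    from this[of "a * (K + 1)"] show ?thesis using a K(1) by (simp add: mult.assoc)
  qed
  finally show False using c by simp
qed

text \<open>At 0 the defining inequality of \<open>betaset\<close> reads 0 < ln a. It persists
  nearby by continuity of \<phi> and its derivative, which come from the holomorphic
  logarithm.\<close>

lemma beta_interval:
  assumes a: "a > 1"
  shows "\<exists>\<epsilon>>0. \<forall>x. \<bar>x\<bar> < \<epsilon> \<longrightarrow> beta_minus M \<zeta> < ereal x \<and> ereal x < beta_plus M \<zeta>"
proof -
  obtain R F where R: "R > 0" "R < \<delta>" and F: "F holomorphic_on ball 0 R"
    and phi: "\<And>x. \<bar>x\<bar> < R \<Longrightarrow> F (of_real x) = of_real (phi M \<zeta> x)"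
  proof -
    have "a > 0" using a by simp
    from log_m[OF this] show ?thesis using that by blast
  qed
  have lap: "laplace M \<zeta> x < \<infinity>" if "\<bar>x\<bar> < R" for x
    unfolding laplace_eq_mgf using that R by (subst mgf_eq) auto
  have "{-R<..<R} \<subseteq> interior {\<beta>. laplace M \<zeta> \<beta> < \<infinity>}"
    by (rule interior_maximal) (use lap in \<open>auto simp: abs_less_iff minus_less_iff\<close>)
  then have sub: "{-R<..<R} \<subseteq> Dphi M \<zeta>"
    unfolding Dphi_def using R by (intro connected_component_maximal) auto
  have dphi: "deriv F (of_real x) = of_real (deriv (phi M \<zeta>) x)" if "\<bar>x\<bar> < R" for x
    by (rule real_derivative_of_holomorphic(2)[OF F phi that])
  have cont: "continuous_on {-R<..<R} (\<lambda>x. Re (F (of_real x)) - Re (deriv F (of_real x)) * x)"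
    by (intro continuous_intros continuous_on_compose2[OF holomorphic_on_imp_continuous_on[OF F]]
          continuous_on_compose2[OF holomorphic_on_imp_continuous_on[OF holomorphic_deriv[OF F open_ball]]]) auto
  have "isCont (\<lambda>x. Re (F (of_real x)) - Re (deriv F (of_real x)) * x) 0"
    using cont R by (simp add: continuous_on_eq_continuous_at)
  then have "((\<lambda>x. Re (F (of_real x)) - Re (deriv F (of_real x)) * x) \<longlongrightarrow> Re (F 0)) (at 0)"
    by (simp add: isCont_def)
  moreover have "Re (F 0) > 0"
  proof -
    have "laplace M \<zeta> 0 = ennreal a" unfolding laplace_eq_mgf using mgf_eq[of 0] delta_pos by (simp add: a_def)
    then have "phi M \<zeta> 0 = ln a" using a by (simp add: phi_def)
    then show ?thesis using phi[of 0] R a by simp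
  qed
  ultimately have "\<forall>\<^sub>F x in at 0. Re (F (of_real x)) - Re (deriv F (of_real x)) * x > 0" by (rule order_tendstoD(1))
  then obtain d where d: "d > 0" "\<And>x. x \<noteq> 0 \<Longrightarrow> \<bar>x\<bar> < d \<Longrightarrow> Re (F (of_real x)) - Re (deriv F (of_real x)) * x > 0"
    unfolding eventually_at by (auto simp: dist_real_def)
  define e where "e = min d R"
  have e: "e > 0" using d R by (simp add: e_def)
  have mem: "x \<in> betaset M \<zeta>" if x: "\<bar>x\<bar> < e" for x
  proof -
    have "Re (F (of_real x)) - Re (deriv F (of_real x)) * x > 0"
      using d(2)[of x] x \<open>Re (F 0) > 0\<close> by (cases "x = 0") (auto simp: e_def)
    moreover have "x \<in> Dphi M \<zeta>" using sub x by (auto simp: e_def abs_less_iff minus_less_iff)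
    ultimately show ?thesis using x phi[of x] dphi[of x] by (auto simp: betaset_def e_def)
  qed
  have "beta_minus M \<zeta> < ereal x \<and> ereal x < beta_plus M \<zeta>" if x: "\<bar>x\<bar> < e" for x
  proof
    \<comment> \<open>A point strictly between |x| and e turns the non-strict bounds by infimum and
      supremum into strict ones.\<close>
    define y where "y = (\<bar>x\<bar> + e) / 2"
    have y: "\<bar>x\<bar> < y" "y < e" using x by (auto simp: y_def)
    then have "- y \<in> betaset M \<zeta>" "y \<in> betaset M \<zeta>" by (auto intro!: mem)
    then have "beta_minus M \<zeta> \<le> ereal (- y)" "ereal y \<le> beta_plus M \<zeta>"
      unfolding beta_minus_def beta_plus_def by (auto intro: Inf_lower Sup_upper)
    moreover have "ereal (- y) < ereal x" "ereal x < ereal y" using y by auto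
    ultimately show "beta_minus M \<zeta> < ereal x" "ereal x < beta_plus M \<zeta>"
      by (blast intro: le_less_trans less_le_trans)+
  qed
  then show ?thesis using e by blast
qed

end

section \<open>Asymptotics of the profile\<close>

lemma Wn_eq:
  "complex_of_real (Wn M \<zeta> n \<beta> \<omega>) = gen_sum \<zeta> (of_real \<beta>) n \<omega> / of_real (exp (phi M \<zeta> \<beta>)) ^ n"
proof -
  have "Wn M \<zeta> n \<beta> \<omega> = (\<Sum>u\<in>gen \<zeta> n \<omega>. exp (\<beta> * real_of_int (pos \<zeta> u \<omega>) - phi M \<zeta> \<beta> * real n))"
    unfolding Wn_def profile_sum_def
    by (rule sum_gen_eq_sum_L[where f="\<lambda>k. exp (\<beta> * real_of_int k - phi M \<zeta> \<beta> * real n)", symmetric])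
  also have "\<dots> = (\<Sum>u\<in>gen \<zeta> n \<omega>. exp (\<beta> * real_of_int (pos \<zeta> u \<omega>))) / exp (phi M \<zeta> \<beta>) ^ n"
    by (simp add: exp_diff sum_divide_distrib exp_of_nat2_mult)
  finally show ?thesis by (simp add: gen_sum_def cexpi_of_real)
qed

lemma deriv_deriv_ln:
  fixes f :: "real \<Rightarrow> real"
  assumes e: "e > 0" and f: "\<And>x. \<bar>x\<bar> < e \<Longrightarrow> (f has_field_derivative f' x) (at x)"
    and f': "(f' has_field_derivative d) (at 0)" and pos: "f 0 > 0"
  shows "deriv (deriv (\<lambda>x. ln (f x))) 0 = d / f 0 - (f' 0 / f 0)\<^sup>2"
proof -
  have "isCont f 0" using f[of 0] e by (simp add: DERIV_isCont)
  then have "\<forall>\<^sub>F x in nhds 0. f x > 0"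
    using pos unfolding isCont_def tendsto_at_iff_tendsto_nhds by (rule order_tendstoD(1))
  moreover have "\<forall>\<^sub>F x in nhds 0. \<bar>x\<bar> < e"
    unfolding eventually_nhds using e by (intro exI[of _ "{-e<..<e}"]) auto
  ultimately have "\<forall>\<^sub>F x in nhds 0. deriv (\<lambda>x. ln (f x)) x = f' x / f x"
  proof eventually_elim
    case (elim x)
    have "((\<lambda>x. ln (f x)) has_field_derivative f' x / f x) (at x)"
      using f[OF elim(2)] elim(1) by (auto intro!: derivative_eq_intros)
    then show ?case by (rule DERIV_imp_deriv)
  qed
  then have "deriv (deriv (\<lambda>x. ln (f x))) 0 = deriv (\<lambda>x. f' x / f x) 0" by (rule deriv_cong_ev) simp
  also have "\<dots> = (d * f 0 - f' 0 * f' 0) / (f 0 * f 0)"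
    using f[of 0] f' e pos by (intro DERIV_imp_deriv DERIV_divide) auto
  also have "\<dots> = d / f 0 - (f' 0 / f 0)\<^sup>2" using pos by (simp add: field_simps power2_eq_square)
  finally show ?thesis .
qed

lemma height_eq:
  assumes "\<And>k. L \<zeta> n k \<omega> \<le> L \<zeta> n k0 \<omega>"
  shows "height \<zeta> n \<omega> = L \<zeta> n k0 \<omega>"
  unfolding height_def by (rule cSup_eq_maximum) (use assms in auto)

context brw_exp_moments
begin

text \<open>The logarithm of m(it) / a with drift and Gaussian term taken out; it becomes \<psi> in
  the Edgeworth expansion.\<close>

definition log_remainder :: "(complex \<Rightarrow> complex) \<Rightarrow> real \<Rightarrow> complex" where
  "log_remainder F t = F (\<i> * of_real t) - F 0 - \<i> * of_real (kappa M \<zeta> 1 * t) + of_real (kappa M \<zeta> 2 * t\<^sup>2 / 2)"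

definition remainder_bounds :: "(complex \<Rightarrow> complex) \<Rightarrow> real \<Rightarrow> real \<Rightarrow> bool" where
  "remainder_bounds F K t \<longleftrightarrow>
     norm (log_remainder F t - (- \<i> * of_real (kappa M \<zeta> 3 * t ^ 3 / 6) + of_real (kappa M \<zeta> 4 * t ^ 4 / 24))) \<le> K * \<bar>t\<bar> ^ 5 \<and>
     norm (log_remainder F t) \<le> kappa M \<zeta> 2 * t\<^sup>2 / 4"

lemma phi_0: "a > 0 \<Longrightarrow> phi M \<zeta> 0 = ln a"
  using mgf_eq[of 0] delta_pos by (simp add: phi_def laplace_eq_mgf a_def)

text \<open>The inversion integral is cut at \<eta>. The outer part is bounded by the integrated
  estimate \<open>away\<close>; in the inner part S_n is replaced by W m^n, the relative error being
  multiplied back by |m(it)|^n <= a^n. Dividing by W(0) a^n leaves a geometric error that does not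
  depend on the site.\<close>

lemma local_approximation:
  assumes a: "a > 1" and \<eta>: "0 < \<eta>" "\<eta> \<le> r" "\<eta> \<le> pi" and K1: "K1 \<ge> 0" and \<theta>: "0 < \<theta>" "\<theta>1 \<le> \<theta>" "\<theta>2 \<le> \<theta>" "0 < \<theta>1" "0 < \<theta>2"
    and W: "continuous_on {-\<eta>..\<eta>} (\<lambda>t. W (\<i> * of_real t))"
    and lim: "\<And>n z. norm z \<le> r \<Longrightarrow> norm (gen_sum \<zeta> z n \<omega> / m z ^ n - W z) \<le> K1 * \<theta>1 ^ n"
    and nz: "\<And>z. norm z \<le> r \<Longrightarrow> m z \<noteq> 0"
    and K2: "K2 \<ge> 0" and away: "\<And>n. (\<integral>\<^sup>+t\<in>{-pi..pi} - {-\<eta>..\<eta>}. ennreal (norm (gen_sum \<zeta> (\<i> * of_real t) n \<omega> / of_real (a ^ n))) \<partial>lborel) \<le> ennreal (K2 * \<theta>2 ^ n)"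
    and W0: "W0 > 0"
  shows "\<bar>real (L \<zeta> n k \<omega>) / (W0 * a ^ n)
     - Re (LBINT t:{-\<eta>..\<eta>}. exp (- (\<i> * of_real t * of_int k)) * (W (\<i> * of_real t) / of_real W0) * (m (\<i> * of_real t) / of_real a) ^ n) / (2 * pi)\<bar>
     \<le> (2 * \<eta> * K1 + K2) / (2 * pi * W0) * \<theta> ^ n"
proof -
  define e where "e t = exp (- (\<i> * complex_of_real t * of_int k))" for t
  define S where "S t = gen_sum \<zeta> (\<i> * of_real t) n \<omega>" for t
  define mt where "mt t = m (\<i> * of_real t)" for t
  define A where "A = {-pi..pi} - {-\<eta>..\<eta>}"
  have ne: "norm (e t) = 1" for t by (simp add: e_def)
  have ce: "continuous_on X e" for X unfolding e_def by (intro continuous_intros)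
  have cS: "continuous_on X S" for X
    unfolding S_def by (rule continuous_on_compose2[OF holomorphic_on_imp_continuous_on[OF holomorphic_gen_sum]]) (auto intro: continuous_intros)
  have cm: "continuous_on X mt" for X
    unfolding mt_def by (rule continuous_on_compose2[OF holomorphic_on_imp_continuous_on[OF holomorphic_m]]) (use delta_pos in \<open>auto intro!: continuous_intros\<close>)
  have iS: "set_integrable lborel {c..d} (\<lambda>t. e t * S t)" for c d
    by (intro borel_integrable_atLeastAtMost' continuous_intros ce cS)
  have iA: "set_integrable lborel A (\<lambda>t. e t * S t)"
    by (rule set_integrable_subset[OF iS[of "-pi" pi]]) (auto simp: A_def)
  have iW: "set_integrable lborel {-\<eta>..\<eta>} (\<lambda>t. e t * (W (\<i> * of_real t) * mt t ^ n))"
    by (intro borel_integrable_atLeastAtMost' continuous_intros ce cm W)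
  have "complex_of_real (2 * pi * real (L \<zeta> n k \<omega>)) = (LBINT t:{-pi..pi}. e t * S t)"
    unfolding e_def S_def by (rule Fourier_inversion[symmetric])
  also have "{-pi..pi} = {-\<eta>..\<eta>} \<union> A" using \<eta> by (auto simp: A_def)
  also have "(LBINT t:{-\<eta>..\<eta>} \<union> A. e t * S t) = (LBINT t:{-\<eta>..\<eta>}. e t * S t) + (LBINT t:A. e t * S t)"
    by (rule set_integral_Un[OF _ iS iA]) (auto simp: A_def)
  finally have split: "complex_of_real (2 * pi * real (L \<zeta> n k \<omega>)) = (LBINT t:{-\<eta>..\<eta>}. e t * S t) + (LBINT t:A. e t * S t)" .
  have far: "norm (LBINT t:A. e t * S t) \<le> a ^ n * (K2 * \<theta>2 ^ n)"
  proof -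
    have "ennreal (norm (LBINT t:A. e t * S t)) \<le> (\<integral>\<^sup>+t. ennreal (norm (indicator A t *\<^sub>R (e t * S t))) \<partial>lborel)"
      using iA unfolding set_lebesgue_integral_def set_integrable_def by (rule integral_norm_bound_ennreal)
    also have "\<dots> = (\<integral>\<^sup>+t. ennreal (a ^ n) * (ennreal (norm (S t / of_real (a ^ n))) * indicator A t) \<partial>lborel)"
      using a by (intro nn_integral_cong) (auto simp: norm_mult ne norm_divide norm_power indicator_def simp flip: ennreal_mult)
    also have "\<dots> = ennreal (a ^ n) * (\<integral>\<^sup>+t\<in>A. ennreal (norm (S t / of_real (a ^ n))) \<partial>lborel)"
    proof (rule nn_integral_cmult)
      have [measurable]: "S \<in> borel_measurable borel" by (rule borel_measurable_continuous_onI[OF cS])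
      have [measurable]: "A \<in> sets borel" by (simp add: A_def)
      show "(\<lambda>t. ennreal (norm (S t / of_real (a ^ n))) * indicator A t) \<in> borel_measurable lborel" by measurable
    qed
    also have "\<dots> \<le> ennreal (a ^ n) * ennreal (K2 * \<theta>2 ^ n)"
      unfolding S_def A_def by (intro mult_left_mono away) simp
    also have "\<dots> = ennreal (a ^ n * (K2 * \<theta>2 ^ n))" using a K2 \<theta> by (simp flip: ennreal_mult)
    finally show ?thesis using a K2 \<theta> by (subst (asm) ennreal_le_iff) auto
  qed
  have near: "norm ((LBINT t:{-\<eta>..\<eta>}. e t * S t) - (LBINT t:{-\<eta>..\<eta>}. e t * (W (\<i> * of_real t) * mt t ^ n))) \<le> a ^ n * (2 * \<eta> * K1 * \<theta>1 ^ n)"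
  proof -
    have "(LBINT t:{-\<eta>..\<eta>}. e t * S t) - (LBINT t:{-\<eta>..\<eta>}. e t * (W (\<i> * of_real t) * mt t ^ n))
       = (LBINT t:{-\<eta>..\<eta>}. e t * S t - e t * (W (\<i> * of_real t) * mt t ^ n))"
      using iS iW by (simp add: set_integral_diff)
    also have "norm \<dots> \<le> (LBINT t:{-\<eta>..\<eta>}. a ^ n * (K1 * \<theta>1 ^ n))"
      unfolding set_lebesgue_integral_def
    proof (rule order_trans[OF integral_norm_bound integral_mono])
      show "integrable lborel (\<lambda>t. norm (indicator {-\<eta>..\<eta>} t *\<^sub>R (e t * S t - e t * (W (\<i> * of_real t) * mt t ^ n))))"
        using set_integral_diff(1)[OF iS iW] unfolding set_integrable_def by (rule integrable_norm)
      show "integrable lborel (\<lambda>t. indicator {-\<eta>..\<eta>} t *\<^sub>R (a ^ n * (K1 * \<theta>1 ^ n)))"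
        by (intro integrable_scaleR_left integrable_real_indicator) (auto simp: emeasure_lborel_Icc_eq)
      fix t :: real
      show "norm (indicator {-\<eta>..\<eta>} t *\<^sub>R (e t * S t - e t * (W (\<i> * of_real t) * mt t ^ n))) \<le> indicator {-\<eta>..\<eta>} t *\<^sub>R (a ^ n * (K1 * \<theta>1 ^ n))"
      proof (cases "t \<in> {-\<eta>..\<eta>}")
        case True
        then have z: "norm (\<i> * complex_of_real t) \<le> r" using \<eta> by (auto simp: norm_mult)
        have "e t * S t - e t * (W (\<i> * of_real t) * mt t ^ n) = e t * (mt t ^ n * (gen_sum \<zeta> (\<i> * of_real t) n \<omega> / m (\<i> * of_real t) ^ n - W (\<i> * of_real t)))"
          using nz[OF z] by (simp add: S_def mt_def field_simps)
        also have "norm \<dots> = norm (mt t) ^ n * norm (gen_sum \<zeta> (\<i> * of_real t) n \<omega> / m (\<i> * of_real t) ^ n - W (\<i> * of_real t))"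
          by (simp add: norm_mult ne norm_power)
        also have "\<dots> \<le> a ^ n * (K1 * \<theta>1 ^ n)"
          using norm_m_imag_le[of t] a by (intro mult_mono power_mono lim z) (auto simp: mt_def)
        finally show ?thesis using True by simp
      qed simp
    qed
    also have "\<dots> = a ^ n * (2 * \<eta> * K1 * \<theta>1 ^ n)"
      using \<eta> by (simp add: set_lebesgue_integral_def)
    finally show ?thesis .
  qed
  define I where "I = (LBINT t:{-\<eta>..\<eta>}. e t * (W (\<i> * of_real t) / of_real W0) * (mt t / of_real a) ^ n)"
  have I: "(LBINT t:{-\<eta>..\<eta>}. e t * (W (\<i> * of_real t) * mt t ^ n)) = of_real (W0 * a ^ n) * I"
  proof -
    have "of_real (W0 * a ^ n) * I = (LBINT t:{-\<eta>..\<eta>}. of_real (W0 * a ^ n) * (e t * (W (\<i> * of_real t) / of_real W0) * (mt t / of_real a) ^ n))"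
      unfolding I_def by (rule set_integral_mult_right[symmetric])
    also have "(\<lambda>t. of_real (W0 * a ^ n) * (e t * (W (\<i> * of_real t) / of_real W0) * (mt t / of_real a) ^ n)) = (\<lambda>t. e t * (W (\<i> * of_real t) * mt t ^ n))"
      using W0 a by (auto simp: fun_eq_iff power_divide)
    finally show ?thesis ..
  qed
  have "norm (complex_of_real (2 * pi * real (L \<zeta> n k \<omega>)) - of_real (W0 * a ^ n) * I) \<le> a ^ n * (2 * \<eta> * K1 * \<theta>1 ^ n) + a ^ n * (K2 * \<theta>2 ^ n)"
  proof -
    have "complex_of_real (2 * pi * real (L \<zeta> n k \<omega>)) - of_real (W0 * a ^ n) * I
       = ((LBINT t:{-\<eta>..\<eta>}. e t * S t) - (LBINT t:{-\<eta>..\<eta>}. e t * (W (\<i> * of_real t) * mt t ^ n))) + (LBINT t:A. e t * S t)"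
      unfolding split I by simp
    then show ?thesis using norm_triangle_mono[OF near far] by simp
  qed
  also have "\<dots> \<le> a ^ n * ((2 * \<eta> * K1 + K2) * \<theta> ^ n)"
  proof -
    have "\<theta>1 ^ n \<le> \<theta> ^ n" "\<theta>2 ^ n \<le> \<theta> ^ n" using \<theta> by (auto intro!: power_mono)
    then have "2 * \<eta> * K1 * \<theta>1 ^ n \<le> 2 * \<eta> * K1 * \<theta> ^ n" "K2 * \<theta>2 ^ n \<le> K2 * \<theta> ^ n"
      using \<eta> K1 K2 by (auto intro!: mult_left_mono)
    then have "2 * \<eta> * K1 * \<theta>1 ^ n + K2 * \<theta>2 ^ n \<le> (2 * \<eta> * K1 + K2) * \<theta> ^ n" unfolding distrib_right by (rule add_mono)
    then show ?thesis unfolding distrib_left[symmetric] using a by (intro mult_left_mono) auto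
  qed
  finally have "\<bar>Re (complex_of_real (2 * pi * real (L \<zeta> n k \<omega>)) - of_real (W0 * a ^ n) * I)\<bar> \<le> a ^ n * ((2 * \<eta> * K1 + K2) * \<theta> ^ n)"
    using abs_Re_le_cmod order_trans by blast
  moreover have "Re (complex_of_real (2 * pi * real (L \<zeta> n k \<omega>)) - of_real (W0 * a ^ n) * I)
      = (2 * pi * (W0 * a ^ n)) * (real (L \<zeta> n k \<omega>) / (W0 * a ^ n) - Re I / (2 * pi))"
  proof -
    have "Re (of_real (W0 * a ^ n) * I) = W0 * a ^ n * Re I"
      by (simp only: scaleR_conv_of_real[symmetric] scaleR_complex.simps)
    then have "Re (complex_of_real (2 * pi * real (L \<zeta> n k \<omega>)) - of_real (W0 * a ^ n) * I) = 2 * pi * real (L \<zeta> n k \<omega>) - W0 * a ^ n * Re I"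
      by (simp only: minus_complex.simps Re_complex_of_real)
    then show ?thesis using W0 a by (simp add: field_simps)
  qed
  ultimately have "(2 * pi * (W0 * a ^ n)) * \<bar>real (L \<zeta> n k \<omega>) / (W0 * a ^ n) - Re I / (2 * pi)\<bar> \<le> a ^ n * ((2 * \<eta> * K1 + K2) * \<theta> ^ n)"
    using W0 a by (simp add: abs_mult)
  then have "\<bar>real (L \<zeta> n k \<omega>) / (W0 * a ^ n) - Re I / (2 * pi)\<bar> \<le> a ^ n * ((2 * \<eta> * K1 + K2) * \<theta> ^ n) / (2 * pi * (W0 * a ^ n))"
    using W0 a by (subst pos_le_divide_eq) (auto simp: mult_ac)
  also have "\<dots> = (2 * \<eta> * K1 + K2) / (2 * pi * W0) * \<theta> ^ n" using a W0 by simp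
  finally show ?thesis unfolding I_def e_def mt_def .
qed

text \<open>All randomness is frozen here. \<open>Winf\<close> and the holomorphic W are limits of
  the same sequence on a real interval, so they and all their derivatives at 0 agree. Their common
  value at 0 is a limit of nonnegative numbers and is not 0 by survival, hence may be divided by.
  What remains is to supply the data of the Edgeworth locale.\<close>

lemma profile_asymptotics:
  fixes Winf :: "real \<Rightarrow> real" and u :: "nat \<Rightarrow> int"
  assumes a: "a > 1" and R: "R > 0" and F: "F holomorphic_on ball 0 R"
    and mF: "\<And>z. norm z < R \<Longrightarrow> m z = of_real a * exp (F z - F 0)" and phi: "\<And>x. \<bar>x\<bar> < R \<Longrightarrow> F (of_real x) = of_real (phi M \<zeta> x)"
    and k2: "kappa M \<zeta> 2 > 0" and \<eta>: "0 < \<eta>" "\<eta> \<le> pi" "\<eta> < r" "r < R" and K3: "K3 \<ge> 0"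
    and psi: "\<And>t. \<bar>t\<bar> \<le> \<eta> \<Longrightarrow> remainder_bounds F K3 t"
    and W: "W holomorphic_on ball 0 r" and K1: "K1 \<ge> 0" and \<theta>1: "0 < \<theta>1" "\<theta>1 < 1"
    and lim: "\<And>n z. norm z \<le> r \<Longrightarrow> norm (gen_sum \<zeta> z n \<omega> / m z ^ n - W z) \<le> K1 * \<theta>1 ^ n"
    and K2: "K2 \<ge> 0" and \<theta>2: "0 < \<theta>2" "\<theta>2 < 1"
    and away: "\<And>n. (\<integral>\<^sup>+t\<in>{-pi..pi} - {-\<eta>..\<eta>}. ennreal (norm (gen_sum \<zeta> (\<i> * of_real t) n \<omega> / of_real (a ^ n))) \<partial>lborel) \<le> ennreal (K2 * \<theta>2 ^ n)"
    and surv: "\<not> (\<lambda>n. real (Npop \<zeta> n \<omega>) / a ^ n) \<longlonglongrightarrow> 0"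
    and \<epsilon>: "\<epsilon> > 0" and Winf: "\<And>x. \<bar>x\<bar> < \<epsilon> \<Longrightarrow> (\<lambda>n. Wn M \<zeta> n x \<omega>) \<longlonglongrightarrow> Winf x"
    and mode: "\<And>n k. L \<zeta> n k \<omega> \<le> L \<zeta> n (u n) \<omega>"
  defines "us \<equiv> \<lambda>n. deriv (phi M \<zeta>) 0 * real n + deriv Winf 0 / Winf 0 - kappa M \<zeta> 3 / (2 * kappa M \<zeta> 2)"
  shows "\<exists>N. \<forall>n>N. u n = \<lfloor>us n\<rfloor> \<or> u n = \<lceil>us n\<rceil>"
    and "(\<lambda>n. sqrt (2 * pi * real n) * sqrt (kappa M \<zeta> 2) * real (height \<zeta> n \<omega>) / (Winf 0 * a ^ n)
        - (1 - 1 / (2 * kappa M \<zeta> 2 * real n) * (kappa M \<zeta> 3 ^ 2 / (6 * kappa M \<zeta> 2 ^ 2) - kappa M \<zeta> 4 / (4 * kappa M \<zeta> 2)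
              + dist_Z (us n) ^ 2 + deriv (deriv (\<lambda>\<beta>. ln (Winf \<beta>))) 0))) \<in> o(\<lambda>n. 1 / real n)"
proof -
  have nz: "m z \<noteq> 0" if "norm z < R" for z using mF[OF that] a by simp
  define \<rho> where "\<rho> = min \<epsilon> r"
  have \<rho>: "\<rho> > 0" "\<rho> \<le> r" "\<rho> \<le> \<epsilon>" using \<epsilon> \<eta> by (auto simp: \<rho>_def)
  have F0: "F 0 = of_real (ln a)" using phi[of 0] R phi_0 a by simp
  have WW: "W (of_real x) = of_real (Winf x)" if x: "\<bar>x\<bar> < \<rho>" for x
  proof (rule LIMSEQ_unique)
    have mx: "m (of_real x) = of_real (exp (phi M \<zeta> x))"
      using mF[of "of_real x"] phi[of x] x \<rho> \<eta> F0 a by (simp add: exp_diff exp_of_real)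
    have "(\<lambda>n. complex_of_real (Wn M \<zeta> n x \<omega>)) \<longlonglongrightarrow> of_real (Winf x)"
      using x \<rho> by (intro tendsto_of_real Winf) auto
    then show "(\<lambda>n. gen_sum \<zeta> (of_real x) n \<omega> / m (of_real x) ^ n) \<longlonglongrightarrow> of_real (Winf x)"
      unfolding Wn_eq mx .
    have "(\<lambda>n. K1 * \<theta>1 ^ n) \<longlonglongrightarrow> K1 * 0" using \<theta>1 by (intro tendsto_mult_left LIMSEQ_power_zero) auto
    then have z: "(\<lambda>n. K1 * \<theta>1 ^ n) \<longlonglongrightarrow> 0" by simp
    have "(\<lambda>n. gen_sum \<zeta> (of_real x) n \<omega> / m (of_real x) ^ n - W (of_real x)) \<longlonglongrightarrow> 0"
      by (rule Lim_null_comparison[OF always_eventually z]) (use lim[of "of_real x"] x \<rho> in auto)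
    then show "(\<lambda>n. gen_sum \<zeta> (of_real x) n \<omega> / m (of_real x) ^ n) \<longlonglongrightarrow> W (of_real x)"
      by (simp add: LIM_zero_iff)
  qed
  have hW: "(deriv ^^ j) W (of_real x) = of_real ((deriv ^^ j) Winf x)" if "\<bar>x\<bar> < \<rho>" for j x
    by (rule higher_deriv_of_holomorphic[OF holomorphic_on_subset[OF W] WW that]) (use \<rho> in auto)
  define W0 where "W0 = Winf 0"
  have W0: "W0 > 0"
  proof -
    have "Wn M \<zeta> n 0 \<omega> = real (Npop \<zeta> n \<omega>) / a ^ n" for n
    proof -
      have "complex_of_real (Wn M \<zeta> n 0 \<omega>) = of_real (real (Npop \<zeta> n \<omega>) / a ^ n)"
        unfolding Wn_eq using phi_0 a by (simp add: gen_sum_zero)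
      then show ?thesis by (simp only: of_real_eq_iff)
    qed
    then have l: "(\<lambda>n. real (Npop \<zeta> n \<omega>) / a ^ n) \<longlonglongrightarrow> W0" using Winf[of 0] \<epsilon> by (simp add: W0_def)
    have "W0 \<ge> 0" by (rule LIMSEQ_le_const[OF l]) (use a in auto)
    moreover have "W0 \<noteq> 0" using l surv by auto
    ultimately show ?thesis by simp
  qed
  define \<alpha> where "\<alpha> = deriv Winf 0 / W0"
  define \<beta> where "\<beta> = deriv (deriv Winf) 0 / W0"
  define V where "V t = W (\<i> * of_real t) / of_real W0" for t
  define G where "G t = m (\<i> * of_real t) / of_real a" for t
  define \<psi> where "\<psi> = log_remainder F"
  obtain KW where KW: "KW \<ge> 0" "\<And>z. norm z \<le> \<eta> \<Longrightarrow> norm (W z - (\<Sum>i\<le>2. (deriv ^^ i) W 0 * z ^ i / fact i)) \<le> KW * norm z ^ Suc 2"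
    using Taylor_holomorphic_bound[OF W \<eta>(3), of 2] by blast
  define K where "K = max (KW / W0) K3"
  have cW: "continuous_on {-\<eta>..\<eta>} (\<lambda>t. W (\<i> * of_real t))"
    by (rule continuous_on_compose2[OF holomorphic_on_imp_continuous_on[OF W]]) (use \<eta> in \<open>auto intro!: continuous_intros simp: norm_mult\<close>)
  interpret edgeworth V G \<psi> "kappa M \<zeta> 1" "kappa M \<zeta> 2" "kappa M \<zeta> 3" "kappa M \<zeta> 4" \<alpha> \<beta> K \<eta>
  proof
    show "kappa M \<zeta> 2 > 0" "\<eta> > 0" "K \<ge> 0" using k2 \<eta> K3 by (auto simp: K_def)
    show "continuous_on {-\<eta>..\<eta>} V" unfolding V_def using W0 by (intro continuous_intros cW) auto
    have "continuous_on {-\<eta>..\<eta>} (\<lambda>t. m (\<i> * of_real t))"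
      by (rule continuous_on_compose2[OF holomorphic_on_imp_continuous_on[OF holomorphic_m]]) (use delta_pos in \<open>auto intro!: continuous_intros\<close>)
    then show "continuous_on {-\<eta>..\<eta>} G" unfolding G_def using a by (intro continuous_intros) auto
    fix t :: real assume t: "\<bar>t\<bar> \<le> \<eta>"
    show "norm (\<psi> t) \<le> kappa M \<zeta> 2 * t\<^sup>2 / 4"
      using psi[OF t] by (simp add: remainder_bounds_def \<psi>_def)
    have "norm (\<psi> t - (- \<i> * of_real (kappa M \<zeta> 3 * t ^ 3 / 6) + of_real (kappa M \<zeta> 4 * t ^ 4 / 24))) \<le> K3 * \<bar>t\<bar> ^ 5"
      using psi[OF t] by (simp add: remainder_bounds_def \<psi>_def)
    also have "\<dots> \<le> K * \<bar>t\<bar> ^ 5" by (intro mult_right_mono) (auto simp: K_def)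
    finally show "norm (\<psi> t - (- \<i> * of_real (kappa M \<zeta> 3 * t ^ 3 / 6) + of_real (kappa M \<zeta> 4 * t ^ 4 / 24))) \<le> K * \<bar>t\<bar> ^ 5" .
    have "m (\<i> * of_real t) = of_real a * exp (F (\<i> * of_real t) - F 0)" using t \<eta> by (intro mF) (simp add: norm_mult)
    then show "G t = exp (\<i> * of_real (kappa M \<zeta> 1 * t) - of_real (kappa M \<zeta> 2 * t\<^sup>2 / 2) + \<psi> t)"
      using a by (simp add: G_def \<psi>_def log_remainder_def)
    have "norm (W (\<i> * of_real t) - (\<Sum>i\<le>2. (deriv ^^ i) W 0 * (\<i> * of_real t) ^ i / fact i)) \<le> KW * \<bar>t\<bar> ^ 3"
      using KW(2)[of "\<i> * of_real t"] t by (simp add: norm_mult numeral_3_eq_3)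
    also have "(\<Sum>i\<le>2. (deriv ^^ i) W 0 * (\<i> * of_real t) ^ i / fact i) = of_real W0 + \<i> * of_real (deriv Winf 0 * t) - of_real (deriv (deriv Winf) 0 * t\<^sup>2 / 2)"
      using hW[of 0 0] hW[of 0 1] hW[of 0 2] \<rho> by (simp add: numeral_2_eq_2 W0_def power_mult_distrib)
    finally have "norm (W (\<i> * of_real t) - (of_real W0 + \<i> * of_real (deriv Winf 0 * t) - of_real (deriv (deriv Winf) 0 * t\<^sup>2 / 2))) / W0 \<le> KW * \<bar>t\<bar> ^ 3 / W0"
      using W0 by (intro divide_right_mono) auto
    also have "norm (W (\<i> * of_real t) - (of_real W0 + \<i> * of_real (deriv Winf 0 * t) - of_real (deriv (deriv Winf) 0 * t\<^sup>2 / 2))) / W0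
       = norm ((W (\<i> * of_real t) - (of_real W0 + \<i> * of_real (deriv Winf 0 * t) - of_real (deriv (deriv Winf) 0 * t\<^sup>2 / 2))) / of_real W0)"
      using W0 by (simp add: norm_divide)
    also have "(W (\<i> * of_real t) - (of_real W0 + \<i> * of_real (deriv Winf 0 * t) - of_real (deriv (deriv Winf) 0 * t\<^sup>2 / 2))) / of_real W0
       = V t - (1 + \<i> * of_real (\<alpha> * t) - of_real (\<beta> * t\<^sup>2 / 2))"
      using W0 by (simp add: V_def \<alpha>_def \<beta>_def field_simps)
    also have "KW * \<bar>t\<bar> ^ 3 / W0 = (KW / W0) * \<bar>t\<bar> ^ 3" by simp
    also have "\<dots> \<le> K * \<bar>t\<bar> ^ 3" by (intro mult_right_mono) (auto simp: K_def)
    finally show "norm (V t - (1 + \<i> * of_real (\<alpha> * t) - of_real (\<beta> * t\<^sup>2 / 2))) \<le> K * \<bar>t\<bar> ^ 3" .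
  qed
  define \<theta> where "\<theta> = max \<theta>1 \<theta>2"
  have \<theta>: "0 < \<theta>" "\<theta> < 1" "\<theta>1 \<le> \<theta>" "\<theta>2 \<le> \<theta>" using \<theta>1 \<theta>2 by (auto simp: \<theta>_def)
  define C where "C = (2 * \<eta> * K1 + K2) / (2 * pi * W0)"
  have C: "C \<ge> 0" using \<eta> K1 K2 W0 by (simp add: C_def)
  define q where "q n k = real (L \<zeta> n k \<omega>) / (W0 * a ^ n)" for n k
  have approx: "\<bar>q n k - Re (local_integral n k) / (2 * pi)\<bar> \<le> C * \<theta> ^ n" for n k
    unfolding q_def local_integral_def V_def G_def C_def
    by (rule local_approximation[OF a \<eta>(1) _ \<eta>(2) K1 \<theta>(1,3,4) \<theta>1(1) \<theta>2(1) cW lim _ K2 away W0])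
       (use \<eta> nz in auto)
  have u_max: "q n k \<le> q n (u n)" for n k
    unfolding q_def using mode[of n k] W0 a by (intro divide_right_mono) auto
  have us: "us n = ustar n" for n
  proof -
    have "kappa M \<zeta> 1 = deriv (phi M \<zeta>) 0" by (simp add: kappa_def)
    then show ?thesis
      unfolding ustar_def[OF \<theta>(1,2) C approx u_max] shift_def unfolding us_def \<alpha>_def W0_def by simp
  qed
  show "\<exists>N. \<forall>n>N. u n = \<lfloor>us n\<rfloor> \<or> u n = \<lceil>us n\<rceil>"
    unfolding us by (rule mode_floor_ceiling[OF \<theta>(1,2) C approx u_max])
  have lnW: "deriv (deriv (\<lambda>\<beta>. ln (Winf \<beta>))) 0 = \<beta> - \<alpha>\<^sup>2"
  proof -
    have W\<rho>: "W holomorphic_on ball 0 \<rho>" using W by (rule holomorphic_on_subset) (use \<rho> in auto)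
    have d: "((deriv ^^ j) Winf has_field_derivative (deriv ^^ Suc j) Winf x) (at x)" if "\<bar>x\<bar> < \<rho>" for j x
    proof -
      have h: "(deriv ^^ j) W holomorphic_on ball 0 \<rho>" by (rule holomorphic_higher_deriv[OF W\<rho>]) simp
      show ?thesis using real_derivative_of_holomorphic[OF h hW that] by simp
    qed
    have "deriv (deriv (\<lambda>\<beta>. ln (Winf \<beta>))) 0 = deriv (deriv Winf) 0 / Winf 0 - (deriv Winf 0 / Winf 0)\<^sup>2"
      by (rule deriv_deriv_ln[OF \<rho>(1)]) (use d[of _ 0] d[of 0 1] \<rho> W0 in \<open>auto simp: W0_def\<close>)
    then show ?thesis by (simp add: \<alpha>_def \<beta>_def W0_def)
  qed
  have "sqrt (2 * pi * real n) * sqrt (kappa M \<zeta> 2) * real (height \<zeta> n \<omega>) / (Winf 0 * a ^ n) = Q q n (u n)" for n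
    using height_eq[of \<zeta> n \<omega> "u n"] mode by (simp add: Q_def[OF \<theta>(1,2) C approx u_max] q_def W0_def)
  moreover have "kappa M \<zeta> 3 ^ 2 / (6 * kappa M \<zeta> 2 ^ 2) - kappa M \<zeta> 4 / (4 * kappa M \<zeta> 2) + dist_Z (us n) ^ 2 + deriv (deriv (\<lambda>\<beta>. ln (Winf \<beta>))) 0
     = cst + (dist_Z (ustar n))\<^sup>2" for n
    by (simp add: cst_def[OF \<theta>(1,2) C approx u_max] lnW us)
  ultimately show "(\<lambda>n. sqrt (2 * pi * real n) * sqrt (kappa M \<zeta> 2) * real (height \<zeta> n \<omega>) / (Winf 0 * a ^ n)
        - (1 - 1 / (2 * kappa M \<zeta> 2 * real n) * (kappa M \<zeta> 3 ^ 2 / (6 * kappa M \<zeta> 2 ^ 2) - kappa M \<zeta> 4 / (4 * kappa M \<zeta> 2)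
              + dist_Z (us n) ^ 2 + deriv (deriv (\<lambda>\<beta>. ln (Winf \<beta>))) 0))) \<in> o(\<lambda>n. 1 / real n)"
    using height_asymptotics[OF \<theta>(1,2) C approx u_max] by simp
qed

end

text \<open>
  The p-th moment assumption lives on the interval (beta_-, beta_+), which is only known to contain
  0 in its interior once phi is known to be smooth near 0; hence the first pass with p = 1.
\<close>

lemma (in branching_random_walk) exp_moments_1:
  assumes C: "0 \<in> interior {\<beta>. laplace M \<zeta> \<beta> < \<infinity>}"
  shows "\<exists>\<delta>. brw_exp_moments M \<zeta> \<delta> 1"
proof -
  obtain d where d: "d > 0" "ball 0 d \<subseteq> {\<beta>. laplace M \<zeta> \<beta> < \<infinity>}"
    using C by (meson mem_interior)
  define \<delta> where "\<delta> = d / 2"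
  have \<delta>: "\<delta> > 0" and fin: "mgf \<delta> < \<infinity>" "mgf (- \<delta>) < \<infinity>"
    using d by (auto simp: \<delta>_def dist_real_def laplace_eq_mgf[symmetric] subset_eq)
  have "envelope \<delta> c = Re (offspring_sum (of_real \<delta>) c) + Re (offspring_sum (of_real (- \<delta>)) c)" for c
    unfolding Re_offspring_sum envelope_def by (simp add: sum_list_addf)
  then have "(\<integral>\<^sup>+\<omega>. ennreal (envelope \<delta> (\<zeta> [] \<omega>) powr 1) \<partial>M) = mgf \<delta> + mgf (- \<delta>)"
    unfolding mgf_def using Re_offspring_sum_nonneg[of \<delta>] Re_offspring_sum_nonneg[of "- \<delta>"]
    by (subst nn_integral_add[symmetric]) (auto simp: ennreal_plus[symmetric] simp del: ennreal_plus of_real_minus)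
  also have "\<dots> < \<infinity>" using fin by (simp add: ennreal_add_less_top)
  finally show ?thesis using \<delta> by (intro exI[of _ \<delta>] brw_exp_moments.intro branching_random_walk_axioms brw_exp_moments_axioms.intro) auto
qed

text \<open>The two-point compact set of d and - d suffices: the envelope is the sum of the
  offspring sums there, and (x + y)^p <= 2^p (x^p + y^p).\<close>

lemma (in brw_exp_moments) higher_moments:
  assumes a: "a > 1"
    and D: "\<exists>p::real>1. \<forall>K. compact K \<and> K \<subseteq> {\<beta>. beta_minus M \<zeta> < ereal \<beta> \<and> ereal \<beta> < beta_plus M \<zeta>}
              \<longrightarrow> (SUP \<beta>\<in>K. \<integral>\<^sup>+\<omega>. ennreal (Wn M \<zeta> 1 \<beta> \<omega> powr p) \<partial>M) < \<infinity>"
  shows "\<exists>\<delta>' p'. brw_exp_moments M \<zeta> \<delta>' p' \<and> p' > 1"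
proof -
  obtain p' :: real where p': "p' > 1" and D': "\<And>K. compact K \<Longrightarrow> K \<subseteq> {\<beta>. beta_minus M \<zeta> < ereal \<beta> \<and> ereal \<beta> < beta_plus M \<zeta>}
              \<Longrightarrow> (SUP \<beta>\<in>K. \<integral>\<^sup>+\<omega>. ennreal (Wn M \<zeta> 1 \<beta> \<omega> powr p') \<partial>M) < \<infinity>"
    using D by blast
  obtain \<epsilon> where \<epsilon>: "\<epsilon> > 0" "\<And>x. \<bar>x\<bar> < \<epsilon> \<Longrightarrow> beta_minus M \<zeta> < ereal x \<and> ereal x < beta_plus M \<zeta>"
    using beta_interval[OF a] by blast
  define d where "d = \<epsilon> / 2"
  have d: "d > 0" "\<bar>d\<bar> < \<epsilon>" "\<bar>- d\<bar> < \<epsilon>" using \<epsilon>(1) by (auto simp: d_def)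
  define X where "X \<beta> \<omega> = Re (offspring_sum (of_real \<beta>) (\<zeta> [] \<omega>))" for \<beta> \<omega>
  have X0: "0 \<le> X \<beta> \<omega>" for \<beta> \<omega> unfolding X_def by (rule Re_offspring_sum_nonneg)
  have [measurable]: "X \<beta> \<in> borel_measurable M" for \<beta> unfolding X_def by measurable
  have fin: "(\<integral>\<^sup>+\<omega>. ennreal (X \<beta> \<omega> powr p') \<partial>M) < \<infinity>" if "\<beta> = d \<or> \<beta> = - d" for \<beta>
  proof -
    have "(\<integral>\<^sup>+\<omega>. ennreal (Wn M \<zeta> 1 \<beta> \<omega> powr p') \<partial>M) \<le> (SUP \<beta>\<in>{d, - d}. \<integral>\<^sup>+\<omega>. ennreal (Wn M \<zeta> 1 \<beta> \<omega> powr p') \<partial>M)"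
      using that by (intro SUP_upper) auto
    also have "\<dots> < \<infinity>" using \<epsilon>(2)[OF d(2)] \<epsilon>(2)[OF d(3)] by (intro D') auto
    finally have W: "(\<integral>\<^sup>+\<omega>. ennreal (Wn M \<zeta> 1 \<beta> \<omega> powr p') \<partial>M) < \<infinity>" .
    have "ennreal (X \<beta> \<omega> powr p') = ennreal (exp (phi M \<zeta> \<beta>) powr p') * ennreal (Wn M \<zeta> 1 \<beta> \<omega> powr p')" for \<omega>
    proof -
      have "complex_of_real (Wn M \<zeta> 1 \<beta> \<omega>) = of_real (X \<beta> \<omega> / exp (phi M \<zeta> \<beta>))"
        unfolding Wn_eq gen_sum_1 X_def by (subst offspring_sum_of_real) simp
      then have "X \<beta> \<omega> = exp (phi M \<zeta> \<beta>) * Wn M \<zeta> 1 \<beta> \<omega>" by (simp only: of_real_eq_iff) simp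
      moreover have "0 \<le> Wn M \<zeta> 1 \<beta> \<omega>" unfolding Wn_def profile_sum_def by (intro sum_nonneg) simp
      ultimately show ?thesis by (simp add: powr_mult flip: ennreal_mult)
    qed
    moreover have "(\<lambda>\<omega>. ennreal (Wn M \<zeta> 1 \<beta> \<omega> powr p')) \<in> borel_measurable M"
    proof -
      have "Wn M \<zeta> 1 \<beta> \<omega> = X \<beta> \<omega> / exp (phi M \<zeta> \<beta>)" for \<omega>
      proof -
        have "complex_of_real (Wn M \<zeta> 1 \<beta> \<omega>) = of_real (X \<beta> \<omega> / exp (phi M \<zeta> \<beta>))"
          unfolding Wn_eq gen_sum_1 X_def by (subst offspring_sum_of_real) simp
        then show ?thesis by (simp only: of_real_eq_iff)
      qed
      then show ?thesis by simp
    qed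
    ultimately show ?thesis using W by (simp add: nn_integral_cmult ennreal_mult_less_top)
  qed
  have "envelope d c = Re (offspring_sum (of_real d) c) + Re (offspring_sum (of_real (- d)) c)" for c
    unfolding Re_offspring_sum envelope_def by (simp add: sum_list_addf)
  then have env: "envelope d (\<zeta> [] \<omega>) = X d \<omega> + X (- d) \<omega>" for \<omega> unfolding X_def .
  have "(\<integral>\<^sup>+\<omega>. ennreal (envelope d (\<zeta> [] \<omega>) powr p') \<partial>M) \<le> (\<integral>\<^sup>+\<omega>. ennreal (2 powr p') * (ennreal (X d \<omega> powr p') + ennreal (X (- d) \<omega> powr p')) \<partial>M)"
  proof (intro nn_integral_mono)
    fix \<omega>
    have "(X d \<omega> + X (- d) \<omega>) powr p' \<le> (2 * max (X d \<omega>) (X (- d) \<omega>)) powr p'"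
      using X0 p' by (intro powr_mono2) (auto intro: add_nonneg_nonneg)
    also have "\<dots> = 2 powr p' * max (X d \<omega>) (X (- d) \<omega>) powr p'" using X0 by (simp add: powr_mult)
    also have "\<dots> \<le> 2 powr p' * (X d \<omega> powr p' + X (- d) \<omega> powr p')" by (intro mult_left_mono) (auto simp: max_def)
    finally show "ennreal (envelope d (\<zeta> [] \<omega>) powr p') \<le> ennreal (2 powr p') * (ennreal (X d \<omega> powr p') + ennreal (X (- d) \<omega> powr p'))"
      unfolding env by (simp add: ennreal_leI flip: ennreal_plus ennreal_mult)
  qed
  also have "\<dots> = ennreal (2 powr p') * ((\<integral>\<^sup>+\<omega>. ennreal (X d \<omega> powr p') \<partial>M) + (\<integral>\<^sup>+\<omega>. ennreal (X (- d) \<omega> powr p') \<partial>M))"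
    by (subst nn_integral_cmult, measurable) (subst nn_integral_add, auto)
  also have "\<dots> < \<infinity>" using fin[of d] fin[of "- d"] by (simp add: ennreal_mult_less_top ennreal_add_less_top)
  finally have "brw_exp_moments M \<zeta> d p'"
    using d(1) p' by (intro brw_exp_moments.intro branching_random_walk_axioms brw_exp_moments_axioms.intro) auto
  then show ?thesis using p' by blast
qed

context brw_exp_moments
begin

text \<open>On a short window the terms of order three and higher are at most B |t|^3, and this is
  at most a quarter of \<kappa>2 t^2 once |t| <= \<kappa>2 / (4 B).\<close>

lemma radius_exists:
  assumes F: "F holomorphic_on ball 0 R" and R: "R > 0" and k2: "kappa M \<zeta> 2 > 0"
    and phi: "\<And>x. \<bar>x\<bar> < R \<Longrightarrow> F (of_real x) = of_real (phi M \<zeta> x)" and s: "s > 0"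
  shows "\<exists>\<eta>>0. \<eta> < s \<and> \<eta> \<le> pi \<and> (\<exists>K3\<ge>0. \<forall>t. \<bar>t\<bar> \<le> \<eta> \<longrightarrow> remainder_bounds F K3 t)"
proof -
  have h: "(deriv ^^ j) F 0 = of_real (kappa M \<zeta> j)" for j
    using higher_deriv_of_holomorphic[OF F phi, of 0 j] R by (simp add: kappa_def)
  define r1 where "r1 = R / 2"
  obtain K where K: "K \<ge> 0" "\<And>z. norm z \<le> r1 \<Longrightarrow> norm (F z - (\<Sum>i\<le>4. (deriv ^^ i) F 0 * z ^ i / fact i)) \<le> K * norm z ^ Suc 4"
    using Taylor_holomorphic_bound[OF F, of r1 4] R unfolding r1_def by auto
  define P where "P = log_remainder F"
  define Pl where "Pl t = - \<i> * complex_of_real (kappa M \<zeta> 3 * t ^ 3 / 6) + of_real (kappa M \<zeta> 4 * t ^ 4 / 24)" for t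
  have T: "norm (P t - Pl t) \<le> K * \<bar>t\<bar> ^ 5" if "\<bar>t\<bar> \<le> r1" for t
  proof -
    have "F 0 = of_real (kappa M \<zeta> 0)" using h[of 0] by simp
    moreover have "(\<Sum>i\<le>4. (deriv ^^ i) F 0 * (\<i> * of_real t) ^ i / fact i)
      = of_real (kappa M \<zeta> 0) + \<i> * of_real (kappa M \<zeta> 1 * t) - of_real (kappa M \<zeta> 2 * t\<^sup>2 / 2) + Pl t"
    proof -
      have s4: "{..4::nat} = {0,1,2,3,4}" by auto
      have i4: "\<i> ^ 4 = 1" "\<i> ^ 3 = - \<i>" by (simp_all add: eval_nat_numeral)
      show ?thesis unfolding h s4 Pl_def by (simp add: power_mult_distrib i4 fact_numeral)
    qed
    ultimately have "P t - Pl t = F (\<i> * of_real t) - (\<Sum>i\<le>4. (deriv ^^ i) F 0 * (\<i> * of_real t) ^ i / fact i)"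
      by (simp add: P_def log_remainder_def)
    then show ?thesis using K(2)[of "\<i> * of_real t"] that by (simp add: norm_mult eval_nat_numeral)
  qed
  define B where "B = \<bar>kappa M \<zeta> 3\<bar> + \<bar>kappa M \<zeta> 4\<bar> + K + 1"
  have B: "B > 0" using K(1) by (simp add: B_def)
  define \<eta> where "\<eta> = min (min (s / 2) r1) (min 1 (kappa M \<zeta> 2 / (4 * B)))"
  have \<eta>: "\<eta> > 0" "\<eta> < s" "\<eta> \<le> r1" "\<eta> \<le> 1" "\<eta> \<le> kappa M \<zeta> 2 / (4 * B)"
    using s R k2 B by (auto simp: \<eta>_def r1_def)
  have small: "norm (P t) \<le> kappa M \<zeta> 2 * t\<^sup>2 / 4" if t: "\<bar>t\<bar> \<le> \<eta>" for t
  proof -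
    have t1: "\<bar>t\<bar> \<le> 1" using t \<eta> by simp
    have p: "\<bar>t\<bar> ^ 4 \<le> \<bar>t\<bar> ^ 3" "\<bar>t\<bar> ^ 5 \<le> \<bar>t\<bar> ^ 3" by (rule power_decreasing; simp add: t1)+
    have "norm (Pl t) \<le> norm (- \<i> * complex_of_real (kappa M \<zeta> 3 * t ^ 3 / 6)) + norm (complex_of_real (kappa M \<zeta> 4 * t ^ 4 / 24))"
      unfolding Pl_def by (rule norm_triangle_ineq)
    also have "\<dots> = \<bar>kappa M \<zeta> 3\<bar> * \<bar>t\<bar> ^ 3 / 6 + \<bar>kappa M \<zeta> 4\<bar> * \<bar>t\<bar> ^ 4 / 24"
      unfolding norm_mult norm_of_real by (simp add: abs_mult power_abs)
    also have "\<dots> \<le> \<bar>kappa M \<zeta> 3\<bar> * \<bar>t\<bar> ^ 3 + \<bar>kappa M \<zeta> 4\<bar> * \<bar>t\<bar> ^ 3"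
    proof (rule add_mono)
      have "0 \<le> \<bar>kappa M \<zeta> 3\<bar> * \<bar>t\<bar> ^ 3" by simp
      then show "\<bar>kappa M \<zeta> 3\<bar> * \<bar>t\<bar> ^ 3 / 6 \<le> \<bar>kappa M \<zeta> 3\<bar> * \<bar>t\<bar> ^ 3" by linarith
      have "\<bar>kappa M \<zeta> 4\<bar> * \<bar>t\<bar> ^ 4 \<le> \<bar>kappa M \<zeta> 4\<bar> * \<bar>t\<bar> ^ 3" using p by (intro mult_left_mono) auto
      moreover have "0 \<le> \<bar>kappa M \<zeta> 4\<bar> * \<bar>t\<bar> ^ 4" by simp
      ultimately show "\<bar>kappa M \<zeta> 4\<bar> * \<bar>t\<bar> ^ 4 / 24 \<le> \<bar>kappa M \<zeta> 4\<bar> * \<bar>t\<bar> ^ 3" by linarith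
    qed
    finally have "norm (Pl t) \<le> \<bar>kappa M \<zeta> 3\<bar> * \<bar>t\<bar> ^ 3 + \<bar>kappa M \<zeta> 4\<bar> * \<bar>t\<bar> ^ 3" .
    moreover have "norm (P t - Pl t) \<le> K * \<bar>t\<bar> ^ 3"
      using T[of t] t \<eta> mult_left_mono[OF p(2) K(1)] by simp
    moreover have "norm (P t) \<le> norm (P t - Pl t) + norm (Pl t)" using norm_triangle_ineq[of "P t - Pl t" "Pl t"] by simp
    moreover have "0 \<le> \<bar>t\<bar> ^ 3" by simp
    ultimately have "norm (P t) \<le> B * \<bar>t\<bar> ^ 3" unfolding B_def distrib_right by linarith
    also have "\<dots> = (B * \<bar>t\<bar>) * t\<^sup>2" by (simp add: power3_eq_cube power2_eq_square mult_ac)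
    also have "\<dots> \<le> (kappa M \<zeta> 2 / 4) * t\<^sup>2"
    proof (rule mult_right_mono)
      have "B * \<bar>t\<bar> \<le> B * (kappa M \<zeta> 2 / (4 * B))" using t \<eta>(5) B by (intro mult_left_mono) auto
      then show "B * \<bar>t\<bar> \<le> kappa M \<zeta> 2 / 4" using B by simp
    qed simp
    finally show ?thesis by simp
  qed
  show ?thesis
    using \<eta> pi_ge_two K(1) T small unfolding remainder_bounds_def P_def Pl_def
    by (intro exI[of _ \<eta>] conjI exI[of _ K] allI impI) auto
qed

end

theorem theorem2p17:
  fixes M :: "'a measure" and \<zeta> :: "nat list \<Rightarrow> 'a \<Rightarrow> int list"
    and Winf :: "real \<Rightarrow> 'a \<Rightarrow> real" and u :: "nat \<Rightarrow> 'a \<Rightarrow> int"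
  assumes P: "prob_space M"
    and indep: "prob_space.indep_vars M (\<lambda>_. count_space UNIV) \<zeta> UNIV"
    and ident: "\<And>v. distr M (count_space UNIV) (\<zeta> v) = distr M (count_space UNIV) (\<zeta> [])"
    and A: "\<exists>k1 k2. k1 \<noteq> k2 \<and> vartheta1 M \<zeta> k1 > 0 \<and> vartheta1 M \<zeta> k2 > 0"
    and B1: "AE \<omega> in M. Npop \<zeta> 1 \<omega> \<noteq> 0"
    and B2: "(\<integral>\<^sup>+\<omega>. of_nat (Npop \<zeta> 1 \<omega>) \<partial>M) < \<infinity>"
    and B3: "mean_offspring M \<zeta> > 1"
    and C: "0 \<in> interior {\<beta>. laplace M \<zeta> \<beta> < \<infinity>}"
    and D: "\<exists>p::real>1. \<forall>K. compact K \<and> K \<subseteq> {\<beta>. beta_minus M \<zeta> < ereal \<beta> \<and> ereal \<beta> < beta_plus M \<zeta>}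
              \<longrightarrow> (SUP \<beta>\<in>K. \<integral>\<^sup>+\<omega>. ennreal (Wn M \<zeta> 1 \<beta> \<omega> powr p) \<partial>M) < \<infinity>"
    and E: "\<not> (\<exists>h::int \<ge> 2. \<exists>a::int. \<forall>k. vartheta1 M \<zeta> k > 0 \<longrightarrow> h dvd (k - a))"
    and Winf: "AE \<omega> in M. \<forall>\<beta>. beta_minus M \<zeta> < ereal \<beta> \<and> ereal \<beta> < beta_plus M \<zeta>
                 \<longrightarrow> (\<lambda>n. Wn M \<zeta> n \<beta> \<omega>) \<longlonglongrightarrow> Winf \<beta> \<omega>"
    and mode: "\<And>n \<omega> k. L \<zeta> n k \<omega> \<le> L \<zeta> n (u n \<omega>) \<omega>"
  defines "ustar \<equiv> \<lambda>n \<omega>. deriv (phi M \<zeta>) 0 * real n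
              + deriv (\<lambda>\<beta>. Winf \<beta> \<omega>) 0 / Winf 0 \<omega>
              - kappa M \<zeta> 3 / (2 * kappa M \<zeta> 2)"
  shows "(AE \<omega> in M. \<exists>N. \<forall>n>N.
            u n \<omega> = \<lfloor>ustar n \<omega>\<rfloor> \<or> u n \<omega> = \<lceil>ustar n \<omega>\<rceil>)
       \<and> (AE \<omega> in M.
            (\<lambda>n. sqrt (2 * pi * real n) * sqrt (kappa M \<zeta> 2) * real (height \<zeta> n \<omega>)
                   / (Winf 0 \<omega> * mean_offspring M \<zeta> ^ n)
                 - (1 - 1 / (2 * kappa M \<zeta> 2 * real n) *
                     (kappa M \<zeta> 3 ^ 2 / (6 * kappa M \<zeta> 2 ^ 2)
                      - kappa M \<zeta> 4 / (4 * kappa M \<zeta> 2)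
                      + dist_Z (ustar n \<omega>) ^ 2
                      + deriv (deriv (\<lambda>\<beta>. ln (Winf \<beta> \<omega>))) 0)))
            \<in> o(\<lambda>n. 1 / real n))"
proof -
  interpret branching_random_walk M \<zeta>
    using P indep ident by (intro branching_random_walk.intro branching_random_walk_axioms.intro)
  obtain \<delta>0 where d0: "brw_exp_moments M \<zeta> \<delta>0 1" using exp_moments_1[OF C] by blast
  \<comment> \<open>The number a is determined by M and \<zeta> alone, so the pass with exponent 1
    already settles a > 1, which the step to higher moments requires.\<close>
  have "brw_exp_moments.a M \<zeta> > 1" using B3 brw_exp_moments.mean_offspring_eq[OF d0] by simp
  from brw_exp_moments.higher_moments[OF d0 this D] obtain \<delta> p where dp: "brw_exp_moments M \<zeta> \<delta> p" "p > 1" by blast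
  interpret brw_exp_moments M \<zeta> \<delta> p by (rule dp(1))
  have a: "a > 1" using B3 mean_offspring_eq by simp
  obtain k0 k1 where k: "vartheta1 M \<zeta> k0 > 0" "vartheta1 M \<zeta> k1 > 0" "k1 \<noteq> k0" using A by blast
  have a0: "a > 0" using a by simp
  from log_m[OF a0] obtain R F where R: "R > 0" "R < \<delta>" and F: "F holomorphic_on ball 0 R"
    and mF: "\<And>z. norm z < R \<Longrightarrow> m z = of_real a * exp (F z - F 0)" and phi: "\<And>x. \<bar>x\<bar> < R \<Longrightarrow> F (of_real x) = of_real (phi M \<zeta> x)"
    by blast
  have k2: "kappa M \<zeta> 2 > 0" by (rule kappa2_pos[OF a0 R F mF phi k])
  obtain \<epsilon> where \<epsilon>: "\<epsilon> > 0" "\<And>x. \<bar>x\<bar> < \<epsilon> \<Longrightarrow> beta_minus M \<zeta> < ereal x \<and> ereal x < beta_plus M \<zeta>"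
    using beta_interval[OF a] by blast
  obtain r C \<rho> where "brw_contraction M \<zeta> \<delta> p r C \<rho>" using key_bound[OF a dp(2)] by blast
  then interpret brw_contraction M \<zeta> \<delta> p r C \<rho> .
  \<comment> \<open>W lives on the disc of radius r/2 and the logarithm on that of radius R; r' fits
    into both.\<close>
  define r' where "r' = min (r / 2) (R / 2)"
  have r': "r' > 0" "r' \<le> r / 2" "r' < R" using r R by (auto simp: r'_def)
  from radius_exists[OF F R(1) k2 phi r'(1)] obtain \<eta> K3 where \<eta>: "0 < \<eta>" "\<eta> < r'" "\<eta> \<le> pi" and K3: "K3 \<ge> 0"
    and psi: "\<And>t. \<bar>t\<bar> \<le> \<eta> \<Longrightarrow> remainder_bounds F K3 t"
    by blast
  have lt: "norm (m (\<i> * of_real t)) < a" if "t \<noteq> 0" "\<bar>t\<bar> \<le> pi" for t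
    by (rule norm_m_imag_less[OF E k that])
  obtain \<theta>2 where \<theta>2: "\<theta>2 > 0" "\<theta>2 < 1" and away: "AE \<omega> in M. \<exists>K\<ge>0. \<forall>n. (\<integral>\<^sup>+t\<in>{-pi..pi} - {-\<eta>..\<eta>}. ennreal (norm (gen_sum \<zeta> (\<i> * of_real t) n \<omega> / of_real (a ^ n))) \<partial>lborel) \<le> ennreal (K * \<theta>2 ^ n)"
    using AE_Fourier_away[OF lt \<eta>(1,3)] by blast
  have ne: "AE \<omega> in M. \<zeta> [] \<omega> \<noteq> []"
    using B1
  proof eventually_elim
    case (elim \<omega>)
    have "complex_of_nat (Npop \<zeta> 1 \<omega>) = of_nat (length (\<zeta> [] \<omega>))"
      unfolding gen_sum_zero[symmetric] gen_sum_1 offspring_sum_0 ..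
    with elim show ?case by auto
  qed
  \<comment> \<open>Four almost sure events are intersected: holomorphic convergence, decay of the
    outer Fourier integral, survival, and convergence to \<open>Winf\<close>. On them the argument
    is deterministic.\<close>
  have "AE \<omega> in M. (\<exists>N. \<forall>n>N. u n \<omega> = \<lfloor>ustar n \<omega>\<rfloor> \<or> u n \<omega> = \<lceil>ustar n \<omega>\<rceil>) \<and> (\<lambda>n. sqrt (2 * pi * real n) * sqrt (kappa M \<zeta> 2) * real (height \<zeta> n \<omega>)
         / (Winf 0 \<omega> * mean_offspring M \<zeta> ^ n)
       - (1 - 1 / (2 * kappa M \<zeta> 2 * real n) *
           (kappa M \<zeta> 3 ^ 2 / (6 * kappa M \<zeta> 2 ^ 2)
            - kappa M \<zeta> 4 / (4 * kappa M \<zeta> 2)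
            + dist_Z (ustar n \<omega>) ^ 2
            + deriv (deriv (\<lambda>\<beta>. ln (Winf \<beta> \<omega>))) 0))) \<in> o(\<lambda>n. 1 / real n)"
    using AE_limit away AE_not_dies_out[OF ne] Winf
  proof eventually_elim
    case (elim \<omega>)
    from elim(1) obtain W K1 where W: "W holomorphic_on ball 0 (r / 2)" and K1: "K1 \<ge> 0"
      and lim: "\<And>n z. norm z \<le> r / 2 \<Longrightarrow> norm (gen_sum \<zeta> z n \<omega> / m z ^ n - W z) \<le> K1 * root 4 \<rho> ^ n" by blast
    from elim(2) obtain K2 where K2: "K2 \<ge> 0" and aw: "\<And>n. (\<integral>\<^sup>+t\<in>{-pi..pi} - {-\<eta>..\<eta>}. ennreal (norm (gen_sum \<zeta> (\<i> * of_real t) n \<omega> / of_real (a ^ n))) \<partial>lborel) \<le> ennreal (K2 * \<theta>2 ^ n)"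
      by blast
    have root: "0 < root 4 \<rho>" "root 4 \<rho> < 1" using \<rho> by (auto simp: real_root_lt_1_iff)
    have W': "W holomorphic_on ball 0 r'" using W by (rule holomorphic_on_subset) (use r' in auto)
    have lim': "norm (gen_sum \<zeta> z n \<omega> / m z ^ n - W z) \<le> K1 * root 4 \<rho> ^ n" if "norm z \<le> r'" for n z
      using that r' by (intro lim) simp
    have Wi: "(\<lambda>n. Wn M \<zeta> n x \<omega>) \<longlonglongrightarrow> Winf x \<omega>" if "\<bar>x\<bar> < \<epsilon>" for x
      using elim(4) \<epsilon>(2)[OF that] by blast
    note res = profile_asymptotics[where Winf="\<lambda>\<beta>. Winf \<beta> \<omega>" and u="\<lambda>n. u n \<omega>" and \<omega>=\<omega>,
        OF a R(1) F mF phi k2 \<eta>(1,3,2) r'(3) K3 psi W' K1 root lim' K2 \<theta>2 aw elim(3) \<epsilon>(1) Wi mode]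
    show ?case unfolding ustar_def mean_offspring_eq using res by blast
  qed
  then show ?thesis by (auto elim: eventually_mono)
qed

end
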